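(* Let $H=\mathbb{R}^{n-1}\times(0,\infty)$ be the upper half-space, with points written $(x,y)$, $x\in\mathbb{R}^{n-1}$, $y>0$. Let $\mu$ be a finite Lévy measure on $[0,\infty)$, i.e. $\mu\ge0$ and $\kappa:=\mu([0,\infty))<\infty$, associated to the symbol $$\Phi(\lambda)=\lambda+\int_0^\infty(1-e^{-\lambda z})\,\mu(\mathrm{d}z),\qquad \lambda>0.$$ Let $f\in H_\Phi(\mathbb{R}^{n-1})\cap\dot H^{-1/2}(\mathbb{R}^{n-1})$ and consider the solution $u$ of the problem $$\begin{cases}\Delta u(x,y)=0 & \text{in }H,\\ u(x,0)=f(x) & \text{on }\partial H.\end{cases}$$ Define the nonlocal boundary operator $K$ by $$Kf(x):=\partial_yu(x,0)+\int_0^\infty\bigl(u(x,z)-u(x,0)\bigr)\,\mu(\mathrm{d}z).$$ Then, in Fourier symbols, $$\widehat{Kf}(\xi)=-\Phi(|\xi|)\,\widehat f(\xi),$$ $Kf\in L^2(\mathbb{R}^{n-1})$ and $u\in L^2(H)$.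
   Context: The Fourier transform is $\widehat\varphi(\xi)=\int_{\mathbb{R}^{n-1}}e^{-ix\cdot\xi}\varphi(x)\,\mathrm{d}x$. For $s\in\mathbb{R}$, the homogeneous Sobolev space $\dot H^s(\mathbb{R}^{n-1})$ is the space of tempered distributions $\varphi$ on $\mathbb{R}^{n-1}$ whose Fourier transform belongs to $L^1_{\mathrm{loc}}(\mathbb{R}^{n-1})$ and satisfies $\|\varphi\|_{\dot H^s(\mathbb{R}^{n-1})}^2:=\int_{\mathbb{R}^{n-1}}|\xi|^{2s}|\widehat\varphi(\xi)|^2\,\mathrm{d}\xi<\infty$. The space $H_\Phi$ is $$H_\Phi(\mathbb{R}^{n-1}):=\{\varphi\in L^2(\mathbb{R}^{n-1}):\ \Phi(|\xi|)\,\widehat\varphi(\xi)\in L^2(\mathbb{R}^{n-1})\},$$ with norm $\|\varphi\|_{H_\Phi}=\|\Phi(|\cdot|)\,\widehat\varphi\|_{L^2}$. Standing assumption: $\kappa>0$. *)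

theory Defs
  imports "HOL-Analysis.Analysis"
begin

(* Boundary space: an arbitrary euclidean space 'a, playing the role of R^(n-1), n >= 2.
   Points (x, y) of R^n are elements of 'a \<times> real. *)

subsection \<open>Square-integrable functions\<close>

(* Functions rather than a.e. classes. *)
definition L2_space :: "'b measure \<Rightarrow> ('b \<Rightarrow> complex) set" where
  "L2_space M = {f \<in> borel_measurable M. integrable M (\<lambda>x. (norm (f x))\<^sup>2)}"

definition L2_norm :: "'b measure \<Rightarrow> ('b \<Rightarrow> complex) \<Rightarrow> real" where
  "L2_norm M f = sqrt (LINT x|M. (norm (f x))\<^sup>2)"

(* The membership conditions are needed because the integral of a non-integrable function is 0. *)
definition L2_tendsto ::
  "'b measure \<Rightarrow> ('c \<Rightarrow> 'b \<Rightarrow> complex) \<Rightarrow> ('b \<Rightarrow> complex) \<Rightarrow> 'c filter \<Rightarrow> bool" where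
  "L2_tendsto M F g net \<longleftrightarrow>
     g \<in> L2_space M \<and> (\<forall>\<^sub>F t in net. F t \<in> L2_space M) \<and>
     ((\<lambda>t. L2_norm M (\<lambda>x. F t x - g x)) \<longlongrightarrow> 0) net"

subsection \<open>Partial derivatives and smoothness\<close>

(* pderivs [b1,...,bk] f is the iterated directional derivative of f along bk, then ..., then b1. *)
fun pderivs :: "'b::euclidean_space list \<Rightarrow> ('b \<Rightarrow> complex) \<Rightarrow> 'b \<Rightarrow> complex" where
  "pderivs [] f = f"
| "pderivs (b # bs) f = (\<lambda>x. frechet_derivative (pderivs bs f) (at x) b)"

(* Intended for open S, where "at x within S" agrees with "at x". *)
definition C_k_on :: "nat \<Rightarrow> ('b::euclidean_space \<Rightarrow> complex) \<Rightarrow> 'b set \<Rightarrow> bool" where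
  "C_k_on k f S \<longleftrightarrow>
     (\<forall>bs. set bs \<subseteq> Basis \<and> length bs < k \<longrightarrow> pderivs bs f differentiable_on S) \<and>
     (\<forall>bs. set bs \<subseteq> Basis \<and> length bs \<le> k \<longrightarrow> continuous_on S (pderivs bs f))"

definition smooth :: "('b::euclidean_space \<Rightarrow> complex) \<Rightarrow> bool" where
  "smooth f \<longleftrightarrow> (\<forall>k. C_k_on k f UNIV)"

definition laplacian :: "('b::euclidean_space \<Rightarrow> complex) \<Rightarrow> 'b \<Rightarrow> complex" where
  "laplacian f x = (\<Sum>b\<in>Basis. pderivs [b, b] f x)"

definition harmonic_on :: "('b::euclidean_space \<Rightarrow> complex) \<Rightarrow> 'b set \<Rightarrow> bool" where
  "harmonic_on f S \<longleftrightarrow> C_k_on 2 f S \<and> (\<forall>x\<in>S. laplacian f x = 0)"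

subsection \<open>Tempered distributions and the Fourier transform\<close>

definition schwartz_space :: "('a::euclidean_space \<Rightarrow> complex) set" where
  "schwartz_space = {\<phi>. smooth \<phi> \<and>
     (\<forall>k bs. set bs \<subseteq> Basis \<longrightarrow> bounded (range (\<lambda>x. norm x ^ k *\<^sub>R pderivs bs \<phi> x)))}"

definition test_functions :: "('a::euclidean_space \<Rightarrow> complex) set" where
  "test_functions = {\<phi>. smooth \<phi> \<and> compact (closure {x. \<phi> x \<noteq> 0})}"

definition schwartz_seminorm :: "nat \<Rightarrow> ('a::euclidean_space \<Rightarrow> complex) \<Rightarrow> real" where
  "schwartz_seminorm N \<phi> =
     (\<Sum>bs | set bs \<subseteq> Basis \<and> length bs \<le> N. SUP x. (1 + norm x) ^ N * norm (pderivs bs \<phi> x))"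

(* Functionals are only relevant through their values on schwartz_space. *)
definition tempered_distribution :: "(('a::euclidean_space \<Rightarrow> complex) \<Rightarrow> complex) \<Rightarrow> bool" where
  "tempered_distribution T \<longleftrightarrow>
     (\<forall>\<phi>\<in>schwartz_space. \<forall>\<psi>\<in>schwartz_space. T (\<lambda>x. \<phi> x + \<psi> x) = T \<phi> + T \<psi>) \<and>
     (\<forall>c. \<forall>\<phi>\<in>schwartz_space. T (\<lambda>x. c * \<phi> x) = c * T \<phi>) \<and>
     (\<exists>N C. \<forall>\<phi>\<in>schwartz_space. norm (T \<phi>) \<le> C * schwartz_seminorm N \<phi>)"

definition regular_distribution ::
  "('a::euclidean_space \<Rightarrow> complex) \<Rightarrow> ('a \<Rightarrow> complex) \<Rightarrow> complex" where
  "regular_distribution f = (\<lambda>\<phi>. LINT x|lborel. f x * \<phi> x)"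

definition fourier_integral :: "('a::euclidean_space \<Rightarrow> complex) \<Rightarrow> 'a \<Rightarrow> complex" where
  "fourier_integral \<phi> \<xi> = (LINT x|lborel. exp (- (\<i> * complex_of_real (x \<bullet> \<xi>))) * \<phi> x)"

definition L1_loc :: "('a::euclidean_space \<Rightarrow> complex) set" where
  "L1_loc = {g \<in> borel_measurable lborel. \<forall>A. compact A \<longrightarrow> set_integrable lborel A g}"

(* The Fourier transform of the tempered distribution T, i.e. the functional sending \<phi> to
   T (fourier_integral \<phi>), is the locally integrable function g. Equality is tested on
   compactly supported functions, since g times a Schwartz function need not be integrable;
   test functions being dense in the Schwartz space, this determines the transform. *)
definition has_fourier ::
  "(('a::euclidean_space \<Rightarrow> complex) \<Rightarrow> complex) \<Rightarrow> ('a \<Rightarrow> complex) \<Rightarrow> bool" where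
  "has_fourier T g \<longleftrightarrow>
     g \<in> L1_loc \<and> (\<forall>\<phi>\<in>test_functions. T (fourier_integral \<phi>) = regular_distribution g \<phi>)"

abbreviation has_fourier_fun :: "('a::euclidean_space \<Rightarrow> complex) \<Rightarrow> ('a \<Rightarrow> complex) \<Rightarrow> bool" where
  "has_fourier_fun f g \<equiv> has_fourier (regular_distribution f) g"

definition homogeneous_sobolev ::
  "real \<Rightarrow> (('a::euclidean_space \<Rightarrow> complex) \<Rightarrow> complex) set" where
  "homogeneous_sobolev s = {T. tempered_distribution T \<and>
     (\<exists>g. has_fourier T g \<and>
          integrable lborel (\<lambda>\<xi>. norm \<xi> powr (2 * s) * (norm (g \<xi>))\<^sup>2))}"

subsection \<open>The symbol and the associated space\<close>

definition levy_symbol :: "real measure \<Rightarrow> real \<Rightarrow> real" where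
  "levy_symbol \<mu> l = l + (LINT z|\<mu>. 1 - exp (- (l * z)))"

definition H_symbol :: "(real \<Rightarrow> real) \<Rightarrow> ('a::euclidean_space \<Rightarrow> complex) set" where
  "H_symbol \<Phi> = {f \<in> L2_space lborel.
     \<exists>g. has_fourier_fun f g \<and> (\<lambda>\<xi>. complex_of_real (\<Phi> (norm \<xi>)) * g \<xi>) \<in> L2_space lborel}"

subsection \<open>The Dirichlet problem and the boundary operator\<close>

definition half_space :: "('a::euclidean_space \<times> real) set" where
  "half_space = {(x, y). 0 < y}"

(* The Dirichlet problem with L2 datum f. The boundary value is attained in the L2 sense, and
   uniform boundedness of the slices singles out one solution: without it, any function with
   horizontal Fourier transform sinh (y |\<xi>|) g(\<xi>), g smooth and compactly supported, could be
   added. The values on the boundary itself are those of the given representative f. *)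
definition dirichlet_solution ::
  "('a::euclidean_space \<Rightarrow> complex) \<Rightarrow> ('a \<times> real \<Rightarrow> complex) \<Rightarrow> bool" where
  "dirichlet_solution f u \<longleftrightarrow>
     harmonic_on u half_space \<and>
     (\<forall>x. u (x, 0) = f x) \<and>
     (\<forall>y>0. (\<lambda>x. u (x, y)) \<in> L2_space lborel) \<and>
     bdd_above ((\<lambda>y. L2_norm lborel (\<lambda>x. u (x, y))) ` {0<..}) \<and>
     L2_tendsto lborel (\<lambda>y x. u (x, y)) f (at_right 0)"

(* One-sided y-derivative at y = 0, as the L2 limit of the difference quotients. *)
definition has_normal_derivative ::
  "('a::euclidean_space \<times> real \<Rightarrow> complex) \<Rightarrow> ('a \<Rightarrow> complex) \<Rightarrow> bool" where
  "has_normal_derivative u g \<longleftrightarrow>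
     L2_tendsto lborel (\<lambda>h x. (u (x, h) - u (x, 0)) / complex_of_real h) g (at_right 0)"

(* Unique up to null sets where it exists. *)
definition normal_derivative :: "('a::euclidean_space \<times> real \<Rightarrow> complex) \<Rightarrow> 'a \<Rightarrow> complex" where
  "normal_derivative u = (SOME g. has_normal_derivative u g)"

definition nonlocal_boundary_op ::
  "real measure \<Rightarrow> ('a::euclidean_space \<times> real \<Rightarrow> complex) \<Rightarrow> 'a \<Rightarrow> complex" where
  "nonlocal_boundary_op \<mu> u x = normal_derivative u x + (LINT z|\<mu>. u (x, z) - u (x, 0))"

end

theory Submission
  imports Defs "HOL-Probability.Probability"
begin

text \<open>
  On the Fourier side the solution of the Dirichlet problem is \<open>exp (- y \<bar>\<xi>\<bar>) fh(\<xi>)\<close>: the Poisson integral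
  with this transform is harmonic and attains the datum in $L^2$, and the difference \<open>w\<close> of two solutions
  vanishes, because \<open>\<bar>w\<bar>\<^sup>2\<close> is subharmonic and so the slice energy \<open>E(y) = \<integral> \<bar>w(x, y)\<bar>\<^sup>2 dx\<close> is convex
  in \<open>y\<close>, bounded, and tends to 0 at the boundary. The normal derivative then has the symbol
  \<open>- \<bar>\<xi>\<bar>\<close>, the jump part the symbol \<open>\<integral> (exp (- z \<bar>\<xi>\<bar>) - 1) \<mu>(dz)\<close> by Fubini, and
  \<open>\<integral> exp (- 2 y \<bar>\<xi>\<bar>) dy = 1 / (2 \<bar>\<xi>\<bar>)\<close> turns the \<open>H\<^sup>-\<^sup>1\<^sup>/\<^sup>2\<close> norm of the datum into the $L^2$ norm on the half-space.
\<close>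

section \<open>Preliminaries on L^2 spaces and Lebesgue measure\<close>

subsection \<open>Square-integrable functions\<close>

text \<open>Why uniqueness is an energy argument: transforming the Laplace equation in x would need
  control of x-integrals of derivatives of u, and a solution brings only a uniform L^2 bound on its
  slices. The energy localised by a cutoff of radius R needs no more: moving the horizontal second
  derivatives onto the cutoff costs at most a constant times R^(-2) times that bound, and this
  defect of convexity disappears as R grows. The second obstacle is the notion of transform. The
  hypotheses provide a locally integrable function tested against smooth compactly supported
  functions, while slices and integrals over slices call for a stable L^2 notion. The relation
  \<open>fourier_pair\<close>, duality against every function that is both integrable and square
  integrable, plays this role: linear combinations and integrals in z act on it directly, and
  uniqueness against test functions identifies the two notions almost everywhere. In the boundary
  operator, the weight Phi controls the normal derivative because |xi| \<le> Phi(|xi|), and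
  finiteness of \<mu> makes the jump part a bounded multiplier.\<close>

lemma L2_spaceD:
  assumes "f \<in> L2_space M"
  shows "f \<in> borel_measurable M" "integrable M (\<lambda>x. (norm (f x))\<^sup>2)"
  using assms by (auto simp: L2_space_def)

lemma L2_norm_nonneg [simp]: "0 \<le> L2_norm M f"
  by (simp add: L2_norm_def)

lemma L2_norm_sq: "(L2_norm M f)\<^sup>2 = (LINT x|M. (norm (f x))\<^sup>2)"
  by (simp add: L2_norm_def)

lemma L2_space_bound:
  assumes "g \<in> L2_space M" "f \<in> borel_measurable M" "AE x in M. norm (f x) \<le> C * norm (g x)"
  shows "f \<in> L2_space M"
proof -
  note [measurable] = assms(2) L2_spaceD(1)[OF assms(1)]
  have "integrable M (\<lambda>x. C\<^sup>2 * (norm (g x))\<^sup>2)"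
    using L2_spaceD(2)[OF assms(1)] by simp
  then have "integrable M (\<lambda>x. (norm (f x))\<^sup>2)"
  proof (rule Bochner_Integration.integrable_bound)
    show "AE x in M. norm ((norm (f x))\<^sup>2) \<le> norm (C\<^sup>2 * (norm (g x))\<^sup>2)"
      using assms(3)
    proof (rule AE_mp, intro AE_I2 impI)
      fix x assume "norm (f x) \<le> C * norm (g x)"
      then have "(norm (f x))\<^sup>2 \<le> (C * norm (g x))\<^sup>2"
        by (intro power_mono) auto
      then show "norm ((norm (f x))\<^sup>2) \<le> norm (C\<^sup>2 * (norm (g x))\<^sup>2)"
        by (simp add: power_mult_distrib)
    qed
  qed measurable
  then show ?thesis using assms(2) by (simp add: L2_space_def)
qed

lemma L2_space_cong_AE:
  assumes "g \<in> L2_space M" "f \<in> borel_measurable M" "AE x in M. f x = g x"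
  shows "f \<in> L2_space M"
  by (rule L2_space_bound[where C=1, OF assms(1,2)]) (use assms(3) in auto)

lemma L2_norm_cong_AE:
  assumes "f \<in> borel_measurable M" "g \<in> borel_measurable M" "AE x in M. f x = g x"
  shows "L2_norm M f = L2_norm M g"
  unfolding L2_norm_def using assms by (intro arg_cong[where f=sqrt] integral_cong_AE) auto

lemma L2_space_cmult:
  assumes "f \<in> L2_space M" shows "(\<lambda>x. c * f x) \<in> L2_space M"
proof -
  note [measurable] = L2_spaceD(1)[OF assms]
  show ?thesis by (rule L2_space_bound[OF assms, of _ "norm c"]) (auto simp: norm_mult)
qed

lemma L2_norm_cmult: "L2_norm M (\<lambda>x. c * f x) = norm c * L2_norm M f"
  by (simp add: L2_norm_def norm_mult power_mult_distrib real_sqrt_mult)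

lemma borel_measurable_cnj [measurable (raw)]:
  "f \<in> borel_measurable M \<Longrightarrow> (\<lambda>x. cnj (f x)) \<in> borel_measurable M"
  by (rule measurable_compose[where N=borel])
    (auto intro!: borel_measurable_continuous_onI continuous_intros)

lemma L2_space_cnj: "f \<in> L2_space M \<Longrightarrow> (\<lambda>x. cnj (f x)) \<in> L2_space M"
  unfolding L2_space_def by (auto intro: borel_measurable_cnj)

lemma square_norm_add_le: "(norm (a + b :: complex))\<^sup>2 \<le> 2 * (norm a)\<^sup>2 + 2 * (norm b)\<^sup>2"
proof -
  have "(norm (a + b))\<^sup>2 \<le> (norm a + norm b)\<^sup>2" by (intro power_mono norm_triangle_ineq) auto
  also have "\<dots> \<le> 2 * (norm a)\<^sup>2 + 2 * (norm b)\<^sup>2"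
    using sum_squares_bound[of "norm a" "norm b"] by (simp add: power2_sum)
  finally show ?thesis .
qed

lemma L2_space_add:
  assumes "f \<in> L2_space M" "g \<in> L2_space M"
  shows "(\<lambda>x. f x + g x) \<in> L2_space M"
proof -
  note [measurable] = L2_spaceD(1)[OF assms(1)] L2_spaceD(1)[OF assms(2)]
  have "integrable M (\<lambda>x. 2 * (norm (f x))\<^sup>2 + 2 * (norm (g x))\<^sup>2)"
    using L2_spaceD(2)[OF assms(1)] L2_spaceD(2)[OF assms(2)] by simp
  then have "integrable M (\<lambda>x. (norm (f x + g x))\<^sup>2)"
    by (rule Bochner_Integration.integrable_bound) (auto simp: square_norm_add_le)
  then show ?thesis by (simp add: L2_space_def)
qed

lemma L2_space_diff:
  assumes "f \<in> L2_space M" "g \<in> L2_space M"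
  shows "(\<lambda>x. f x - g x) \<in> L2_space M"
  using L2_space_add[OF assms(1) L2_space_cmult[OF assms(2), of "-1"]] by simp

lemma L2_mult_integrable:
  assumes "f \<in> L2_space M" "g \<in> L2_space M"
  shows "integrable M (\<lambda>x. f x * g x)"
proof -
  note [measurable] = L2_spaceD(1)[OF assms(1)] L2_spaceD(1)[OF assms(2)]
  have "integrable M (\<lambda>x. (norm (f x))\<^sup>2 + (norm (g x))\<^sup>2)"
    using L2_spaceD(2)[OF assms(1)] L2_spaceD(2)[OF assms(2)] by simp
  then show ?thesis
  proof (rule Bochner_Integration.integrable_bound, measurable, intro AE_I2)
    fix x
    have "norm (f x) * norm (g x) \<le> (norm (f x))\<^sup>2 + (norm (g x))\<^sup>2"
      using sum_squares_bound[of "norm (f x)" "norm (g x)"] mult_nonneg_nonneg[OF norm_ge_zero[of "f x"] norm_ge_zero[of "g x"]]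
      by linarith
    then show "norm (f x * g x) \<le> norm ((norm (f x))\<^sup>2 + (norm (g x))\<^sup>2)"
      by (simp add: norm_mult)
  qed
qed

lemma L2_Cauchy_Schwarz:
  assumes f: "f \<in> L2_space M" and g: "g \<in> L2_space M"
  shows "(LINT x|M. norm (f x * g x)) \<le> L2_norm M f * L2_norm M g"
    and "norm (LINT x|M. f x * g x) \<le> L2_norm M f * L2_norm M g"
proof -
  note [measurable] = L2_spaceD(1)[OF f] L2_spaceD(1)[OF g]
  have sq: "(\<integral>\<^sup>+x. ennreal (norm (h x)) ^ 2 \<partial>M) = ennreal ((L2_norm M h)\<^sup>2)" if "h \<in> L2_space M" for h
    using L2_spaceD(2)[OF that] by (simp add: L2_norm_sq ennreal_power nn_integral_eq_integral)
  have int: "(\<integral>\<^sup>+x. ennreal (norm (f x)) * ennreal (norm (g x)) \<partial>M) = ennreal (LINT x|M. norm (f x * g x))"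
    using L2_mult_integrable[OF f g]
    by (subst nn_integral_eq_integral[symmetric, OF integrable_norm]) (auto simp: norm_mult ennreal_mult)
  have "ennreal (LINT x|M. norm (f x * g x)) ^ 2 \<le> ennreal ((L2_norm M f)\<^sup>2) * ennreal ((L2_norm M g)\<^sup>2)"
    using Cauchy_Schwarz_nn_integral[of "\<lambda>x. ennreal (norm (f x))" M "\<lambda>x. ennreal (norm (g x))"]
    unfolding int sq[OF f] sq[OF g] by simp
  then have "ennreal ((LINT x|M. norm (f x * g x))\<^sup>2) \<le> ennreal ((L2_norm M f * L2_norm M g)\<^sup>2)"
    by (simp add: ennreal_power ennreal_mult[symmetric] power_mult_distrib)
  then have "(LINT x|M. norm (f x * g x))\<^sup>2 \<le> (L2_norm M f * L2_norm M g)\<^sup>2"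
    by (simp add: ennreal_le_iff)
  then show *: "(LINT x|M. norm (f x * g x)) \<le> L2_norm M f * L2_norm M g"
    by (rule power2_le_imp_le) simp
  show "norm (LINT x|M. f x * g x) \<le> L2_norm M f * L2_norm M g"
    using integral_norm_bound[of M "\<lambda>x. f x * g x"] * by linarith
qed

lemma L2_norm_triangle:
  assumes f: "f \<in> L2_space M" and g: "g \<in> L2_space M"
  shows "L2_norm M (\<lambda>x. f x + g x) \<le> L2_norm M f + L2_norm M g"
proof (rule power2_le_imp_le)
  note [measurable] = L2_spaceD(1)[OF f] L2_spaceD(1)[OF g]
  note i = L2_spaceD(2)[OF f] L2_spaceD(2)[OF g] integrable_norm[OF L2_mult_integrable[OF f g]]
  have "(L2_norm M (\<lambda>x. f x + g x))\<^sup>2 = (LINT x|M. (norm (f x + g x))\<^sup>2)" by (rule L2_norm_sq)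
  also have "\<dots> \<le> (LINT x|M. (norm (f x))\<^sup>2 + 2 * norm (f x * g x) + (norm (g x))\<^sup>2)"
  proof (rule integral_mono)
    show "integrable M (\<lambda>x. (norm (f x + g x))\<^sup>2)"
      by (rule L2_spaceD(2)[OF L2_space_add[OF f g]])
    show "integrable M (\<lambda>x. (norm (f x))\<^sup>2 + 2 * norm (f x * g x) + (norm (g x))\<^sup>2)"
      using i by simp
    fix x
    have "(norm (f x + g x))\<^sup>2 \<le> (norm (f x) + norm (g x))\<^sup>2"
      by (intro power_mono norm_triangle_ineq) auto
    then show "(norm (f x + g x))\<^sup>2 \<le> (norm (f x))\<^sup>2 + 2 * norm (f x * g x) + (norm (g x))\<^sup>2"
      by (simp add: power2_sum norm_mult)
  qed
  also have "\<dots> = (L2_norm M f)\<^sup>2 + 2 * (LINT x|M. norm (f x * g x)) + (L2_norm M g)\<^sup>2"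
    using i by (simp add: L2_norm_sq)
  also have "\<dots> \<le> (L2_norm M f + L2_norm M g)\<^sup>2"
    using L2_Cauchy_Schwarz(1)[OF f g] by (simp add: power2_sum)
  finally show "(L2_norm M (\<lambda>x. f x + g x))\<^sup>2 \<le> (L2_norm M f + L2_norm M g)\<^sup>2" .
qed simp

lemma L2_norm_minus_commute: "L2_norm M (\<lambda>x. f x - g x) = L2_norm M (\<lambda>x. g x - f x)"
  by (simp add: L2_norm_def norm_minus_commute)

lemma L2_norm_triangle_diff:
  assumes f: "f \<in> L2_space M" and g: "g \<in> L2_space M" and h: "h \<in> L2_space M"
  shows "L2_norm M (\<lambda>x. f x - h x) \<le> L2_norm M (\<lambda>x. f x - g x) + L2_norm M (\<lambda>x. g x - h x)"
  using L2_norm_triangle[OF L2_space_diff[OF f g] L2_space_diff[OF g h]] by simp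

text \<open>A Cauchy criterion with an explicit rate; the weights \<open>2 ^ n\<close> make the increments summable
  almost everywhere, which avoids Minkowski's inequality for series.\<close>

lemma L2_complete_rate:
  fixes g :: "nat \<Rightarrow> 'b \<Rightarrow> complex"
  assumes g: "\<And>n. g n \<in> L2_space M"
    and fast: "\<And>m n. m \<le> n \<Longrightarrow> (L2_norm M (\<lambda>x. g n x - g m x))\<^sup>2 \<le> (1/4) ^ m"
  obtains h where "h \<in> L2_space M" "\<And>m. (L2_norm M (\<lambda>x. h x - g m x))\<^sup>2 \<le> (1/4) ^ m"
proof -
  note [measurable] = L2_spaceD(1)[OF g]
  have sq: "(\<integral>\<^sup>+x. ennreal ((norm (k x))\<^sup>2) \<partial>M) = ennreal ((L2_norm M k)\<^sup>2)" if "k \<in> L2_space M" for k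
    using L2_spaceD(2)[OF that] by (simp add: L2_norm_sq nn_integral_eq_integral)
  define d where "d n x = g (Suc n) x - g n x" for n x
  have d: "d n \<in> L2_space M" for n
    unfolding d_def[abs_def] by (intro L2_space_diff g)
  note [measurable] = L2_spaceD(1)[OF d]
  have "(\<integral>\<^sup>+x. (\<Sum>n. ennreal (2^n * (norm (d n x))\<^sup>2)) \<partial>M) = (\<Sum>n. \<integral>\<^sup>+x. ennreal (2^n * (norm (d n x))\<^sup>2) \<partial>M)"
    by (rule nn_integral_suminf) measurable
  also have "\<dots> = (\<Sum>n. ennreal (2^n * (L2_norm M (d n))\<^sup>2))"
    by (simp add: ennreal_mult nn_integral_cmult sq[OF d])
  \<comment> \<open>The rate (1/4)^n beats the weight 2^n and leaves a convergent geometric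
    series.\<close>
  also have "\<dots> \<le> (\<Sum>n. ennreal ((1/2)^n))"
  proof (intro suminf_le ennreal_leI)
    fix n
    have "(L2_norm M (d n))\<^sup>2 \<le> (1/4) ^ n" using fast[of n "Suc n"] by (simp add: d_def[abs_def])
    then have "2^n * (L2_norm M (d n))\<^sup>2 \<le> 2^n * (1/4) ^ n" by (intro mult_left_mono) auto
    also have "\<dots> = (1/2)^n" by (simp add: power_mult_distrib[symmetric])
    finally show "2^n * (L2_norm M (d n))\<^sup>2 \<le> (1/2)^n" .
  qed auto
  also have "\<dots> < \<infinity>"
  proof -
    have "(\<Sum>n. ennreal ((1/2)^n)) = ennreal (\<Sum>n. (1/2)^n)"
      by (intro suminf_ennreal2) (auto simp: summable_geometric_iff)
    then show ?thesis by simp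
  qed
  finally have fin: "(\<integral>\<^sup>+x. (\<Sum>n. ennreal (2^n * (norm (d n x))\<^sup>2)) \<partial>M) \<noteq> \<infinity>" by simp
  have "AE x in M. (\<Sum>n. ennreal (2^n * (norm (d n x))\<^sup>2)) \<noteq> \<infinity>"
    by (rule nn_integral_noteq_infinite[OF _ fin]) measurable
  then have conv: "AE x in M. convergent (\<lambda>n. g n x)"
  proof (rule AE_mp, intro AE_I2 impI)
    fix x assume "(\<Sum>n. ennreal (2^n * (norm (d n x))\<^sup>2)) \<noteq> \<infinity>"
    then have sm: "summable (\<lambda>n. 2^n * (norm (d n x))\<^sup>2)"
      by (intro summable_suminf_not_top) auto
    have "summable (\<lambda>n. 2^n * (norm (d n x))\<^sup>2 + (1/2)^n)"
      by (intro summable_add sm) (auto simp: summable_geometric_iff)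
    then have "summable (\<lambda>n. d n x)"
    proof (rule summable_comparison_test'[where N=0])
      fix n
      \<comment> \<open>The arithmetic-geometric mean inequality, with the weight split as 2^(n/2)
        times 2^(-n/2), bounds the increment itself by two summable terms.\<close>
      have "2 * (sqrt (2^n) * norm (d n x)) * sqrt ((1/2)^n) \<le> (sqrt (2^n) * norm (d n x))\<^sup>2 + (sqrt ((1/2)^n))\<^sup>2"
        by (rule sum_squares_bound)
      moreover have "sqrt (2^n) * sqrt ((1/2)^n) = 1"
        by (simp add: real_sqrt_mult[symmetric] power_mult_distrib[symmetric])
      then have "2 * (sqrt (2^n) * norm (d n x)) * sqrt ((1/2)^n) = 2 * norm (d n x)"
        by (simp add: algebra_simps)
      ultimately have "2 * norm (d n x) \<le> 2^n * (norm (d n x))\<^sup>2 + (1/2)^n"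
        by (simp add: power_mult_distrib)
      then show "norm (d n x) \<le> 2^n * (norm (d n x))\<^sup>2 + (1/2)^n"
        using norm_ge_zero[of "d n x"] by linarith
    qed
    then have "convergent (\<lambda>n. g n x - g 0 x)"
      unfolding d_def by (subst (asm) summable_iff_convergent)
        (simp add: sum_lessThan_telescope[of "\<lambda>n. g n x"])
    from convergent_add[OF this convergent_const[of "g 0 x"]] show "convergent (\<lambda>n. g n x)"
      by simp
  qed
  define h where "h x = lim (\<lambda>n. g n x)" for x
  have [measurable]: "h \<in> borel_measurable M"
    unfolding h_def[abs_def] by measurable
  have lim: "AE x in M. (\<lambda>n. g n x) \<longlonglongrightarrow> h x"
    using conv by (rule AE_mp) (auto simp: h_def convergent_LIMSEQ_iff)
  \<comment> \<open>Fatou's lemma carries the Cauchy estimate, valid for all n \<ge> m, over to the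
    pointwise limit.\<close>
  have bound: "(\<integral>\<^sup>+x. ennreal ((norm (h x - g m x))\<^sup>2) \<partial>M) \<le> ennreal ((1/4) ^ m)" for m
  proof -
    have "(\<integral>\<^sup>+x. ennreal ((norm (h x - g m x))\<^sup>2) \<partial>M) = (\<integral>\<^sup>+x. liminf (\<lambda>n. ennreal ((norm (g n x - g m x))\<^sup>2)) \<partial>M)"
    proof (rule nn_integral_cong_AE, rule AE_mp[OF lim], intro AE_I2 impI)
      fix x assume "(\<lambda>n. g n x) \<longlonglongrightarrow> h x"
      then have "(\<lambda>n. ennreal ((norm (g n x - g m x))\<^sup>2)) \<longlonglongrightarrow> ennreal ((norm (h x - g m x))\<^sup>2)"
        by (intro tendsto_intros)
      then show "ennreal ((norm (h x - g m x))\<^sup>2) = liminf (\<lambda>n. ennreal ((norm (g n x - g m x))\<^sup>2))"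
        by (rule lim_imp_Liminf[OF trivial_limit_sequentially, symmetric])
    qed
    also have "\<dots> \<le> liminf (\<lambda>n. (\<integral>\<^sup>+x. ennreal ((norm (g n x - g m x))\<^sup>2) \<partial>M))"
      by (rule nn_integral_liminf) measurable
    also have "\<dots> = liminf (\<lambda>n. ennreal ((L2_norm M (\<lambda>x. g n x - g m x))\<^sup>2))"
      by (simp add: sq[OF L2_space_diff[OF g g]])
    also have "\<dots> \<le> limsup (\<lambda>n. ennreal ((L2_norm M (\<lambda>x. g n x - g m x))\<^sup>2))"
      by (rule Liminf_le_Limsup) simp
    also have "\<dots> \<le> ennreal ((1/4) ^ m)"
      by (intro Limsup_bounded eventually_sequentiallyI[of m] ennreal_leI fast)
    finally show ?thesis .
  qed
  have hg: "(\<lambda>x. h x - g m x) \<in> L2_space M" for m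
    unfolding L2_space_def
  proof (safe)
    show "integrable M (\<lambda>x. (norm (h x - g m x))\<^sup>2)"
      using bound[of m] by (intro integrableI_bounded) (auto intro: order.strict_trans1)
  qed measurable
  have "h \<in> L2_space M"
    using L2_space_add[OF hg[of 0] g[of 0]] by simp
  moreover have "(L2_norm M (\<lambda>x. h x - g m x))\<^sup>2 \<le> (1/4) ^ m" for m
    using bound[of m] unfolding sq[OF hg] by (simp add: ennreal_le_iff)
  ultimately show ?thesis by (rule that)
qed

subsection \<open>Affine substitutions and product integrands\<close>

lemma lborel_integral_affine:
  fixes f :: "'a::euclidean_space \<Rightarrow> 'b::{banach, second_countable_topology}"
  assumes c: "c \<noteq> 0" and f [measurable]: "f \<in> borel_measurable borel"
  shows "(LINT x|lborel. f x) = \<bar>c\<bar> ^ DIM('a) *\<^sub>R (LINT x|lborel. f (t + c *\<^sub>R x))"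
    and "integrable lborel f \<longleftrightarrow> integrable lborel (\<lambda>x. f (t + c *\<^sub>R x))"
proof -
  let ?M = "distr lborel borel (\<lambda>x::'a. t + c *\<^sub>R x)"
  have eq: "(lborel :: 'a measure) = density ?M (\<lambda>_. \<bar>c\<bar> ^ DIM('a))"
    by (rule lborel_affine[OF c])
  have "(LINT x|lborel. f x) = (LINT x|density ?M (\<lambda>_. \<bar>c\<bar> ^ DIM('a)). f x)"
    by (rule arg_cong[where f="\<lambda>M. integral\<^sup>L M f", OF eq])
  also have "\<dots> = \<bar>c\<bar> ^ DIM('a) *\<^sub>R (LINT x|lborel. f (t + c *\<^sub>R x))"
    by (subst integral_density) (auto simp: integral_distr)
  finally show "(LINT x|lborel. f x) = \<bar>c\<bar> ^ DIM('a) *\<^sub>R (LINT x|lborel. f (t + c *\<^sub>R x))" .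
  have "integrable lborel f \<longleftrightarrow> integrable (density ?M (\<lambda>_. \<bar>c\<bar> ^ DIM('a))) f"
    by (rule arg_cong[where f="\<lambda>M. integrable M f", OF eq])
  also have "\<dots> \<longleftrightarrow> integrable lborel (\<lambda>x. \<bar>c\<bar> ^ DIM('a) *\<^sub>R f (t + c *\<^sub>R x))"
    by (subst integrable_density) (simp_all add: integrable_distr_eq)
  also have "\<dots> \<longleftrightarrow> integrable lborel (\<lambda>x. f (t + c *\<^sub>R x))"
    using integrable_scaleR_right[of "1 / \<bar>c\<bar> ^ DIM('a)" lborel "\<lambda>x. \<bar>c\<bar> ^ DIM('a) *\<^sub>R f (t + c *\<^sub>R x)"] c
    by auto
  finally show "integrable lborel f \<longleftrightarrow> integrable lborel (\<lambda>x. f (t + c *\<^sub>R x))" .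
qed

lemma lborel_integral_translate:
  fixes f :: "'a::euclidean_space \<Rightarrow> 'b::{banach, second_countable_topology}"
  assumes "f \<in> borel_measurable borel"
  shows "(LINT x|lborel. f (x + t)) = (LINT x|lborel. f x)"
  using lborel_integral_affine(1)[OF _ assms, of 1 t] by (simp add: add.commute)

lemma lborel_integrable_translate:
  fixes f :: "'a::euclidean_space \<Rightarrow> 'b::{banach, second_countable_topology}"
  assumes "f \<in> borel_measurable borel"
  shows "integrable lborel (\<lambda>x. f (x + t)) \<longleftrightarrow> integrable lborel f"
  using lborel_integral_affine(2)[OF _ assms, of 1 t] by (simp add: add.commute)

lemma lborel_integral_reflect:
  fixes f :: "'a::euclidean_space \<Rightarrow> 'b::{banach, second_countable_topology}"
  assumes "f \<in> borel_measurable borel"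
  shows "(LINT x|lborel. f (- x)) = (LINT x|lborel. f x)"
  using lborel_integral_affine(1)[OF _ assms, of "-1" 0] by simp

lemma lborel_integrable_reflect:
  fixes f :: "'a::euclidean_space \<Rightarrow> 'b::{banach, second_countable_topology}"
  assumes "f \<in> borel_measurable borel"
  shows "integrable lborel (\<lambda>x. f (- x)) \<longleftrightarrow> integrable lborel f"
  using lborel_integral_affine(2)[OF _ assms, of "-1" 0] by simp

lemma L2_translate:
  fixes f :: "'a::euclidean_space \<Rightarrow> complex"
  assumes "f \<in> L2_space lborel"
  shows "(\<lambda>x. f (x + t)) \<in> L2_space lborel" "L2_norm lborel (\<lambda>x. f (x + t)) = L2_norm lborel f"
proof -
  have [measurable]: "f \<in> borel_measurable borel" using L2_spaceD(1)[OF assms] by simp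
  have m: "(\<lambda>x. (norm (f x))\<^sup>2) \<in> borel_measurable borel" by measurable
  show "(\<lambda>x. f (x + t)) \<in> L2_space lborel"
    using L2_spaceD(2)[OF assms] lborel_integrable_translate[OF m, of t] by (simp add: L2_space_def)
  show "L2_norm lborel (\<lambda>x. f (x + t)) = L2_norm lborel f"
    using lborel_integral_translate[OF m, of t] by (simp add: L2_norm_def)
qed

lemma L2_reflect:
  fixes f :: "'a::euclidean_space \<Rightarrow> complex"
  assumes "f \<in> L2_space lborel"
  shows "(\<lambda>x. f (- x)) \<in> L2_space lborel" "L2_norm lborel (\<lambda>x. f (- x)) = L2_norm lborel f"
proof -
  have [measurable]: "f \<in> borel_measurable borel" using L2_spaceD(1)[OF assms] by simp
  have m: "(\<lambda>x. (norm (f x))\<^sup>2) \<in> borel_measurable borel" by measurable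
  show "(\<lambda>x. f (- x)) \<in> L2_space lborel"
    using L2_spaceD(2)[OF assms] lborel_integrable_reflect[OF m] by (simp add: L2_space_def)
  show "L2_norm lborel (\<lambda>x. f (- x)) = L2_norm lborel f"
    using lborel_integral_reflect[OF m] by (simp add: L2_norm_def)
qed

text \<open>\<open>lborel\<close> is the image of a finite product of one-dimensional Lebesgue
  measures, so integrands that factor over the coordinates reduce to dimension one. This serves the
  Gaussian and the exponential weights.\<close>

lemma lborel_integral_prod_Basis:
  fixes f :: "'a::euclidean_space \<Rightarrow> real \<Rightarrow> complex"
  assumes f: "\<And>b. b \<in> Basis \<Longrightarrow> integrable lborel (f b)"
  shows "integrable lborel (\<lambda>x. \<Prod>b\<in>Basis. f b (x \<bullet> b))"
    and "(LINT x|lborel. (\<Prod>b\<in>Basis. f b (x \<bullet> b))) = (\<Prod>b\<in>Basis. (LINT t|lborel. f b t))"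
proof -
  interpret product_sigma_finite "\<lambda>_::'a. lborel :: real measure" ..
  have [measurable]: "f b \<in> borel_measurable borel" if "b \<in> Basis" for b
    using borel_measurable_integrable[OF f[OF that]] by simp
  have eq: "(\<Prod>b\<in>Basis. f b ((\<Sum>c\<in>Basis. g c *\<^sub>R c) \<bullet> b)) = (\<Prod>b\<in>Basis. f b (g b))" for g
    by (intro prod.cong refl) simp
  have m: "(\<lambda>g. \<Sum>c\<in>Basis. g c *\<^sub>R c) \<in> (\<Pi>\<^sub>M b\<in>(Basis::'a set). lborel) \<rightarrow>\<^sub>M borel" by measurable
  have [measurable]: "(\<lambda>x::'a. \<Prod>b\<in>Basis. f b (x \<bullet> b)) \<in> borel_measurable borel" by measurable
  show "integrable lborel (\<lambda>x. \<Prod>b\<in>Basis. f b (x \<bullet> b))"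
    unfolding lborel_eq[where ?'a='a]
    by (subst integrable_distr_eq[OF m]) (auto simp: eq intro!: product_integrable_prod f)
  show "(LINT x|lborel. (\<Prod>b\<in>Basis. f b (x \<bullet> b))) = (\<Prod>b\<in>Basis. (LINT t|lborel. f b t))"
    unfolding lborel_eq[where ?'a='a]
    by (subst integral_distr[OF m]) (auto simp: eq intro!: product_integral_prod f)
qed

section \<open>Plancherel theory by Gaussian summation\<close>

subsection \<open>The Gaussian\<close>

text \<open>The standard normal density on the whole space. It has mass 1 and its transform is a
  multiple of itself, so the number \<open>gauss 0\<close> carries all normalising constants of the
  Fourier theory.\<close>

definition gauss :: "'a::euclidean_space \<Rightarrow> real" where
  "gauss z = (\<Prod>b\<in>Basis. std_normal_density (z \<bullet> b))"

lemma gauss_0: "gauss (0::'a::euclidean_space) = (1 / sqrt (2 * pi)) ^ DIM('a)"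
  by (simp add: gauss_def std_normal_density_def)

lemma gauss_0_pos: "0 < gauss (0::'a::euclidean_space)"
  by (simp add: gauss_0)

text \<open>The origin of the factor (2 pi)^n in Plancherel's theorem: \<open>gauss 0\<close> enters
  there once through the transform of the Gaussian and once as the limit of the regularising
  weight.\<close>

lemma gauss_0_square: "(gauss (0::'a::euclidean_space))\<^sup>2 * (2 * pi) ^ DIM('a) = 1"
proof -
  have "(gauss (0::'a))\<^sup>2 = ((1 / sqrt (2 * pi))\<^sup>2) ^ DIM('a)"
    by (simp only: gauss_0 power_mult[symmetric] mult.commute)
  then show ?thesis
    by (simp add: power_divide)
qed

lemma norm_square_eq_sum_Basis: "(norm z)\<^sup>2 = (\<Sum>b\<in>Basis. (z \<bullet> b)\<^sup>2)"
  unfolding power2_norm_eq_inner by (subst euclidean_inner) (simp add: power2_eq_square)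

lemma exp_norm_square_eq_prod_Basis: "exp (- (norm z)\<^sup>2 / 2) = (\<Prod>b\<in>Basis. exp (- (z \<bullet> b)\<^sup>2 / 2))"
  by (subst exp_sum[symmetric]) (simp_all add: norm_square_eq_sum_Basis sum_negf sum_divide_distrib)

lemma gauss_eq: "gauss (z::'a::euclidean_space) = gauss (0::'a) * exp (- (norm z)\<^sup>2 / 2)"
proof -
  have "gauss z = (1 / sqrt (2 * pi)) ^ DIM('a) * (\<Prod>b\<in>Basis. exp (- (z \<bullet> b)\<^sup>2 / 2))"
    unfolding gauss_def std_normal_density_def prod.distrib by simp
  then show ?thesis unfolding gauss_0 exp_norm_square_eq_prod_Basis .
qed

lemma gauss_nonneg [simp]: "0 \<le> gauss z"
  by (simp add: gauss_def prod_nonneg)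

lemma gauss_le: "gauss (z::'a::euclidean_space) \<le> gauss (0::'a)"
  using gauss_0_pos[where 'a='a] by (subst gauss_eq) (simp add: mult_le_cancel_left1)

lemma gauss_measurable [measurable]: "(gauss :: 'a::euclidean_space \<Rightarrow> real) \<in> borel_measurable borel"
  unfolding gauss_def[abs_def] by measurable

lemma gauss_minus [simp]: "gauss (- z) = gauss z"
  by (subst (1 2) gauss_eq) simp

lemma gauss_tendsto:
  assumes "(e \<longlongrightarrow> 0) F" shows "((\<lambda>n. gauss (e n *\<^sub>R (z::'a::euclidean_space))) \<longlongrightarrow> gauss (0::'a)) F"
proof -
  have "((\<lambda>n. gauss (0::'a) * exp (- (norm (e n *\<^sub>R z))\<^sup>2 / 2)) \<longlongrightarrow> gauss (0::'a) * exp (- (norm (0 *\<^sub>R z))\<^sup>2 / 2)) F"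
    by (intro tendsto_intros assms) simp
  then show ?thesis by (simp only: gauss_eq[symmetric]) simp
qed

lemma integrable_gauss: "integrable lborel (\<lambda>z::'a::euclidean_space. complex_of_real (gauss z))"
  and fourier_gauss: "fourier_integral (\<lambda>z. complex_of_real (gauss z)) (\<xi>::'a) = gauss \<xi> / gauss (0::'a)"
proof -
  have i: "integrable lborel (\<lambda>t. complex_of_real (std_normal_density t))"
    by simp
  show "integrable lborel (\<lambda>z::'a. complex_of_real (gauss z))"
    using lborel_integral_prod_Basis(1)[OF i] by (simp add: gauss_def)
  define g where "g b t = exp (- (\<i> * complex_of_real (t * (\<xi> \<bullet> b)))) * complex_of_real (std_normal_density t)" for b t
  have gi: "integrable lborel (g b)" for b
    unfolding g_def by (rule Bochner_Integration.integrable_bound[OF i]) (auto simp: norm_mult)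
  have "(LINT t|lborel. g b t) = exp (- (\<xi> \<bullet> b)\<^sup>2 / 2)" for b
  proof -
    \<comment> \<open>\<open>char\<close> integrates exp(i t x), so it is evaluated at the negative
      frequency to match the sign in \<open>fourier_integral\<close>.\<close>
    have "char std_normal_distribution (- (\<xi> \<bullet> b)) = (LINT t|lborel. g b t)"
      unfolding char_def
      unfolding g_def[abs_def] by (subst integral_density) (auto simp: scaleR_conv_of_real mult_ac)
    then show ?thesis unfolding char_std_normal_distribution by simp
  qed
  then have "(LINT x|lborel. (\<Prod>b\<in>Basis. g b (x \<bullet> b))) = (\<Prod>b\<in>Basis. complex_of_real (exp (- (\<xi> \<bullet> b)\<^sup>2 / 2)))"
    by (subst lborel_integral_prod_Basis(2)[OF gi]) simp
  also have "\<dots> = complex_of_real (\<Prod>b\<in>Basis. exp (- (\<xi> \<bullet> b)\<^sup>2 / 2))" by simp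
  also have "(\<Prod>b\<in>Basis. exp (- (\<xi> \<bullet> b)\<^sup>2 / 2)) = exp (- (norm \<xi>)\<^sup>2 / 2)"
    by (rule exp_norm_square_eq_prod_Basis[symmetric])
  also have "(\<lambda>x. \<Prod>b\<in>Basis. g b (x \<bullet> b)) = (\<lambda>x. exp (- (\<i> * complex_of_real (x \<bullet> \<xi>))) * complex_of_real (gauss x))"
  proof
    fix x :: 'a
    have "- (\<i> * complex_of_real (x \<bullet> \<xi>)) = (\<Sum>b\<in>Basis. - (\<i> * complex_of_real ((x \<bullet> b) * (\<xi> \<bullet> b))))"
      by (subst euclidean_inner) (simp add: sum_negf sum_distrib_left)
    then show "(\<Prod>b\<in>Basis. g b (x \<bullet> b)) = exp (- (\<i> * complex_of_real (x \<bullet> \<xi>))) * complex_of_real (gauss x)"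
      by (simp add: g_def gauss_def prod.distrib exp_sum del: of_real_mult)
  qed
  finally have "fourier_integral (\<lambda>z. complex_of_real (gauss z)) \<xi> = exp (- (norm \<xi>)\<^sup>2 / 2)"
    by (simp add: fourier_integral_def)
  then show "fourier_integral (\<lambda>z. complex_of_real (gauss z)) \<xi> = gauss \<xi> / gauss (0::'a)"
    using gauss_0_pos[where 'a='a] by (simp add: gauss_eq[of \<xi>])
qed

lemma integral_gauss: "(LINT z|lborel. complex_of_real (gauss (z::'a::euclidean_space))) = 1"
  using fourier_gauss[of "0::'a"] gauss_0_pos[where 'a='a] by (simp add: fourier_integral_def)

subsection \<open>The Fourier integral of integrable functions\<close>

lemma fourier_integrand_integrable:
  fixes f :: "'a::euclidean_space \<Rightarrow> complex"
  assumes "integrable lborel f"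
  shows "integrable lborel (\<lambda>x. exp (- (\<i> * complex_of_real (x \<bullet> \<xi>))) * f x)"
  using borel_measurable_integrable[OF assms]
  by (intro Bochner_Integration.integrable_bound[OF assms]) (auto simp: norm_mult)

lemma fourier_integral_measurable [measurable]:
  fixes f :: "'a::euclidean_space \<Rightarrow> complex"
  assumes "integrable lborel f"
  shows "fourier_integral f \<in> borel_measurable borel"
proof -
  have [measurable]: "f \<in> borel_measurable borel" using borel_measurable_integrable[OF assms] by simp
  show ?thesis unfolding fourier_integral_def[abs_def] by measurable
qed

lemma fourier_integral_bound:
  fixes f :: "'a::euclidean_space \<Rightarrow> complex"
  assumes "integrable lborel f"
  shows "norm (fourier_integral f \<xi>) \<le> (LINT x|lborel. norm (f x))"
proof -
  have "norm (fourier_integral f \<xi>) \<le> (LINT x|lborel. norm (exp (- (\<i> * complex_of_real (x \<bullet> \<xi>))) * f x))"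
    unfolding fourier_integral_def by (rule integral_norm_bound)
  then show ?thesis by (simp add: norm_mult)
qed

lemma fourier_integral_diff:
  assumes "integrable lborel f" "integrable lborel g"
  shows "fourier_integral (\<lambda>x. f x - g x) \<xi> = fourier_integral f \<xi> - fourier_integral g \<xi>"
  using fourier_integrand_integrable[OF assms(1), of \<xi>] fourier_integrand_integrable[OF assms(2), of \<xi>]
  unfolding fourier_integral_def by (simp add: right_diff_distrib)

lemma fourier_integral_cnj: "fourier_integral (\<lambda>x. cnj (f x)) \<xi> = cnj (fourier_integral f (- \<xi>))"
proof -
  have "fourier_integral (\<lambda>x. cnj (f x)) \<xi> = (LINT x|lborel. cnj (exp (- (\<i> * complex_of_real (x \<bullet> - \<xi>))) * f x))"
    unfolding fourier_integral_def by (rule Bochner_Integration.integral_cong[OF refl]) (simp add: exp_cnj)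
  also have "\<dots> = cnj (fourier_integral f (- \<xi>))"
    unfolding fourier_integral_def by (rule Bochner_Integration.integral_cnj)
  finally show ?thesis .
qed

text \<open>Fubini, with a kernel that has modulus 1 and is symmetric in x and \<xi>. This identity
  is the model for the relation \<open>fourier_pair\<close>.\<close>

lemma fourier_multiplication:
  fixes f g :: "'a::euclidean_space \<Rightarrow> complex"
  assumes f: "integrable lborel f" and g: "integrable lborel g"
  shows "(LINT \<xi>|lborel. fourier_integral f \<xi> * g \<xi>) = (LINT x|lborel. f x * fourier_integral g x)"
proof -
  have [measurable]: "f \<in> borel_measurable borel" "g \<in> borel_measurable borel"
    using borel_measurable_integrable[OF f] borel_measurable_integrable[OF g] by auto
  let ?F = "\<lambda>x \<xi>. exp (- (\<i> * complex_of_real (x \<bullet> \<xi>))) * f x * g \<xi>"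
  have int: "integrable (lborel \<Otimes>\<^sub>M lborel) (case_prod ?F)"
  proof (rule lborel_pair.Fubini_integrable)
    show "case_prod ?F \<in> borel_measurable (lborel \<Otimes>\<^sub>M lborel)" by measurable
    show "integrable lborel (\<lambda>x. LINT y|lborel. norm (case (x, y) of (x, \<xi>) \<Rightarrow> ?F x \<xi>))"
      using f g by (simp add: norm_mult)
    show "AE x in lborel. integrable lborel (\<lambda>y. case (x, y) of (x, \<xi>) \<Rightarrow> ?F x \<xi>)"
    proof (intro AE_I2)
      fix x :: 'a
      have "integrable lborel (\<lambda>y. f x * g y)" using g by simp
      then show "integrable lborel (\<lambda>y. case (x, y) of (x, \<xi>) \<Rightarrow> ?F x \<xi>)"
        by (rule Bochner_Integration.integrable_bound) (auto simp: norm_mult)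
    qed
  qed
  have "(LINT \<xi>|lborel. fourier_integral f \<xi> * g \<xi>) = (LINT \<xi>|lborel. (LINT x|lborel. ?F x \<xi>))"
    using fourier_integrand_integrable[OF f] by (simp add: fourier_integral_def)
  also have "\<dots> = (LINT x|lborel. (LINT \<xi>|lborel. ?F x \<xi>))"
    by (rule lborel_pair.Fubini_integral[OF int])
  also have "\<dots> = (LINT x|lborel. f x * fourier_integral g x)"
    unfolding fourier_integral_def
    by (intro Bochner_Integration.integral_cong refl, subst integral_mult_right_zero[symmetric])
      (simp only: inner_commute mult_ac)
  finally show ?thesis .
qed

subsection \<open>Continuous functions are dense in $L^2$\<close>

lemma L2_tendsto_0_dominated:
  fixes F :: "nat \<Rightarrow> 'b \<Rightarrow> complex"
  assumes [measurable]: "\<And>n. F n \<in> borel_measurable M" and G: "G \<in> L2_space M"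
    and lim: "AE x in M. (\<lambda>n. F n x) \<longlonglongrightarrow> 0"
    and bound: "\<And>n. AE x in M. norm (F n x) \<le> norm (G x)"
  shows "(\<lambda>n. L2_norm M (F n)) \<longlonglongrightarrow> 0"
proof -
  have "(\<lambda>n. LINT x|M. (norm (F n x))\<^sup>2) \<longlonglongrightarrow> (LINT x|M. 0)"
  proof (rule integral_dominated_convergence)
    show "integrable M (\<lambda>x. (norm (G x))\<^sup>2)" by (rule L2_spaceD(2)[OF G])
    show "AE x in M. (\<lambda>n. (norm (F n x))\<^sup>2) \<longlonglongrightarrow> 0"
      using lim by (rule AE_mp) (auto intro!: AE_I2 tendsto_eq_intros)
    show "AE x in M. norm ((norm (F n x))\<^sup>2) \<le> (norm (G x))\<^sup>2" for n
      using bound[of n] by (rule AE_mp) (auto intro!: AE_I2 power_mono)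
  qed measurable
  then have "(\<lambda>n. sqrt (LINT x|M. (norm (F n x))\<^sup>2)) \<longlonglongrightarrow> sqrt (LINT x|M. 0)"
    by (rule tendsto_real_sqrt)
  then show ?thesis by (simp add: L2_norm_def)
qed

lemma L2_space_bounded_support:
  fixes f :: "'a::euclidean_space \<Rightarrow> complex"
  assumes [measurable]: "f \<in> borel_measurable borel"
    and "\<And>x. norm (f x) \<le> B" "\<And>x. norm x > r \<Longrightarrow> f x = 0"
  shows "f \<in> L2_space lborel" "integrable lborel f"
proof -
  have fin: "emeasure lborel (cball (0::'a) r) < \<infinity>" by (intro emeasure_lborel_cball_finite)
  have "integrable lborel (\<lambda>x. indicator (cball (0::'a) r) x *\<^sub>R B)"
    using fin by (intro integrable_scaleR_left) auto
  then show "integrable lborel f"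
    by (rule Bochner_Integration.integrable_bound)
      (use assms(2,3) in \<open>auto intro!: AE_I2 simp: indicator_def not_le intro: order_trans[OF _ abs_ge_self]\<close>)
  have "integrable lborel (\<lambda>x. indicator (cball (0::'a) r) x *\<^sub>R B\<^sup>2)"
    using fin by (intro integrable_scaleR_left) auto
  then have "integrable lborel (\<lambda>x. (norm (f x))\<^sup>2)"
    by (rule Bochner_Integration.integrable_bound)
      (use assms(2,3) in \<open>auto intro!: AE_I2 power_mono simp: indicator_def not_le\<close>)
  then show "f \<in> L2_space lborel" by (simp add: L2_space_def)
qed

text \<open>Cutting both the argument and the value lands in L^1 as well as L^2, where the transform
  is an honest integral.\<close>

definition truncation :: "nat \<Rightarrow> ('a::euclidean_space \<Rightarrow> complex) \<Rightarrow> 'a \<Rightarrow> complex" where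
  "truncation k f x = (if norm x \<le> real k \<and> norm (f x) \<le> real k then f x else 0)"

lemma truncation_measurable [measurable]:
  "f \<in> borel_measurable borel \<Longrightarrow> truncation k f \<in> borel_measurable borel"
  unfolding truncation_def[abs_def]
  by (intro measurable_If borel_measurable_const) auto

lemma truncation_L2:
  assumes "f \<in> L2_space lborel"
  shows "truncation k f \<in> L2_space lborel" "integrable lborel (truncation k f)"
proof -
  have m: "truncation k f \<in> borel_measurable borel" using L2_spaceD(1)[OF assms] by simp
  show "truncation k f \<in> L2_space lborel" "integrable lborel (truncation k f)"
    by (rule L2_space_bounded_support[OF m, of "real k" "real k"]; simp add: truncation_def)+
qed

lemma truncation_tendsto:
  assumes f: "f \<in> L2_space lborel"
  shows "(\<lambda>k. L2_norm lborel (\<lambda>x. f x - truncation k f x)) \<longlonglongrightarrow> 0"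
proof (rule L2_tendsto_0_dominated[OF _ f])
  have [measurable]: "f \<in> borel_measurable borel" using L2_spaceD(1)[OF f] by simp
  show "(\<lambda>x. f x - truncation k f x) \<in> borel_measurable lborel" for k by measurable
  show "AE x in lborel. norm (f x - truncation k f x) \<le> norm (f x)" for k
    by (simp add: truncation_def)
  show "AE x in lborel. (\<lambda>k. f x - truncation k f x) \<longlonglongrightarrow> 0"
  proof (intro AE_I2 tendsto_eventually)
    fix x
    obtain N where "max (norm x) (norm (f x)) \<le> real N" using real_arch_simple by blast
    then show "\<forall>\<^sub>F k in sequentially. f x - truncation k f x = 0"
      by (intro eventually_sequentiallyI[of N]) (auto simp: truncation_def)
  qed
qed

text \<open>A truncated function is an almost everywhere limit of continuous functions, but these
  come without a common bound or support. Projecting their values to a ball and multiplying by a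
  continuous spatial cutoff supplies both and leaves the limit unchanged, so dominated convergence
  applies.\<close>

lemma L2_dense_continuous:
  fixes f :: "'a::euclidean_space \<Rightarrow> complex"
  assumes f: "f \<in> L2_space lborel" and "0 < e"
  obtains c B where "c \<in> L2_space lborel" "continuous_on UNIV c" "\<And>x. norm (c x) \<le> B"
    "L2_norm lborel (\<lambda>x. f x - c x) < e"
proof -
  obtain k where k: "L2_norm lborel (\<lambda>x. f x - truncation k f x) < e / 2"
    using truncation_tendsto[OF f, THEN order_tendstoD(2), of "e / 2"] \<open>0 < e\<close>
    by (auto simp: eventually_sequentially)
  define g where "g = truncation k f"
  have g: "g \<in> L2_space lborel" and [measurable]: "g \<in> borel_measurable borel"
    using truncation_L2[OF f] L2_spaceD(1)[OF truncation_L2(1)[OF f]] by (auto simp: g_def)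
  have "g \<in> borel_measurable lebesgue" by (intro measurable_completion) measurable
  then have "g measurable_on UNIV" by (rule lebesgue_measurable_imp_measurable_on) simp
  then obtain N G where N: "negligible N" and Gc: "\<And>n. continuous_on UNIV (G n)"
    and G: "\<And>x. x \<notin> N \<Longrightarrow> (\<lambda>n::nat. G n x) \<longlonglongrightarrow> g x"
    unfolding measurable_on_def by auto
  \<comment> \<open>The nearest-point projection is a continuous retraction onto the ball in which
    the truncated function takes its values.\<close>
  define p where "p = closest_point (cball (0::complex) (real k))"
  have pc: "continuous_on UNIV p" and pb: "norm (p w) \<le> real k" for w
    unfolding p_def
    by (intro continuous_on_closest_point, auto)
      (use closest_point_in_set[of "cball (0::complex) (real k)" w] in auto)
  have pid: "p w = w" if "norm w \<le> real k" for w
    using that by (auto simp: p_def closest_point_self)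
  define X where "X x = max 0 (1 + real k - norm x)" for x :: 'a
  define Y where "Y x = min 1 (X x)" for x :: 'a
  have Y: "continuous_on UNIV Y" "0 \<le> Y x" "Y x \<le> 1" "norm x \<le> real k \<Longrightarrow> Y x = 1" "norm x > real k + 1 \<Longrightarrow> Y x = 0" for x
    unfolding Y_def X_def by (auto intro!: continuous_intros)
  define c where "c n x = p (G n x) * complex_of_real (Y x)" for n x
  have cc: "continuous_on UNIV (c n)" for n
    unfolding c_def by (intro continuous_intros continuous_on_compose2[OF pc Gc] Y) auto
  then have cm [measurable]: "c n \<in> borel_measurable borel" for n
    by (rule borel_measurable_continuous_onI)
  have cb: "norm (c n x) \<le> real k" for n x
    using mult_mono[OF pb[of "G n x"] Y(3)[of x]] Y(2)[of x] by (simp add: c_def norm_mult)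
  have cs: "c n x = 0" if "norm x > real k + 1" for n x
    using Y(5)[OF that] by (simp add: c_def)
  have cL2: "c n \<in> L2_space lborel" for n
    by (rule L2_space_bounded_support[OF cm cb cs])
  define H where "H x = complex_of_real (2 * real k * indicator (cball (0::'a) (real k + 1)) x)" for x
  have H: "H \<in> L2_space lborel"
    by (rule L2_space_bounded_support[of _ "2 * real k" "real k + 1"])
      (measurable, auto simp: H_def[abs_def] indicator_def)
  have "(\<lambda>n. L2_norm lborel (\<lambda>x. g x - c n x)) \<longlonglongrightarrow> 0"
  proof (rule L2_tendsto_0_dominated[OF _ H])
    show "(\<lambda>x. g x - c n x) \<in> borel_measurable lborel" for n by measurable
    have gb: "norm (g x) \<le> real k" "norm x > real k + 1 \<Longrightarrow> g x = 0" for x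
      by (auto simp: g_def truncation_def)
    show "AE x in lborel. norm (g x - c n x) \<le> norm (H x)" for n
    proof (intro AE_I2)
      fix x
      have "norm (g x - c n x) \<le> 2 * real k"
        using norm_triangle_ineq4[of "g x" "c n x"] gb(1)[of x] cb[of n x] by linarith
      then show "norm (g x - c n x) \<le> norm (H x)"
        using gb(2)[of x] cs[of x n] by (cases "norm x > real k + 1") (auto simp: H_def)
    qed
    have "AE x in lebesgue. x \<notin> N"
      using N by (intro AE_not_in) (simp add: negligible_iff_null_sets)
    then have "AE x in lborel. x \<notin> N" by (simp add: AE_completion_iff)
    then show "AE x in lborel. (\<lambda>n. g x - c n x) \<longlonglongrightarrow> 0"
    proof (rule AE_mp, intro AE_I2 impI)
      fix x assume "x \<notin> N"
      then have "(\<lambda>n. p (G n x)) \<longlonglongrightarrow> p (g x)"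
        by (intro continuous_on_tendsto_compose[OF pc G]) auto
      then have "(\<lambda>n. c n x) \<longlonglongrightarrow> p (g x) * complex_of_real (Y x)"
        unfolding c_def by (intro tendsto_intros)
      also have "p (g x) * complex_of_real (Y x) = g x"
        using Y(4)[of x] pid[OF gb(1), of x] by (cases "norm x \<le> real k") (auto simp: g_def truncation_def)
      finally have "(\<lambda>n. c n x) \<longlonglongrightarrow> g x" .
      from tendsto_diff[OF tendsto_const[of "g x"] this] show "(\<lambda>n. g x - c n x) \<longlonglongrightarrow> 0"
        by simp
    qed
  qed
  from order_tendstoD(2)[OF this half_gt_zero[OF \<open>0 < e\<close>]]
  obtain n where n: "L2_norm lborel (\<lambda>x. g x - c n x) < e / 2"
    unfolding eventually_sequentially by blast
  have "L2_norm lborel (\<lambda>x. f x - c n x) < e"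
    using L2_norm_triangle_diff[OF f g cL2[of n]] k n by (simp add: g_def)
  with cL2 cc cb show ?thesis by (rule that)
qed

text \<open>Replacing g by a bounded continuous function c makes an error that is the same for every
  shift, by translation invariance of the L^2 norm; for c itself the limit follows by domination,
  since f is integrable.\<close>

lemma L2_correlation_tendsto:
  fixes f g :: "'a::euclidean_space \<Rightarrow> complex"
  assumes f: "f \<in> L2_space lborel" "integrable lborel f" and g: "g \<in> L2_space lborel"
    and t: "t \<longlonglongrightarrow> 0"
  shows "(\<lambda>n. LINT x|lborel. f x * g (x + t n)) \<longlonglongrightarrow> (LINT x|lborel. f x * g x)"
proof (rule metric_LIMSEQ_I)
  fix e :: real assume "0 < e"
  have [measurable]: "f \<in> borel_measurable borel" "g \<in> borel_measurable borel"
    using L2_spaceD(1)[OF f(1)] L2_spaceD(1)[OF g] by auto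
  define A where "A = L2_norm lborel f"
  \<comment> \<open>A quarter of e is spent on the shifted and a quarter on the unshifted
    correlation; A + 1 instead of A guards against f having norm 0.\<close>
  have "0 < e / (4 * (A + 1))" using \<open>0 < e\<close> by (simp add: A_def add_nonneg_pos)
  from L2_dense_continuous[OF g this] obtain c B where c: "c \<in> L2_space lborel" "continuous_on UNIV c"
    and B: "\<And>x. norm (c x) \<le> B" and gc: "L2_norm lborel (\<lambda>x. g x - c x) < e / (4 * (A + 1))" by blast
  have [measurable]: "c \<in> borel_measurable borel" using L2_spaceD(1)[OF c(1)] by simp
  have Ae: "A * L2_norm lborel (\<lambda>x. g x - c x) \<le> e / 4"
  proof -
    have "A * L2_norm lborel (\<lambda>x. g x - c x) \<le> (A + 1) * (e / (4 * (A + 1)))"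
      by (intro mult_mono) (use gc in \<open>auto simp: A_def\<close>)
    moreover have "0 \<le> A" by (simp add: A_def)
    then have "A + 1 \<noteq> 0" by linarith
    then have "(A + 1) * (e / (4 * (A + 1))) = e / 4" by (simp add: divide_simps)
    ultimately show ?thesis by (simp only:)
  qed
  have diff: "norm ((LINT x|lborel. f x * g (x + s)) - (LINT x|lborel. f x * c (x + s))) \<le> e / 4" for s
  proof -
    have "(LINT x|lborel. f x * g (x + s)) - (LINT x|lborel. f x * c (x + s)) = (LINT x|lborel. f x * (g (x + s) - c (x + s)))"
      using L2_mult_integrable[OF f(1) L2_translate(1)[OF g]] L2_mult_integrable[OF f(1) L2_translate(1)[OF c(1)]]
      by (simp add: right_diff_distrib)
    also have "norm \<dots> \<le> A * L2_norm lborel (\<lambda>x. g (x + s) - c (x + s))"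
      unfolding A_def by (intro L2_Cauchy_Schwarz f L2_translate(1)[OF L2_space_diff[OF g c(1)]])
    also have "\<dots> = A * L2_norm lborel (\<lambda>x. g x - c x)"
      using L2_translate(2)[OF L2_space_diff[OF g c(1)], of s] by simp
    finally show ?thesis using Ae by linarith
  qed
  have "(\<lambda>n. LINT x|lborel. f x * c (x + t n)) \<longlonglongrightarrow> (LINT x|lborel. f x * c x)"
  proof (rule integral_dominated_convergence)
    show "integrable lborel (\<lambda>x. norm (f x) * B)" using f(2) by simp
    show "AE x in lborel. (\<lambda>n. f x * c (x + t n)) \<longlonglongrightarrow> f x * c x"
    proof (intro AE_I2 tendsto_intros)
      fix x
      have "(\<lambda>n. x + t n) \<longlonglongrightarrow> x" using tendsto_add[OF tendsto_const t, of x] by simp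
      then show "(\<lambda>n. c (x + t n)) \<longlonglongrightarrow> c x"
        by (rule continuous_on_tendsto_compose[OF c(2)]) auto
    qed
    show "AE x in lborel. norm (f x * c (x + t n)) \<le> norm (f x) * B" for n
      using B by (intro AE_I2) (auto simp: norm_mult intro: mult_left_mono)
  qed measurable
  then obtain N where N: "\<And>n. n \<ge> N \<Longrightarrow> dist (LINT x|lborel. f x * c (x + t n)) (LINT x|lborel. f x * c x) < e / 2"
    using \<open>0 < e\<close> by (meson half_gt_zero metric_LIMSEQ_D)
  have "dist (LINT x|lborel. f x * g (x + t n)) (LINT x|lborel. f x * g x) < e" if "n \<ge> N" for n
    using N[OF that] diff[of "t n"] diff[of 0] by (simp add: dist_norm) norm
  then show "\<exists>N. \<forall>n\<ge>N. dist (LINT x|lborel. f x * g (x + t n)) (LINT x|lborel. f x * g x) < e" by blast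
qed

subsection \<open>The Plancherel theorem\<close>

text \<open>A wave under a wide Gaussian transforms into a narrow Gaussian of width e around x, that
  is, into a multiple of an approximate identity.\<close>

lemma fourier_gauss_shift:
  fixes x y :: "'a::euclidean_space"
  assumes e: "0 < e"
  shows "fourier_integral (\<lambda>\<xi>. exp (\<i> * complex_of_real (x \<bullet> \<xi>)) * complex_of_real (gauss (e *\<^sub>R \<xi>))) y
     = complex_of_real (gauss ((1 / e) *\<^sub>R (y - x)) / (e ^ DIM('a) * gauss (0::'a)))"
proof -
  let ?F = "\<lambda>z. exp (- (\<i> * complex_of_real (z \<bullet> ((1 / e) *\<^sub>R (y - x))))) * complex_of_real (gauss z)"
  have [measurable]: "?F \<in> borel_measurable borel" by measurable
  have "complex_of_real (gauss ((1 / e) *\<^sub>R (y - x)) / gauss (0::'a)) = (LINT z|lborel. ?F z)"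
    using fourier_gauss[of "(1 / e) *\<^sub>R (y - x)"] by (simp add: fourier_integral_def)
  also have "\<dots> = e ^ DIM('a) *\<^sub>R (LINT \<xi>|lborel. ?F (0 + e *\<^sub>R \<xi>))"
    using lborel_integral_affine(1)[of e ?F 0] e by simp
  also have "(\<lambda>\<xi>. ?F (0 + e *\<^sub>R \<xi>)) = (\<lambda>\<xi>. exp (- (\<i> * complex_of_real (\<xi> \<bullet> y))) *
      (exp (\<i> * complex_of_real (x \<bullet> \<xi>)) * complex_of_real (gauss (e *\<^sub>R \<xi>))))"
    using e by (simp add: fun_eq_iff inner_diff_right exp_diff exp_minus inner_commute[of x] field_simps)
  finally have "complex_of_real (gauss ((1 / e) *\<^sub>R (y - x)) / gauss (0::'a)) =
     e ^ DIM('a) *\<^sub>R fourier_integral (\<lambda>\<xi>. exp (\<i> * complex_of_real (x \<bullet> \<xi>)) * complex_of_real (gauss (e *\<^sub>R \<xi>))) y"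
    by (simp add: fourier_integral_def)
  then show ?thesis using e gauss_0_pos[where 'a='a] by (simp add: scaleR_conv_of_real field_simps)
qed

lemma integrable_gauss_scaled:
  assumes e: "0 < e"
  shows "integrable lborel (\<lambda>\<xi>::'a::euclidean_space. complex_of_real (gauss (e *\<^sub>R \<xi>)))"
  using lborel_integral_affine(2)[of e "\<lambda>z::'a. complex_of_real (gauss z)" 0] integrable_gauss[where 'a='a] e by simp

text \<open>The product of the two transforms is not yet known to be integrable; the Gaussian weight
  makes it so. Moving one transform across by \<open>fourier_multiplication\<close> turns the weight
  into a Gaussian average of correlations of f and g at shifts of size e.\<close>

lemma fourier_gauss_regularised:
  fixes f g :: "'a::euclidean_space \<Rightarrow> complex"
  assumes f: "f \<in> L2_space lborel" "integrable lborel f" and g: "g \<in> L2_space lborel" "integrable lborel g"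
    and e: "0 < e"
  shows "(LINT \<xi>|lborel. fourier_integral f \<xi> * (fourier_integral g (- \<xi>) * complex_of_real (gauss (e *\<^sub>R \<xi>))))
     = (LINT z|lborel. complex_of_real (gauss z) * (LINT x|lborel. f x * g (x + e *\<^sub>R z))) / complex_of_real (gauss (0::'a))"
proof -
  have [measurable]: "f \<in> borel_measurable borel" "g \<in> borel_measurable borel"
    using L2_spaceD(1)[OF f(1)] L2_spaceD(1)[OF g(1)] by auto
  note [measurable] = fourier_integral_measurable[OF g(2)] fourier_integral_measurable[OF f(2)]
  let ?G = "\<lambda>\<xi>. fourier_integral g (- \<xi>) * complex_of_real (gauss (e *\<^sub>R \<xi>))"
  have "integrable lborel (\<lambda>\<xi>::'a. complex_of_real (LINT x|lborel. norm (g x)) * complex_of_real (gauss (e *\<^sub>R \<xi>)))"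
    by (intro integrable_mult_right integrable_gauss_scaled e)
  then have Gi: "integrable lborel ?G"
    by (rule Bochner_Integration.integrable_bound)
      (auto intro!: AE_I2 mult_right_mono order_trans[OF fourier_integral_bound[OF g(2)]] simp: norm_mult abs_mult)
  have FG: "fourier_integral ?G x = (LINT z|lborel. complex_of_real (gauss z) * g (x + e *\<^sub>R z)) / complex_of_real (gauss (0::'a))" for x
  proof -
    let ?E = "\<lambda>\<xi>. exp (\<i> * complex_of_real (x \<bullet> \<xi>)) * complex_of_real (gauss (e *\<^sub>R \<xi>))"
    have Ei: "integrable lborel ?E"
      by (rule Bochner_Integration.integrable_bound[OF integrable_gauss_scaled[where 'a='a, OF e]]) (auto simp: norm_mult)
    have "fourier_integral ?G x = (LINT \<xi>|lborel. exp (- (\<i> * complex_of_real (\<xi> \<bullet> x))) * ?G \<xi>)"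
      by (simp add: fourier_integral_def)
    \<comment> \<open>Reflecting \<xi> turns the reflected transform of g into the transform itself,
      so that the multiplication formula applies to it.\<close>
    also have "\<dots> = (LINT \<xi>|lborel. exp (- (\<i> * complex_of_real ((- \<xi>) \<bullet> x))) * ?G (- \<xi>))"
      by (rule lborel_integral_reflect[symmetric]) measurable
    also have "\<dots> = (LINT \<xi>|lborel. fourier_integral g \<xi> * ?E \<xi>)"
      by (rule Bochner_Integration.integral_cong[OF refl]) (simp add: inner_commute)
    also have "\<dots> = (LINT y|lborel. g y * fourier_integral ?E y)"
      by (rule fourier_multiplication[OF g(2) Ei])
    also have "\<dots> = (LINT y|lborel. g y * complex_of_real (gauss ((1 / e) *\<^sub>R (y - x)) / (e ^ DIM('a) * gauss (0::'a))))"
      by (simp only: fourier_gauss_shift[OF e])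
    also have "\<dots> = e ^ DIM('a) *\<^sub>R (LINT z|lborel. g (x + e *\<^sub>R z) *
        complex_of_real (gauss ((1 / e) *\<^sub>R (x + e *\<^sub>R z - x)) / (e ^ DIM('a) * gauss (0::'a))))"
      using e by (subst lborel_integral_affine(1)[of e _ x]) auto
    also have "\<dots> = e ^ DIM('a) *\<^sub>R ((LINT z|lborel. complex_of_real (gauss z) * g (x + e *\<^sub>R z)) /
        (complex_of_real (e ^ DIM('a)) * complex_of_real (gauss (0::'a))))"
      using e by (subst Bochner_Integration.integral_divide_zero[symmetric])
         (intro arg_cong[where f="\<lambda>x. _ *\<^sub>R x"] Bochner_Integration.integral_cong refl, simp add: mult.commute)
    also have "\<dots> = (LINT z|lborel. complex_of_real (gauss z) * g (x + e *\<^sub>R z)) / complex_of_real (gauss (0::'a))"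
      using e by (simp add: scaleR_conv_of_real)
    finally show ?thesis .
  qed
  let ?H = "\<lambda>z x. complex_of_real (gauss z) * (f x * g (x + e *\<^sub>R z))"
  have Hx: "integrable lborel (\<lambda>x. f x * g (x + e *\<^sub>R z))" for z
    by (intro L2_mult_integrable f L2_translate(1)[OF g(1)])
  have int: "integrable (lborel \<Otimes>\<^sub>M lborel) (case_prod ?H)"
  proof (rule lborel_pair.Fubini_integrable)
    show "case_prod ?H \<in> borel_measurable (lborel \<Otimes>\<^sub>M lborel)" by measurable
    show "AE z in lborel. integrable lborel (\<lambda>x. case (z, x) of (z, x) \<Rightarrow> ?H z x)"
      using Hx by simp
    have "integrable lborel (\<lambda>z. complex_of_real (L2_norm lborel f * L2_norm lborel g) * complex_of_real (gauss (z::'a)))"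
      by (intro integrable_mult_right integrable_gauss)
    then show "integrable lborel (\<lambda>z. LINT x|lborel. norm (case (z, x) of (z, x) \<Rightarrow> ?H z x))"
    proof (rule Bochner_Integration.integrable_bound)
      show "AE z in lborel. norm (LINT x|lborel. norm (case (z, x) of (z, x) \<Rightarrow> ?H z x)) \<le>
         norm (complex_of_real (L2_norm lborel f * L2_norm lborel g) * complex_of_real (gauss z))"
      proof (intro AE_I2)
        fix z :: 'a
        \<comment> \<open>The bound does not depend on z, so the Gaussian alone dominates the outer
          integral.\<close>
        have "(LINT x|lborel. norm (f x * g (x + e *\<^sub>R z))) \<le> L2_norm lborel f * L2_norm lborel g"
          using L2_Cauchy_Schwarz(1)[OF f(1) L2_translate(1)[OF g(1)], of "e *\<^sub>R z"]
          by (simp add: L2_translate(2)[OF g(1)])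
        then show "norm (LINT x|lborel. norm (case (z, x) of (z, x) \<Rightarrow> ?H z x)) \<le>
         norm (complex_of_real (L2_norm lborel f * L2_norm lborel g) * complex_of_real (gauss z))"
          by (auto simp: norm_mult integral_nonneg_AE mult.commute[of _ "gauss z"] intro!: mult_left_mono)
      qed
    qed measurable
  qed
  have "(LINT \<xi>|lborel. fourier_integral f \<xi> * ?G \<xi>) = (LINT x|lborel. f x * fourier_integral ?G x)"
    by (rule fourier_multiplication[OF f(2) Gi])
  also have "\<dots> = (LINT x|lborel. (LINT z|lborel. ?H z x) / complex_of_real (gauss (0::'a)))"
  proof (intro Bochner_Integration.integral_cong refl)
    fix x
    have "(LINT z|lborel. ?H z x) = (LINT z|lborel. f x * (complex_of_real (gauss z) * g (x + e *\<^sub>R z)))"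
      by (simp only: mult.left_commute)
    then show "f x * fourier_integral ?G x = (LINT z|lborel. ?H z x) / complex_of_real (gauss (0::'a))"
      unfolding FG by simp
  qed
  also have "\<dots> = (LINT x|lborel. (LINT z|lborel. ?H z x)) / complex_of_real (gauss (0::'a))"
    by (rule Bochner_Integration.integral_divide_zero)
  also have "(LINT x|lborel. (LINT z|lborel. ?H z x)) = (LINT z|lborel. (LINT x|lborel. ?H z x))"
    by (rule lborel_pair.Fubini_integral[OF int])
  finally show ?thesis by simp
qed

lemma fourier_gauss_regularised_tendsto:
  fixes f g :: "'a::euclidean_space \<Rightarrow> complex"
  assumes f: "f \<in> L2_space lborel" "integrable lborel f" and g: "g \<in> L2_space lborel" "integrable lborel g"
  shows "(\<lambda>n. LINT \<xi>|lborel. fourier_integral f \<xi> *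
             (fourier_integral g (- \<xi>) * complex_of_real (gauss ((1 / real (Suc n)) *\<^sub>R \<xi>))))
     \<longlonglongrightarrow> (LINT x|lborel. f x * g x) / complex_of_real (gauss (0::'a))"
proof -
  have [measurable]: "f \<in> borel_measurable borel" "g \<in> borel_measurable borel"
    using L2_spaceD(1)[OF f(1)] L2_spaceD(1)[OF g(1)] by auto
  have e: "(\<lambda>n. 1 / real (Suc n)) \<longlonglongrightarrow> 0" by (rule lim_1_over_n[THEN LIMSEQ_Suc])
  define h where "h t = (LINT x|lborel. f x * g (x + t))" for t
  have [measurable]: "h \<in> borel_measurable borel" unfolding h_def[abs_def] by measurable
  have hb: "norm (h t) \<le> L2_norm lborel f * L2_norm lborel g" for t
    using L2_Cauchy_Schwarz(2)[OF f(1) L2_translate(1)[OF g(1), of t]]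
    by (simp add: L2_translate(2)[OF g(1)] h_def)
  have "(\<lambda>n. LINT z|lborel. complex_of_real (gauss z) * h ((1 / real (Suc n)) *\<^sub>R z)) \<longlonglongrightarrow> (LINT z|lborel. complex_of_real (gauss (z::'a)) * h 0)"
  proof (rule integral_dominated_convergence)
    show "integrable lborel (\<lambda>z::'a. norm (complex_of_real (gauss z)) * (L2_norm lborel f * L2_norm lborel g))"
      using integrable_norm[OF integrable_gauss[where 'a='a]] by simp
    show "AE z in lborel. (\<lambda>n. complex_of_real (gauss z) * h ((1 / real (Suc n)) *\<^sub>R z)) \<longlonglongrightarrow> complex_of_real (gauss (z::'a)) * h 0"
    proof (intro AE_I2 tendsto_intros)
      fix z :: 'a
      have "(\<lambda>n. (1 / real (Suc n)) *\<^sub>R z) \<longlonglongrightarrow> 0"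
        using tendsto_scaleR[OF e tendsto_const, of z] by simp
      from L2_correlation_tendsto[OF f g(1) this]
      show "(\<lambda>n. h ((1 / real (Suc n)) *\<^sub>R z)) \<longlonglongrightarrow> h 0" by (simp add: h_def)
    qed
    show "AE z in lborel. norm (complex_of_real (gauss z) * h ((1 / real (Suc n)) *\<^sub>R z)) \<le>
      norm (complex_of_real (gauss (z::'a))) * (L2_norm lborel f * L2_norm lborel g)" for n
      by (intro AE_I2) (simp add: norm_mult mult_left_mono hb)
  qed measurable
  also have "(LINT z|lborel. complex_of_real (gauss (z::'a)) * h 0) = (LINT x|lborel. f x * g x)"
    using integral_gauss[where 'a='a] by (simp add: h_def)
  finally have "(\<lambda>n. (LINT z|lborel. complex_of_real (gauss z) * h ((1 / real (Suc n)) *\<^sub>R z)) / complex_of_real (gauss (0::'a)))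
     \<longlonglongrightarrow> (LINT x|lborel. f x * g x) / complex_of_real (gauss (0::'a))"
    using gauss_0_pos[where 'a='a] by (intro tendsto_divide tendsto_const) auto
  then show ?thesis
    by (subst fourier_gauss_regularised[OF f g]) (simp_all add: h_def)
qed

text \<open>With the conjugate of f as second function the regularised integrals are those of the
  squared modulus of the transform. They converge, and Fatou's lemma bounds the unweighted integral.
  This is the domination needed to remove the weight in \<open>Plancherel_bilinear\<close>.\<close>

lemma fourier_integral_L2:
  fixes f :: "'a::euclidean_space \<Rightarrow> complex"
  assumes f: "f \<in> L2_space lborel" "integrable lborel f"
  shows "fourier_integral f \<in> L2_space lborel"
proof -
  note [measurable] = fourier_integral_measurable[OF f(2)]
  let ?c = "gauss (0::'a)"
  let ?I = "\<lambda>n. (LINT \<xi>|lborel. (norm (fourier_integral f \<xi>))\<^sup>2 * gauss ((1 / real (Suc n)) *\<^sub>R \<xi>))"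
  have cnjf: "(\<lambda>x. cnj (f x)) \<in> L2_space lborel" "integrable lborel (\<lambda>x. cnj (f x))"
    using L2_space_cnj[OF f(1)] f(2) by auto
  have "(\<lambda>n. complex_of_real (?I n)) \<longlonglongrightarrow> (LINT x|lborel. f x * cnj (f x)) / complex_of_real ?c"
    using fourier_gauss_regularised_tendsto[OF f cnjf]
    by (simp add: fourier_integral_cnj complex_norm_square[symmetric] mult.assoc[symmetric]
          flip: integral_complex_of_real of_real_mult of_real_power)
  also have "(LINT x|lborel. f x * cnj (f x)) = complex_of_real ((L2_norm lborel f)\<^sup>2)"
    by (simp add: L2_norm_sq complex_norm_square[symmetric] flip: integral_complex_of_real of_real_power)
  finally have "(\<lambda>n. complex_of_real (?I n)) \<longlonglongrightarrow> complex_of_real ((L2_norm lborel f)\<^sup>2 / ?c)" by simp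
  then have lim: "?I \<longlonglongrightarrow> (L2_norm lborel f)\<^sup>2 / ?c"
    by (simp only: tendsto_of_real_iff)
  have int: "integrable lborel (\<lambda>\<xi>. (norm (fourier_integral f \<xi>))\<^sup>2 * gauss ((1 / real (Suc n)) *\<^sub>R \<xi>))" for n
  proof -
    have "integrable lborel (\<lambda>\<xi>::'a. (LINT x|lborel. norm (f x))\<^sup>2 * norm (complex_of_real (gauss ((1 / real (Suc n)) *\<^sub>R \<xi>))))"
      using integrable_norm[OF integrable_gauss_scaled[where 'a='a and e="1 / real (Suc n)"]] by simp
    then show ?thesis
      by (rule Bochner_Integration.integrable_bound)
        (auto intro!: AE_I2 mult_right_mono power_mono fourier_integral_bound[OF f(2)] simp: abs_mult)
  qed
  have "(\<integral>\<^sup>+\<xi>. ennreal ((norm (fourier_integral f \<xi>))\<^sup>2 * ?c) \<partial>lborel) =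
     (\<integral>\<^sup>+\<xi>. liminf (\<lambda>n. ennreal ((norm (fourier_integral f \<xi>))\<^sup>2 * gauss ((1 / real (Suc n)) *\<^sub>R \<xi>))) \<partial>lborel)"
  proof (intro nn_integral_cong lim_imp_Liminf[symmetric] tendsto_intros gauss_tendsto)
    show "(\<lambda>n. 1 / real (Suc n)) \<longlonglongrightarrow> 0" by (rule lim_1_over_n[THEN LIMSEQ_Suc])
  qed simp
  also have "\<dots> \<le> liminf (\<lambda>n. \<integral>\<^sup>+\<xi>. ennreal ((norm (fourier_integral f \<xi>))\<^sup>2 * gauss ((1 / real (Suc n)) *\<^sub>R \<xi>)) \<partial>lborel)"
    by (rule nn_integral_liminf) measurable
  also have "\<dots> = liminf (\<lambda>n. ennreal (?I n))"
    using int by (subst nn_integral_eq_integral) auto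
  also have "\<dots> = ennreal ((L2_norm lborel f)\<^sup>2 / ?c)"
    by (intro lim_imp_Liminf tendsto_ennrealI lim) simp
  finally have "(\<integral>\<^sup>+\<xi>. ennreal ((norm (fourier_integral f \<xi>))\<^sup>2 * ?c) \<partial>lborel) < \<infinity>"
    by (rule order.strict_trans1) simp
  then have "integrable lborel (\<lambda>\<xi>. (norm (fourier_integral f \<xi>))\<^sup>2 * ?c)"
    by (intro integrableI_bounded) (auto simp: abs_mult)
  then have "integrable lborel (\<lambda>\<xi>. (norm (fourier_integral f \<xi>))\<^sup>2)"
    using gauss_0_pos[where 'a='a] by simp
  then show ?thesis by (simp add: L2_space_def)
qed

text \<open>Two limits of the same regularised integral are compared: by domination on the frequency
  side, by continuity of correlations on the other. The form without conjugation is the one that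
  fits duality pairings.\<close>

theorem Plancherel_bilinear:
  fixes f g :: "'a::euclidean_space \<Rightarrow> complex"
  assumes f: "f \<in> L2_space lborel" "integrable lborel f" and g: "g \<in> L2_space lborel" "integrable lborel g"
  shows "(LINT \<xi>|lborel. fourier_integral f \<xi> * fourier_integral g (- \<xi>)) = (2 * pi) ^ DIM('a) * (LINT x|lborel. f x * g x)"
proof -
  note [measurable] = fourier_integral_measurable[OF f(2)] fourier_integral_measurable[OF g(2)]
  let ?c = "gauss (0::'a)"
  have int: "integrable lborel (\<lambda>\<xi>. fourier_integral f \<xi> * fourier_integral g (- \<xi>))"
    by (intro L2_mult_integrable fourier_integral_L2 f L2_reflect(1) g)
  have "(\<lambda>n. LINT \<xi>|lborel. fourier_integral f \<xi> *
             (fourier_integral g (- \<xi>) * complex_of_real (gauss ((1 / real (Suc n)) *\<^sub>R \<xi>))))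
     \<longlonglongrightarrow> (LINT \<xi>|lborel. fourier_integral f \<xi> * (fourier_integral g (- \<xi>) * complex_of_real ?c))"
  proof (rule integral_dominated_convergence)
    show "integrable lborel (\<lambda>\<xi>. norm (fourier_integral f \<xi> * fourier_integral g (- \<xi>)) * ?c)"
      using int by simp
    show "AE \<xi> in lborel. (\<lambda>n. fourier_integral f \<xi> *
             (fourier_integral g (- \<xi>) * complex_of_real (gauss ((1 / real (Suc n)) *\<^sub>R \<xi>))))
     \<longlonglongrightarrow> fourier_integral f \<xi> * (fourier_integral g (- \<xi>) * complex_of_real ?c)"
    proof (intro AE_I2 tendsto_intros gauss_tendsto)
      show "(\<lambda>n. 1 / real (Suc n)) \<longlonglongrightarrow> 0" by (rule lim_1_over_n[THEN LIMSEQ_Suc])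
    qed
    show "AE \<xi> in lborel. norm (fourier_integral f \<xi> *
             (fourier_integral g (- \<xi>) * complex_of_real (gauss ((1 / real (Suc n)) *\<^sub>R \<xi>)))) \<le>
       norm (fourier_integral f \<xi> * fourier_integral g (- \<xi>)) * ?c" for n
      by (intro AE_I2) (simp add: norm_mult mult.assoc mult_left_mono gauss_le)
  qed measurable
  from LIMSEQ_unique[OF this fourier_gauss_regularised_tendsto[OF f g]]
  have "(LINT \<xi>|lborel. fourier_integral f \<xi> * fourier_integral g (- \<xi>)) * complex_of_real ?c
     = (LINT x|lborel. f x * g x) / complex_of_real ?c"
    by (simp add: mult.assoc[symmetric])
  then have *: "(LINT x|lborel. f x * g x) = (LINT \<xi>|lborel. fourier_integral f \<xi> * fourier_integral g (- \<xi>)) * complex_of_real (?c\<^sup>2)"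
    using gauss_0_pos[where 'a='a] by (simp add: field_simps power2_eq_square)
  have "(2 * pi) ^ DIM('a) * complex_of_real (?c\<^sup>2) = complex_of_real (?c\<^sup>2 * (2 * pi) ^ DIM('a))"
    by simp
  also have "\<dots> = 1" by (simp only: gauss_0_square of_real_1)
  finally have "(2 * pi) ^ DIM('a) * complex_of_real (?c\<^sup>2) = 1" .
  then show ?thesis unfolding * by (simp add: mult.left_commute)
qed

theorem Plancherel_norm:
  fixes f :: "'a::euclidean_space \<Rightarrow> complex"
  assumes f: "f \<in> L2_space lborel" "integrable lborel f"
  shows "(L2_norm lborel (fourier_integral f))\<^sup>2 = (2 * pi) ^ DIM('a) * (L2_norm lborel f)\<^sup>2"
proof -
  have cnjf: "(\<lambda>x. cnj (f x)) \<in> L2_space lborel" "integrable lborel (\<lambda>x. cnj (f x))"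
    using L2_space_cnj[OF f(1)] f(2) by auto
  have sq: "complex_of_real ((L2_norm lborel h)\<^sup>2) = (LINT x|lborel. h x * cnj (h x))" for h :: "'a \<Rightarrow> complex"
    by (simp add: L2_norm_sq complex_norm_square[symmetric] flip: integral_complex_of_real of_real_power)
  have "complex_of_real ((L2_norm lborel (fourier_integral f))\<^sup>2) = (2 * pi) ^ DIM('a) * complex_of_real ((L2_norm lborel f)\<^sup>2)"
    using Plancherel_bilinear[OF f cnjf] unfolding sq by (simp add: fourier_integral_cnj)
  then have "complex_of_real ((L2_norm lborel (fourier_integral f))\<^sup>2) = complex_of_real ((2 * pi) ^ DIM('a) * (L2_norm lborel f)\<^sup>2)"
    by simp
  then show ?thesis by (simp only: of_real_eq_iff)
qed

subsection \<open>The Fourier transform on $L^2$\<close>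

lemma L2_inner_tendsto:
  assumes F: "\<And>n. F n \<in> L2_space M" and G: "G \<in> L2_space M" and H: "H \<in> L2_space M"
    and lim: "(\<lambda>n. L2_norm M (\<lambda>x. F n x - G x)) \<longlonglongrightarrow> 0"
  shows "(\<lambda>n. LINT x|M. F n x * H x) \<longlonglongrightarrow> (LINT x|M. G x * H x)"
proof (rule LIM_zero_cancel, rule Lim_null_comparison)
  show "\<forall>\<^sub>F n in sequentially. norm ((LINT x|M. F n x * H x) - (LINT x|M. G x * H x)) \<le> L2_norm M (\<lambda>x. F n x - G x) * L2_norm M H"
  proof (intro always_eventually allI)
    fix n
    have "(LINT x|M. F n x * H x) - (LINT x|M. G x * H x) = (LINT x|M. (F n x - G x) * H x)"
      using L2_mult_integrable[OF F H] L2_mult_integrable[OF G H] by (simp add: left_diff_distrib)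
    then show "norm ((LINT x|M. F n x * H x) - (LINT x|M. G x * H x)) \<le> L2_norm M (\<lambda>x. F n x - G x) * L2_norm M H"
      using L2_Cauchy_Schwarz(2)[OF L2_space_diff[OF F G] H] by simp
  qed
  show "(\<lambda>n. L2_norm M (\<lambda>x. F n x - G x) * L2_norm M H) \<longlonglongrightarrow> 0"
    using tendsto_mult[OF lim tendsto_const] by simp
qed

lemma L2_norm_diff_le:
  assumes F: "F \<in> L2_space M" and G: "G \<in> L2_space M"
  shows "\<bar>L2_norm M F - L2_norm M G\<bar> \<le> L2_norm M (\<lambda>x. F x - G x)"
  using L2_norm_triangle[OF L2_space_diff[OF F G] G] L2_norm_triangle[OF L2_space_diff[OF G F] F]
    L2_norm_minus_commute[of M F G] by (simp only: diff_add_cancel)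

lemma L2_norm_tendsto:
  assumes F: "\<And>n. F n \<in> L2_space M" and G: "G \<in> L2_space M"
    and lim: "(\<lambda>n. L2_norm M (\<lambda>x. F n x - G x)) \<longlonglongrightarrow> 0"
  shows "(\<lambda>n. L2_norm M (F n)) \<longlonglongrightarrow> L2_norm M G"
  by (rule LIM_zero_cancel, rule Lim_null_comparison[OF _ lim]) (simp add: L2_norm_diff_le[OF F G])

text \<open>The transforms of suitable truncations form a Cauchy sequence by Plancherel, and K is
  their limit. Both pairings pass to the limit by Cauchy-Schwarz; the second one, with the reflected
  transform, is what yields inversion.\<close>

lemma L2_fourier_exists:
  fixes k :: "'a::euclidean_space \<Rightarrow> complex"
  assumes k: "k \<in> L2_space lborel"
  obtains K where "K \<in> L2_space lborel" "(L2_norm lborel K)\<^sup>2 = (2 * pi) ^ DIM('a) * (L2_norm lborel k)\<^sup>2"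
    "\<And>g. g \<in> L2_space lborel \<Longrightarrow> integrable lborel g \<Longrightarrow>
       (LINT x|lborel. k x * fourier_integral g x) = (LINT x|lborel. K x * g x)"
    "\<And>g. g \<in> L2_space lborel \<Longrightarrow> integrable lborel g \<Longrightarrow>
       (LINT x|lborel. K x * fourier_integral g (- x)) = (2 * pi) ^ DIM('a) * (LINT x|lborel. k x * g x)"
proof -
  define D where "D n = L2_norm lborel (\<lambda>x. k x - truncation n k x)" for n
  define C where "C = (2 * pi) ^ DIM('a)"
  have C: "0 < C" by (simp add: C_def)
  \<comment> \<open>Two truncations within \<open>d m\<close> of k differ by at most
    \<open>2 * d m\<close>; Plancherel multiplies the square of this by C, and the choice makes the
    product exactly (1/4)^m, the rate in \<open>L2_complete_rate\<close>.\<close>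
  define d where "d n = (1/2) ^ n / (2 * sqrt C)" for n :: nat
  have d: "0 < d n" for n using C by (simp add: d_def)
  have "\<exists>N. D N < d m" for m
    using order_tendstoD(2)[OF truncation_tendsto[OF k] d[of m]]
    unfolding eventually_sequentially D_def by blast
  then obtain r where r: "\<And>m. D (r m) < d m" by metis
  define F where "F n = truncation (r n) k" for n
  have F: "F n \<in> L2_space lborel" "integrable lborel (F n)" for n
    using truncation_L2[OF k] by (auto simp: F_def)
  have Fk: "L2_norm lborel (\<lambda>x. F n x - k x) < d n" for n
    using r[of n] by (simp add: F_def D_def L2_norm_minus_commute)
  have FF: "L2_norm lborel (\<lambda>x. F n x - F m x) \<le> 2 * d m" if "m \<le> n" for m n
  proof -
    have "d n \<le> d m" using that C by (simp add: d_def divide_right_mono power_decreasing)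
    then show ?thesis
      using L2_norm_triangle_diff[OF F(1)[of n] k F(1)[of m]] Fk[of n] Fk[of m]
        L2_norm_minus_commute[of lborel k "F m"] by linarith
  qed
  define g where "g n = fourier_integral (F n)" for n
  have g: "g n \<in> L2_space lborel" for n unfolding g_def by (intro fourier_integral_L2 F)
  have gg: "(L2_norm lborel (\<lambda>x. g n x - g m x))\<^sup>2 \<le> (1/4) ^ m" if "m \<le> n" for m n
  proof -
    have "(\<lambda>x. g n x - g m x) = fourier_integral (\<lambda>x. F n x - F m x)"
      by (simp add: g_def fun_eq_iff fourier_integral_diff[OF F(2) F(2)])
    then have "(L2_norm lborel (\<lambda>x. g n x - g m x))\<^sup>2 = C * (L2_norm lborel (\<lambda>x. F n x - F m x))\<^sup>2"
      unfolding C_def by (simp add: Plancherel_norm L2_space_diff F)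
    also have "\<dots> \<le> C * (2 * d m)\<^sup>2"
      using FF[OF that] C by (intro mult_left_mono power_mono) auto
    also have "\<dots> = ((1/2) ^ m)\<^sup>2"
      using C by (simp add: d_def power_mult_distrib power_divide)
    also have "\<dots> = (1/4) ^ m"
      by (simp add: power2_eq_square flip: power_mult_distrib)
    finally show ?thesis .
  qed
  obtain K where K: "K \<in> L2_space lborel" and Kg: "\<And>m. (L2_norm lborel (\<lambda>x. K x - g m x))\<^sup>2 \<le> (1/4) ^ m"
    using L2_complete_rate[OF g gg] by blast
  have Flim: "(\<lambda>n. L2_norm lborel (\<lambda>x. F n x - k x)) \<longlonglongrightarrow> 0"
  proof (rule Lim_null_comparison)
    show "\<forall>\<^sub>F n in sequentially. norm (L2_norm lborel (\<lambda>x. F n x - k x)) \<le> d n"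
      using less_imp_le[OF Fk] by simp
    have "(\<lambda>n. (1/2::real) ^ n / (2 * sqrt C)) \<longlonglongrightarrow> 0 / (2 * sqrt C)"
      by (intro tendsto_divide LIMSEQ_realpow_zero tendsto_const) (use C in auto)
    then show "d \<longlonglongrightarrow> 0" unfolding d_def[abs_def] by simp
  qed
  have glim: "(\<lambda>n. L2_norm lborel (\<lambda>x. g n x - K x)) \<longlonglongrightarrow> 0"
  proof (rule Lim_null_comparison)
    have "L2_norm lborel (\<lambda>x. K x - g n x) \<le> (1/2) ^ n" for n
    proof (rule power2_le_imp_le)
      show "(L2_norm lborel (\<lambda>x. K x - g n x))\<^sup>2 \<le> ((1/2) ^ n)\<^sup>2"
        using Kg[of n] by (simp add: power2_eq_square flip: power_mult_distrib)
    qed simp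
    then show "\<forall>\<^sub>F n in sequentially. norm (L2_norm lborel (\<lambda>x. g n x - K x)) \<le> (1/2) ^ n"
      by (subst L2_norm_minus_commute) simp
  qed (rule LIMSEQ_realpow_zero; simp)
  show ?thesis
  proof (rule that[OF K])
    have lim: "(\<lambda>n. (L2_norm lborel (g n))\<^sup>2) \<longlonglongrightarrow> (L2_norm lborel K)\<^sup>2"
      by (intro tendsto_intros L2_norm_tendsto g K glim)
    have eq: "(L2_norm lborel (g n))\<^sup>2 = C * (L2_norm lborel (F n))\<^sup>2" for n
      unfolding g_def C_def by (intro Plancherel_norm F)
    have lim': "(\<lambda>n. C * (L2_norm lborel (F n))\<^sup>2) \<longlonglongrightarrow> C * (L2_norm lborel k)\<^sup>2"
      by (intro tendsto_intros L2_norm_tendsto F k Flim)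
    from LIMSEQ_unique[OF lim[unfolded eq] lim'] show "(L2_norm lborel K)\<^sup>2 = (2 * pi) ^ DIM('a) * (L2_norm lborel k)\<^sup>2"
      by (simp add: C_def)
  next
    fix h :: "'a \<Rightarrow> complex" assume h: "h \<in> L2_space lborel" "integrable lborel h"
    have lim: "(\<lambda>n. LINT x|lborel. g n x * h x) \<longlonglongrightarrow> (LINT x|lborel. K x * h x)"
      by (intro L2_inner_tendsto g K h glim)
    have eq: "(LINT x|lborel. g n x * h x) = (LINT x|lborel. F n x * fourier_integral h x)" for n
      unfolding g_def by (rule fourier_multiplication[OF F(2) h(2)])
    have lim': "(\<lambda>n. LINT x|lborel. F n x * fourier_integral h x) \<longlonglongrightarrow> (LINT x|lborel. k x * fourier_integral h x)"
      by (intro L2_inner_tendsto F k fourier_integral_L2 h Flim)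
    from LIMSEQ_unique[OF lim[unfolded eq] lim'] show "(LINT x|lborel. k x * fourier_integral h x) = (LINT x|lborel. K x * h x)"
      by (simp add: C_def)
    have lim: "(\<lambda>n. LINT x|lborel. g n x * fourier_integral h (- x)) \<longlonglongrightarrow> (LINT x|lborel. K x * fourier_integral h (- x))"
      by (intro L2_inner_tendsto g K L2_reflect(1) fourier_integral_L2 h glim)
    have eq: "(LINT x|lborel. g n x * fourier_integral h (- x)) = (2 * pi) ^ DIM('a) * (LINT x|lborel. F n x * h x)" for n
      unfolding g_def by (rule Plancherel_bilinear[OF F h])
    have lim': "(\<lambda>n. (2 * pi) ^ DIM('a) * (LINT x|lborel. F n x * h x)) \<longlonglongrightarrow> (2 * pi) ^ DIM('a) * (LINT x|lborel. k x * h x)"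
      by (intro tendsto_intros L2_inner_tendsto F k h Flim)
    from LIMSEQ_unique[OF lim[unfolded eq] lim'] show "(LINT x|lborel. K x * fourier_integral h (- x)) = (2 * pi) ^ DIM('a) * (LINT x|lborel. k x * h x)"
      by (simp add: C_def)
  qed
qed

text \<open>The L^2 Fourier transform as a relation defined by duality. Testing against all of L^1
  and L^2 together, rather than smooth functions only, allows Fubini arguments without
  approximation; k is still determined only up to null sets.\<close>

definition fourier_pair :: "('a::euclidean_space \<Rightarrow> complex) \<Rightarrow> ('a \<Rightarrow> complex) \<Rightarrow> bool" where
  "fourier_pair f k \<longleftrightarrow> f \<in> L2_space lborel \<and> k \<in> L2_space lborel \<and>
     (\<forall>g\<in>L2_space lborel. integrable lborel g \<longrightarrow>
        (LINT x|lborel. f x * fourier_integral g x) = (LINT x|lborel. k x * g x))"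

lemma fourier_pairD:
  assumes "fourier_pair f k"
  shows "f \<in> L2_space lborel" "k \<in> L2_space lborel"
    "g \<in> L2_space lborel \<Longrightarrow> integrable lborel g \<Longrightarrow>
        (LINT x|lborel. f x * fourier_integral g x) = (LINT x|lborel. k x * g x)"
  using assms by (auto simp: fourier_pair_def)

lemma fourier_pair_diff:
  assumes "fourier_pair f k" "fourier_pair g l"
  shows "fourier_pair (\<lambda>x. f x - g x) (\<lambda>x. k x - l x)"
  using assms unfolding fourier_pair_def
  by (auto simp: L2_space_diff left_diff_distrib L2_mult_integrable fourier_integral_L2)

lemma fourier_pair_cmult:
  assumes "fourier_pair f k"
  shows "fourier_pair (\<lambda>x. c * f x) (\<lambda>x. c * k x)"
  using assms unfolding fourier_pair_def by (auto simp: L2_space_cmult mult.assoc)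

lemma fourier_pair_cong_AE:
  assumes fk: "fourier_pair f k" and "f' \<in> borel_measurable lborel" "k' \<in> borel_measurable lborel"
    "AE x in lborel. f' x = f x" "AE x in lborel. k' x = k x"
  shows "fourier_pair f' k'"
  unfolding fourier_pair_def
proof (intro conjI ballI impI)
  show f': "f' \<in> L2_space lborel" and k': "k' \<in> L2_space lborel"
    using assms fourier_pairD[OF fk] by (blast intro: L2_space_cong_AE)+
  fix g :: "'a \<Rightarrow> complex" assume g: "g \<in> L2_space lborel" "integrable lborel g"
  note [measurable] = L2_spaceD(1)[OF f'] L2_spaceD(1)[OF k'] L2_spaceD(1)[OF g(1)]
    L2_spaceD(1)[OF fourier_pairD(1)[OF fk]] L2_spaceD(1)[OF fourier_pairD(2)[OF fk]] fourier_integral_measurable[OF g(2)]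
  have "(LINT x|lborel. f' x * fourier_integral g x) = (LINT x|lborel. f x * fourier_integral g x)"
    using assms(4) by (intro integral_cong_AE) auto
  also have "\<dots> = (LINT x|lborel. k x * g x)" by (rule fourier_pairD(3)[OF fk g])
  also have "\<dots> = (LINT x|lborel. k' x * g x)"
    using assms(5) by (intro integral_cong_AE) auto
  finally show "(LINT x|lborel. f' x * fourier_integral g x) = (LINT x|lborel. k' x * g x)" .
qed

lemma fourier_pair_exists:
  fixes f :: "'a::euclidean_space \<Rightarrow> complex"
  assumes f: "f \<in> L2_space lborel"
  obtains k where "fourier_pair f k" "(L2_norm lborel k)\<^sup>2 = (2 * pi) ^ DIM('a) * (L2_norm lborel f)\<^sup>2"
proof (rule L2_fourier_exists[OF f])
  fix K assume K: "K \<in> L2_space lborel" "(L2_norm lborel K)\<^sup>2 = (2 * pi) ^ DIM('a) * (L2_norm lborel f)\<^sup>2"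
    "\<And>g. g \<in> L2_space lborel \<Longrightarrow> integrable lborel g \<Longrightarrow>
       (LINT x|lborel. f x * fourier_integral g x) = (LINT x|lborel. K x * g x)"
  then have "fourier_pair f K" using f by (simp add: fourier_pair_def)
  then show ?thesis using K(2) by (rule that)
qed

text \<open>Surjectivity of the transform: the forward transform of k, reflected and divided by (2
  pi)^n, is a preimage. It supplies a candidate for the normal derivative from its symbol
  alone.\<close>

lemma fourier_pair_inverse_exists:
  fixes k :: "'a::euclidean_space \<Rightarrow> complex"
  assumes k: "k \<in> L2_space lborel"
  obtains f where "fourier_pair f k"
proof (rule L2_fourier_exists[OF k])
  fix K assume K: "K \<in> L2_space lborel"
    and Kg: "\<And>g. g \<in> L2_space lborel \<Longrightarrow> integrable lborel g \<Longrightarrow>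
       (LINT x|lborel. K x * fourier_integral g (- x)) = (2 * pi) ^ DIM('a) * (LINT x|lborel. k x * g x)"
  have [measurable]: "K \<in> borel_measurable borel" using L2_spaceD(1)[OF K] by simp
  let ?c = "complex_of_real (1 / (2 * pi) ^ DIM('a))"
  have "fourier_pair (\<lambda>x. ?c * K (- x)) k"
    unfolding fourier_pair_def
  proof (intro conjI ballI impI L2_space_cmult L2_reflect K k)
    fix g :: "'a \<Rightarrow> complex" assume g: "g \<in> L2_space lborel" "integrable lborel g"
    note [measurable] = fourier_integral_measurable[OF g(2)]
    have "(LINT x|lborel. ?c * K (- x) * fourier_integral g x) = ?c * (LINT x|lborel. K (- x) * fourier_integral g (- (- x)))"
      by (simp add: mult.assoc)
    also have "(LINT x|lborel. K (- x) * fourier_integral g (- (- x))) = (LINT x|lborel. K x * fourier_integral g (- x))"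
      by (rule lborel_integral_reflect[where f="\<lambda>x. K x * fourier_integral g (- x)"]) measurable
    finally show "(LINT x|lborel. ?c * K (- x) * fourier_integral g x) = (LINT x|lborel. k x * g x)"
      by (simp add: Kg[OF g])
  qed
  then show ?thesis by (rule that)
qed

text \<open>For integrable k the preimage is the explicit inverse integral, which is what identifies
  the slices of the Poisson integral.\<close>

lemma fourier_pair_inversion:
  fixes k :: "'a::euclidean_space \<Rightarrow> complex"
  assumes k: "k \<in> L2_space lborel" "integrable lborel k"
  shows "fourier_pair (\<lambda>x. fourier_integral k (- x) / (2 * pi) ^ DIM('a)) k"
proof -
  note [measurable] = fourier_integral_measurable[OF k(2)]
  have "fourier_pair (\<lambda>x. complex_of_real (1 / (2 * pi) ^ DIM('a)) * fourier_integral k (- x)) k"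
    unfolding fourier_pair_def
  proof (intro conjI ballI impI L2_space_cmult L2_reflect fourier_integral_L2 k)
    fix g :: "'a \<Rightarrow> complex" assume g: "g \<in> L2_space lborel" "integrable lborel g"
    note [measurable] = fourier_integral_measurable[OF g(2)]
    let ?c = "complex_of_real (1 / (2 * pi) ^ DIM('a))"
    have "(LINT x|lborel. ?c * fourier_integral k (- x) * fourier_integral g x) = ?c * (LINT x|lborel. fourier_integral k (- x) * fourier_integral g (- (- x)))"
      by (simp add: mult.assoc)
    also have "(LINT x|lborel. fourier_integral k (- x) * fourier_integral g (- (- x))) = (LINT x|lborel. fourier_integral k x * fourier_integral g (- x))"
      by (rule lborel_integral_reflect[where f="\<lambda>x. fourier_integral k x * fourier_integral g (- x)"]) measurable
    finally show "(LINT x|lborel. ?c * fourier_integral k (- x) * fourier_integral g x) = (LINT x|lborel. k x * g x)"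
      by (simp add: Plancherel_bilinear[OF k g])
  qed
  then show ?thesis by simp
qed

section \<open>Smooth bumps and uniqueness of the distributional transform\<close>

subsection \<open>Smooth functions of one real variable\<close>

text \<open>An existential chain of derivatives, so that sums, products and exponentials inherit the
  property by induction; \<open>differentiable_times_deriv_funpow\<close> returns to
  \<open>deriv\<close> at the end.\<close>

primrec differentiable_times :: "nat \<Rightarrow> (real \<Rightarrow> real) \<Rightarrow> bool" where
  "differentiable_times 0 f \<longleftrightarrow> True"
| "differentiable_times (Suc n) f \<longleftrightarrow> (\<exists>f'. (\<forall>t. (f has_real_derivative f' t) (at t)) \<and> differentiable_times n f')"

lemma differentiable_times_SucI:
  "(\<And>t. (f has_real_derivative f' t) (at t)) \<Longrightarrow> differentiable_times n f' \<Longrightarrow> differentiable_times (Suc n) f"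
  by auto

lemma differentiable_times_SucD: "differentiable_times (Suc n) f \<Longrightarrow> differentiable_times n f"
proof (induction n arbitrary: f)
  case (Suc n)
  then obtain f' where "\<forall>t. (f has_real_derivative f' t) (at t)" "differentiable_times (Suc n) f'"
    using differentiable_times.simps(2)[of "Suc n" f] by blast
  then show ?case using Suc.IH[of f'] unfolding differentiable_times.simps(2)[of n f] by blast
qed simp

lemma differentiable_times_const: "differentiable_times n (\<lambda>t. c)"
proof (induction n arbitrary: c)
  case (Suc n)
  show ?case using Suc[of 0] by (auto intro!: exI[of _ "\<lambda>t. 0"])
qed simp

lemma differentiable_times_add:
  "differentiable_times n f \<Longrightarrow> differentiable_times n g \<Longrightarrow> differentiable_times n (\<lambda>t. f t + g t)"
proof (induction n arbitrary: f g)
  case (Suc n)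
  then obtain f' g' where "\<And>t. (f has_real_derivative f' t) (at t)" "\<And>t. (g has_real_derivative g' t) (at t)"
    "differentiable_times n f'" "differentiable_times n g'" by auto
  with Suc.IH[of f' g'] show ?case
    by (auto intro!: exI[of _ "\<lambda>t. f' t + g' t"] derivative_eq_intros)
qed simp

lemma differentiable_times_mult:
  "differentiable_times n f \<Longrightarrow> differentiable_times n g \<Longrightarrow> differentiable_times n (\<lambda>t. f t * g t)"
proof (induction n arbitrary: f g)
  case (Suc n)
  then obtain f' g' where *: "\<And>t. (f has_real_derivative f' t) (at t)" "\<And>t. (g has_real_derivative g' t) (at t)"
    "differentiable_times n f'" "differentiable_times n g'" by auto
  have "differentiable_times n (\<lambda>t. f' t * g t + g' t * f t)"
    using differentiable_times_SucD[OF Suc.prems(1)] differentiable_times_SucD[OF Suc.prems(2)] *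
    by (intro differentiable_times_add Suc.IH)
  moreover have "((\<lambda>t. f t * g t) has_real_derivative f' t * g t + g' t * f t) (at t)" for t
    using DERIV_mult[OF *(1)[of t] *(2)[of t]] .
  ultimately show ?case by (intro differentiable_times_SucI)
qed simp

lemma differentiable_times_affine:
  "differentiable_times n f \<Longrightarrow> differentiable_times n (\<lambda>t. f (c * t + d))"
proof (induction n arbitrary: f)
  case (Suc n)
  then obtain f' where *: "\<And>t. (f has_real_derivative f' t) (at t)" "differentiable_times n f'" by auto
  have "differentiable_times n (\<lambda>t. c * f' (c * t + d))"
    by (intro differentiable_times_mult differentiable_times_const Suc.IH *)
  moreover have "((\<lambda>t. f (c * t + d)) has_real_derivative c * f' (c * t + d)) (at t)" for t
    by (rule DERIV_chain2[OF *(1), THEN DERIV_cong]) (auto intro!: derivative_eq_intros)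
  ultimately show ?case by (intro differentiable_times_SucI)
qed simp

lemma differentiable_times_exp:
  "differentiable_times n f \<Longrightarrow> differentiable_times n (\<lambda>t. exp (f t))"
proof (induction n arbitrary: f)
  case (Suc n)
  then obtain f' where *: "\<And>t. (f has_real_derivative f' t) (at t)" "differentiable_times n f'" by auto
  have "differentiable_times n (\<lambda>t. exp (f t) * f' t)"
    by (intro differentiable_times_mult Suc.IH * differentiable_times_SucD[OF Suc.prems])
  moreover have "((\<lambda>t. exp (f t)) has_real_derivative exp (f t) * f' t) (at t)" for t
    using *(1)[of t] by (auto intro!: derivative_eq_intros)
  ultimately show ?case by (intro differentiable_times_SucI)
qed simp

lemma differentiable_times_deriv_funpow:
  "differentiable_times n f \<Longrightarrow> k < n \<Longrightarrow> ((deriv ^^ k) f has_real_derivative (deriv ^^ Suc k) f t) (at t)"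
proof (induction n arbitrary: f k)
  case (Suc n)
  then obtain f' where *: "\<And>t. (f has_real_derivative f' t) (at t)" "differentiable_times n f'" by auto
  have df: "deriv f = f'" using DERIV_imp_deriv[OF *(1)] by auto
  show ?case
  proof (cases k)
    case 0
    then show ?thesis using *(1) df by simp
  next
    case (Suc j)
    then have "((deriv ^^ j) f' has_real_derivative (deriv ^^ Suc j) f' t) (at t)"
      using Suc.IH[OF *(2)] Suc.prems(2) by simp
    then show ?thesis unfolding Suc funpow_Suc_right comp_def df by (simp add: funpow_swap1)
  qed
qed simp

text \<open>The classical smooth function exp(-1/t), with a polynomial factor in 1/t. Allowing all p
  makes the family closed under differentiation (p becomes X^2 (p - p')), so smoothness is an
  induction over p.\<close>

definition flat_function :: "real poly \<Rightarrow> real \<Rightarrow> real" where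
  "flat_function p t = (if 0 < t then poly p (1 / t) * exp (- (1 / t)) else 0)"

lemma poly_exp_tendsto_0: "((\<lambda>x. poly p x * exp (- x)) \<longlongrightarrow> (0::real)) at_top"
proof -
  have "((\<lambda>x. \<Sum>i\<le>degree p. coeff p i * (x ^ i / exp x)) \<longlongrightarrow> (\<Sum>i\<le>degree p. coeff p i * 0)) at_top"
    by (intro tendsto_intros tendsto_power_div_exp_0)
  then show ?thesis
    by (simp add: poly_altdef sum_distrib_right exp_minus divide_inverse mult.assoc)
qed

lemma flat_function_tendsto_0: "(flat_function p \<longlongrightarrow> 0) (at 0)"
proof (subst at_eq_sup_left_right, rule filterlim_sup)
  have "\<forall>\<^sub>F t in at_left 0. flat_function p t = 0"
    by (auto simp: eventually_at_filter flat_function_def)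
  then show "(flat_function p \<longlongrightarrow> 0) (at_left 0)" by (rule tendsto_eventually)
  have "((\<lambda>t. poly p (inverse t) * exp (- inverse t)) \<longlongrightarrow> 0) (at_right 0)"
    by (rule filterlim_compose[OF poly_exp_tendsto_0 filterlim_inverse_at_top_right])
  then show "(flat_function p \<longlongrightarrow> 0) (at_right 0)"
    by (rule Lim_transform_eventually)
      (auto simp: eventually_at_filter flat_function_def inverse_eq_divide)
qed

lemma flat_function_deriv:
  "(flat_function p has_real_derivative flat_function ([:0, 0, 1:] * (p - pderiv p)) t) (at t)"
proof (cases t "0::real" rule: linorder_cases)
  case less
  have "((\<lambda>t. 0) has_real_derivative 0) (at t)" by simp
  then have "(flat_function p has_real_derivative 0) (at t)"
    by (rule has_field_derivative_transform_within_open[of _ _ _ "{..<0}"])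
      (use less in \<open>auto simp: flat_function_def\<close>)
  with less show ?thesis by (simp add: flat_function_def)
next
  case equal
  \<comment> \<open>Dividing by h multiplies the polynomial by X, so the difference quotient at 0 is
    again a flat function and tends to 0.\<close>
  have "((\<lambda>h. flat_function p h / h) \<longlongrightarrow> 0) (at 0)"
    by (rule Lim_transform_eventually[OF flat_function_tendsto_0[of "[:0, 1:] * p"]])
      (auto simp: eventually_at_filter flat_function_def)
  then show ?thesis using equal by (simp add: DERIV_def flat_function_def)
next
  case greater
  have "((\<lambda>t. poly p (1 / t) * exp (- (1 / t))) has_real_derivative
     poly ([:0, 0, 1:] * (p - pderiv p)) (1 / t) * exp (- (1 / t))) (at t)"
    using greater
    by (auto intro!: derivative_eq_intros poly_DERIV[THEN DERIV_chain2] simp: field_simps power2_eq_square)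
  then have "(flat_function p has_real_derivative poly ([:0, 0, 1:] * (p - pderiv p)) (1 / t) * exp (- (1 / t))) (at t)"
    by (rule has_field_derivative_transform_within_open[of _ _ _ "{0<..}"])
      (use greater in \<open>auto simp: flat_function_def\<close>)
  with greater show ?thesis by (simp add: flat_function_def)
qed

lemma differentiable_times_flat_function: "differentiable_times n (flat_function p)"
proof (induction n arbitrary: p)
  case (Suc n)
  then show ?case using flat_function_deriv[of p] by auto
qed simp

definition interval_bump :: "real \<Rightarrow> real \<Rightarrow> real \<Rightarrow> real" where
  "interval_bump a b t = flat_function 1 (t - a) * flat_function 1 (b - t)"

lemma interval_bump_nonneg: "0 \<le> interval_bump a b t"
  by (simp add: interval_bump_def flat_function_def)

lemma interval_bump_pos_iff: "0 < interval_bump a b t \<longleftrightarrow> a < t \<and> t < b"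
  by (simp add: interval_bump_def flat_function_def)

lemma interval_bump_eq_0_iff: "interval_bump a b t = 0 \<longleftrightarrow> \<not> (a < t \<and> t < b)"
  using interval_bump_nonneg[of a b t] interval_bump_pos_iff[of a b t] by linarith

lemma differentiable_times_interval_bump: "differentiable_times n (interval_bump a b)"
proof -
  have "differentiable_times n (\<lambda>t. flat_function 1 (1 * t + - a) * flat_function 1 (-1 * t + b))"
    by (intro differentiable_times_mult differentiable_times_affine differentiable_times_flat_function)
  then show ?thesis by (simp add: interval_bump_def[abs_def] add.commute)
qed

text \<open>The bump is positive exactly on the open interval, so the values increase to 1 there and
  stay 0 elsewhere: smooth approximation of an indicator from below without mollification.\<close>

definition interval_approx :: "nat \<Rightarrow> real \<Rightarrow> real \<Rightarrow> real \<Rightarrow> real" where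
  "interval_approx k a b t = 1 - exp (- real k * interval_bump a b t)"

lemma differentiable_times_interval_approx: "differentiable_times n (interval_approx k a b)"
proof -
  have "differentiable_times n (\<lambda>t. 1 + (-1) * exp (- real k * interval_bump a b t))"
    by (intro differentiable_times_mult differentiable_times_add differentiable_times_const
        differentiable_times_exp differentiable_times_interval_bump)
  then show ?thesis by (simp add: interval_approx_def[abs_def])
qed

lemma interval_approx_bounds: "0 \<le> interval_approx k a b t" "interval_approx k a b t \<le> 1"
  using interval_bump_nonneg[of a b t] by (auto simp: interval_approx_def)

lemma interval_approx_outside: "\<not> (a < t \<and> t < b) \<Longrightarrow> interval_approx k a b t = 0"
  using interval_bump_eq_0_iff[of a b t] by (simp add: interval_approx_def)

lemma interval_approx_tendsto:
  assumes "a < t" "t < b" shows "(\<lambda>k. interval_approx k a b t) \<longlonglongrightarrow> 1"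
proof -
  have "exp (- interval_bump a b t) < 1" using assms interval_bump_pos_iff[of a b t] by simp
  then have "(\<lambda>k. 1 - exp (- interval_bump a b t) ^ k) \<longlonglongrightarrow> 1 - 0"
    by (intro tendsto_intros LIMSEQ_realpow_zero) auto
  then show ?thesis by (simp add: interval_approx_def exp_of_nat_mult[symmetric])
qed

subsection \<open>Test functions\<close>

text \<open>Each direction differentiates only its own factor, so an iterated derivative is recorded
  by how often every basis vector occurs in \<open>bs\<close>, irrespective of the order.\<close>

lemma tensor_pderivs:
  fixes h :: "'a::euclidean_space \<Rightarrow> real \<Rightarrow> real"
  assumes h: "\<And>n b. differentiable_times n (h b)" and "set bs \<subseteq> Basis"
  shows "pderivs bs (\<lambda>x. complex_of_real (\<Prod>b\<in>Basis. h b (x \<bullet> b))) =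
      (\<lambda>x. complex_of_real (\<Prod>b\<in>Basis. (deriv ^^ count_list bs b) (h b) (x \<bullet> b)))"
    and "pderivs bs (\<lambda>x. complex_of_real (\<Prod>b\<in>Basis. h b (x \<bullet> b))) differentiable (at x)"
proof -
  let ?f = "\<lambda>x. complex_of_real (\<Prod>b\<in>Basis. h b (x \<bullet> b))"
  let ?T = "\<lambda>k x. complex_of_real (\<Prod>b\<in>Basis. (deriv ^^ k b) (h b) (x \<bullet> b))"
  have der: "(?T k has_derivative (\<lambda>v. complex_of_real (\<Sum>b\<in>Basis. (v \<bullet> b) * (deriv ^^ Suc (k b)) (h b) (x \<bullet> b) *
         (\<Prod>c\<in>Basis - {b}. (deriv ^^ k c) (h c) (x \<bullet> c))))) (at x)" for k x
  proof (intro has_derivative_of_real has_derivative_prod)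
    fix b :: 'a
    have 1: "((deriv ^^ k b) (h b) has_derivative (\<lambda>s. s * (deriv ^^ Suc (k b)) (h b) (x \<bullet> b))) (at (x \<bullet> b))"
      using differentiable_times_deriv_funpow[OF h, of "k b" "Suc (k b)" b "x \<bullet> b"]
      by (simp add: has_field_derivative_def mult_commute_abs)
    have 2: "((\<lambda>x. x \<bullet> b) has_derivative (\<lambda>v. v \<bullet> b)) (at x)"
      by (auto intro!: derivative_eq_intros)
    show "((\<lambda>x. (deriv ^^ k b) (h b) (x \<bullet> b)) has_derivative (\<lambda>v. (v \<bullet> b) * (deriv ^^ Suc (k b)) (h b) (x \<bullet> b))) (at x)"
      by (rule has_derivative_compose[OF 2 1])
  qed
  show eq: "pderivs bs ?f = ?T (count_list bs)"
    using assms(2)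
  proof (induction bs)
    case (Cons c bs)
    then have c: "c \<in> Basis" and IH: "pderivs bs ?f = ?T (count_list bs)" by auto
    show ?case
    proof
      fix x
      have "pderivs (c # bs) ?f x = frechet_derivative (?T (count_list bs)) (at x) c"
        by (simp only: pderivs.simps IH)
      also have "\<dots> = complex_of_real (\<Sum>b\<in>Basis. (c \<bullet> b) * (deriv ^^ Suc (count_list bs b)) (h b) (x \<bullet> b) *
         (\<Prod>d\<in>Basis - {b}. (deriv ^^ count_list bs d) (h d) (x \<bullet> d)))"
        unfolding frechet_derivative_at[OF der, symmetric] ..
      \<comment> \<open>In the product rule the coefficient \<open>c \<bullet> b\<close> is 1 for b
        = c and 0 otherwise, so a single summand survives.\<close>
      also have "(\<Sum>b\<in>Basis. (c \<bullet> b) * (deriv ^^ Suc (count_list bs b)) (h b) (x \<bullet> b) *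
         (\<Prod>d\<in>Basis - {b}. (deriv ^^ count_list bs d) (h d) (x \<bullet> d))) =
         (\<Sum>b\<in>Basis. if b = c then (deriv ^^ Suc (count_list bs b)) (h b) (x \<bullet> b) *
         (\<Prod>d\<in>Basis - {b}. (deriv ^^ count_list bs d) (h d) (x \<bullet> d)) else 0)"
        using c by (intro sum.cong refl) (auto simp: inner_Basis)
      also have "\<dots> = (deriv ^^ Suc (count_list bs c)) (h c) (x \<bullet> c) *
         (\<Prod>d\<in>Basis - {c}. (deriv ^^ count_list bs d) (h d) (x \<bullet> d))"
        using c by (subst sum.delta) auto
      also have "(\<Prod>d\<in>Basis - {c}. (deriv ^^ count_list bs d) (h d) (x \<bullet> d)) =
         (\<Prod>d\<in>Basis - {c}. (deriv ^^ count_list (c # bs) d) (h d) (x \<bullet> d))"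
        by (intro prod.cong refl) auto
      also have "(deriv ^^ Suc (count_list bs c)) (h c) (x \<bullet> c) * \<dots> =
         (\<Prod>d\<in>Basis. (deriv ^^ count_list (c # bs) d) (h d) (x \<bullet> d))"
        using prod.remove[OF finite_Basis c, of "\<lambda>d. (deriv ^^ count_list (c # bs) d) (h d) (x \<bullet> d)"] by simp
      finally show "pderivs (c # bs) ?f x = ?T (count_list (c # bs)) x" .
    qed
  qed simp
  show "pderivs bs ?f differentiable (at x)"
    unfolding eq differentiable_def using der by blast
qed

lemma smooth_tensor:
  fixes h :: "'a::euclidean_space \<Rightarrow> real \<Rightarrow> real"
  assumes h: "\<And>n b. differentiable_times n (h b)"
  shows "smooth (\<lambda>x. complex_of_real (\<Prod>b\<in>Basis. h b (x \<bullet> b)))"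
  unfolding smooth_def C_k_on_def
  using tensor_pderivs(2)[OF h]
  by (auto simp: differentiable_on_def differentiable_imp_continuous_within intro!: differentiable_imp_continuous_on)

text \<open>The common bound by the indicator of a compact box is what lets dominated convergence
  work against a merely locally integrable function.\<close>

lemma box_indicator_approx:
  fixes a b :: "'a::euclidean_space"
  obtains \<phi> :: "nat \<Rightarrow> 'a \<Rightarrow> complex" where "\<And>n. \<phi> n \<in> test_functions"
    "\<And>n x. norm (\<phi> n x) \<le> indicator (cbox a b) x" "\<And>x. (\<lambda>n. \<phi> n x) \<longlonglongrightarrow> indicator (box a b) x"
proof -
  define \<phi> where "\<phi> n x = complex_of_real (\<Prod>c\<in>Basis. interval_approx n (a \<bullet> c) (b \<bullet> c) (x \<bullet> c))" for n and x :: 'a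
  have out: "\<phi> n x = 0" if "x \<notin> box a b" for n x
  proof -
    obtain c where "c \<in> Basis" "\<not> (a \<bullet> c < x \<bullet> c \<and> x \<bullet> c < b \<bullet> c)" using \<open>x \<notin> box a b\<close> by (auto simp: mem_box)
    then have "interval_approx n (a \<bullet> c) (b \<bullet> c) (x \<bullet> c) = 0" using interval_approx_outside by blast
    then show ?thesis using \<open>c \<in> Basis\<close> by (auto simp: \<phi>_def prod_zero_iff)
  qed
  have b1: "norm (\<phi> n x) \<le> 1" for n x
    unfolding \<phi>_def norm_of_real
    by (simp add: abs_prod interval_approx_bounds prod_le_1 del: of_real_prod)
  show ?thesis
  proof (rule that)
    fix n
    have "smooth (\<phi> n)"
      unfolding \<phi>_def[abs_def] by (intro smooth_tensor differentiable_times_interval_approx)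
    moreover have "closure {x. \<phi> n x \<noteq> 0} \<subseteq> cbox a b"
      using out box_subset_cbox by (intro closure_minimal) (auto, blast)
    then have "compact (closure {x. \<phi> n x \<noteq> 0})"
      by (metis bounded_cbox bounded_subset closed_closure compact_eq_bounded_closed)
    ultimately show "\<phi> n \<in> test_functions" by (simp add: test_functions_def)
  next
    fix n x
    show "norm (\<phi> n x) \<le> indicator (cbox a b) x"
      using out[of x n] b1[of n x] box_subset_cbox[of a b] by (auto simp: indicator_def)
  next
    fix x
    show "(\<lambda>n. \<phi> n x) \<longlonglongrightarrow> indicator (box a b) x"
    proof (cases "x \<in> box a b")
      case True
      have "(\<lambda>n. \<phi> n x) \<longlonglongrightarrow> complex_of_real (\<Prod>c\<in>(Basis::'a set). 1)"
        unfolding \<phi>_def using True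
        by (intro tendsto_of_real tendsto_prod interval_approx_tendsto) (auto simp: mem_box)
      then show ?thesis using True by simp
    qed (simp add: out)
  qed
qed

lemma test_functions_L2:
  fixes \<phi> :: "'a::euclidean_space \<Rightarrow> complex"
  assumes "\<phi> \<in> test_functions"
  shows "\<phi> \<in> L2_space lborel" "integrable lborel \<phi>"
proof -
  have "C_k_on 0 \<phi> UNIV" "compact (closure {x. \<phi> x \<noteq> 0})"
    using assms by (auto simp: test_functions_def smooth_def)
  then have c: "continuous_on UNIV \<phi>" and bd: "bounded {x. \<phi> x \<noteq> 0}"
    using bounded_subset[OF compact_imp_bounded closure_subset] by (auto simp: C_k_on_def)
  obtain r where r: "\<And>x. \<phi> x \<noteq> 0 \<Longrightarrow> norm x \<le> r" using bd by (auto simp: bounded_iff)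
  have "compact (\<phi> ` cball 0 r)"
    by (rule compact_continuous_image[OF continuous_on_subset[OF c subset_UNIV] compact_cball])
  then obtain B where "\<forall>w\<in>\<phi> ` cball 0 r. norm w \<le> B"
    using compact_imp_bounded[of "\<phi> ` cball 0 r"] unfolding bounded_iff by auto
  then have B: "\<And>x. norm x \<le> r \<Longrightarrow> norm (\<phi> x) \<le> B" by simp
  have "norm (\<phi> x) \<le> max 0 B" for x
    using r[of x] B[of x] by (cases "\<phi> x = 0") auto
  moreover have "\<phi> \<in> borel_measurable borel" using c by (rule borel_measurable_continuous_onI)
  moreover have "\<phi> x = 0" if "norm x > r" for x using r[of x] that by linarith
  ultimately show "\<phi> \<in> L2_space lborel" "integrable lborel \<phi>"
    using L2_space_bounded_support[of \<phi> "max 0 B" r] by blast+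
qed

text \<open>Open boxes are stable under intersection and generate the Borel sets, so a Dynkin
  argument extends the vanishing to all of them. The whole space is no box; \<open>total\<close>
  covers it and is used for complements.\<close>

lemma integrable_zero_on_boxes_imp_AE_zero:
  fixes g :: "'a::euclidean_space \<Rightarrow> complex"
  assumes g: "integrable lborel g" and total: "(LINT x|lborel. g x) = 0"
    and box: "\<And>a b. (LINT x|lborel. indicator (box a b) x *\<^sub>R g x) = 0"
  shows "AE x in lborel. g x = 0"
proof (rule sigma_finite_measure.density_zero[OF sigma_finite_lborel g])
  fix A :: "'a set" assume "A \<in> sets lborel"
  then have A: "A \<in> sigma_sets UNIV (range (\<lambda>(a, b). box a b :: 'a set))"
    by (simp add: borel_eq_box)
  have int: "set_integrable lborel A g" if "A \<in> sigma_sets UNIV (range (\<lambda>(a, b). box a b :: 'a set))" for A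
    unfolding set_integrable_def
    by (intro integrable_mult_indicator g) (use that in \<open>simp add: borel_eq_box\<close>)
  have "Int_stable (range (\<lambda>(a, b). box a b :: 'a set))"
    by (auto simp: Int_stable_def box_Int_box)
  moreover have "range (\<lambda>(a, b). box a b :: 'a set) \<subseteq> Pow UNIV" by simp
  ultimately show "set_lebesgue_integral lborel A g = 0"
    using A
  proof (induction rule: sigma_sets_induct_disjoint)
    case (basic A)
    then show ?case using box by (auto simp: set_lebesgue_integral_def)
  next
    case empty
    show ?case by (simp add: set_lebesgue_integral_def)
  next
    case (compl A)
    have "set_lebesgue_integral lborel (UNIV - A) g = (LINT x|lborel. g x - indicator A x *\<^sub>R g x)"
      unfolding set_lebesgue_integral_def
      by (intro Bochner_Integration.integral_cong) (auto simp: indicator_def)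
    also have "\<dots> = 0"
      using compl int[OF compl(1)] g total
      by (simp add: set_integrable_def set_lebesgue_integral_def)
    finally show ?case .
  next
    case (union A)
    have meas: "A i \<in> sets lborel" for i using union(2) by (auto simp: borel_eq_box)
    have "(\<Union>i. A i) \<in> sets lborel" using meas by blast
    then have "set_integrable lborel (\<Union>i. A i) g"
      unfolding set_integrable_def by (intro integrable_mult_indicator g)
    then have "set_lebesgue_integral lborel (\<Union>i. A i) g = (\<Sum>i. set_lebesgue_integral lborel (A i) g)"
      by (intro lebesgue_integral_countable_add meas) (use union(1) in \<open>auto simp: disjoint_family_on_def\<close>)
    then show ?case using union by simp
  qed
qed

text \<open>The fundamental lemma of the calculus of variations: approximating indicators of boxes
  by test functions makes all box integrals vanish.\<close>

lemma L1_loc_AE_zero: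
  fixes g :: "'a::euclidean_space \<Rightarrow> complex"
  assumes g: "g \<in> L1_loc" and test: "\<And>\<phi>. \<phi> \<in> test_functions \<Longrightarrow> (LINT x|lborel. g x * \<phi> x) = 0"
  shows "AE x in lborel. g x = 0"
proof -
  have [measurable]: "g \<in> borel_measurable borel" using g by (simp add: L1_loc_def)
  have gi: "integrable lborel (\<lambda>x. indicator (cbox a b) x *\<^sub>R g x)" for a b
    using g compact_cbox unfolding L1_loc_def set_integrable_def by blast
  have box: "(LINT x|lborel. indicator (box a b) x *\<^sub>R g x) = 0" for a b
  proof -
    obtain \<phi> :: "nat \<Rightarrow> 'a \<Rightarrow> complex" where \<phi>: "\<And>n. \<phi> n \<in> test_functions"
      "\<And>n x. norm (\<phi> n x) \<le> indicator (cbox a b) x" "\<And>x. (\<lambda>n. \<phi> n x) \<longlonglongrightarrow> indicator (box a b) x"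
      using box_indicator_approx[of a b] by blast
    have [measurable]: "\<phi> n \<in> borel_measurable borel" for n
      using L2_spaceD(1)[OF test_functions_L2(1)[OF \<phi>(1)]] by simp
    have "(\<lambda>n. LINT x|lborel. g x * \<phi> n x) \<longlonglongrightarrow> (LINT x|lborel. g x * indicator (box a b) x)"
    proof (rule integral_dominated_convergence)
      show "integrable lborel (\<lambda>x. norm (indicator (cbox a b) x *\<^sub>R g x))"
        by (intro integrable_norm gi)
      show "AE x in lborel. (\<lambda>n. g x * \<phi> n x) \<longlonglongrightarrow> g x * indicator (box a b) x"
        by (intro AE_I2 tendsto_intros \<phi>)
      show "AE x in lborel. norm (g x * \<phi> n x) \<le> norm (indicator (cbox a b) x *\<^sub>R g x)" for n
        using mult_left_mono[OF \<phi>(2)[of n] norm_ge_zero] by (intro AE_I2) (simp add: norm_mult mult.commute)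
    qed measurable
    then have "(LINT x|lborel. g x * indicator (box a b) x) = 0"
      by (simp add: test[OF \<phi>(1)] LIMSEQ_const_iff)
    also have "(\<lambda>x. g x * indicator (box a b) x) = (\<lambda>x. indicator (box a b) x *\<^sub>R g x)"
      by (auto simp: indicator_def)
    finally show ?thesis .
  qed
  \<comment> \<open>g need not be integrable, so it is restricted to cubes that exhaust the space;
    the intersection of a box with a cube is a box again.\<close>
  define Q where "Q n = box (- (real n *\<^sub>R One)) (real n *\<^sub>R (One::'a))" for n :: nat
  have "AE x in lborel. indicator (Q n) x *\<^sub>R g x = 0" for n
  proof (rule integrable_zero_on_boxes_imp_AE_zero)
    show "integrable lborel (\<lambda>x. indicator (Q n) x *\<^sub>R g x)"
      by (rule Bochner_Integration.integrable_bound[OF gi[of "- (real n *\<^sub>R One)" "real n *\<^sub>R One"]])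
        (auto simp: Q_def indicator_def box_subset_cbox[THEN subsetD])
    show "(LINT x|lborel. indicator (Q n) x *\<^sub>R g x) = 0" unfolding Q_def by (rule box)
    fix a b
    have "(\<lambda>x. indicator (box a b) x *\<^sub>R indicator (Q n) x *\<^sub>R g x) = (\<lambda>x. indicator (box a b \<inter> Q n) x *\<^sub>R g x)"
      by (auto simp: indicator_def)
    then show "(LINT x|lborel. indicator (box a b) x *\<^sub>R indicator (Q n) x *\<^sub>R g x) = 0"
      unfolding Q_def box_Int_box by (simp only: box)
  qed
  then have "AE x in lborel. \<forall>n. indicator (Q n) x *\<^sub>R g x = 0" unfolding AE_all_countable by blast
  then show ?thesis
  proof (rule AE_mp, intro AE_I2 impI)
    fix x assume *: "\<forall>n. indicator (Q n) x *\<^sub>R g x = 0"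
    obtain n where "norm x < real n" using reals_Archimedean2 by blast
    then have "x \<in> Q n"
      using Basis_le_norm[of _ x] by (force simp: Q_def mem_box)
    then show "g x = 0" using *[rule_format, of n] by simp
  qed
qed

lemma L2_space_imp_L1_loc:
  fixes g :: "'a::euclidean_space \<Rightarrow> complex"
  assumes g: "g \<in> L2_space lborel"
  shows "g \<in> L1_loc"
  unfolding L1_loc_def
proof (safe)
  show m [measurable]: "g \<in> borel_measurable lborel" by (rule L2_spaceD(1)[OF g])
  fix A :: "'a set" assume A: "compact A"
  then have [measurable]: "A \<in> sets borel" by (simp add: borel_compact)
  obtain r where r: "\<And>x. x \<in> A \<Longrightarrow> norm x \<le> r" using compact_imp_bounded[OF A] by (auto simp: bounded_iff)
  have "(\<lambda>x. indicator A x :: complex) \<in> L2_space lborel"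
    by (rule L2_space_bounded_support[of _ 1 r]) (use r in \<open>force simp: indicator_def\<close>)+
  from L2_mult_integrable[OF this g] have "integrable lborel (\<lambda>x. indicator A x * g x)" .
  also have "(\<lambda>x. indicator A x * g x) = (\<lambda>x. indicator A x *\<^sub>R g x)" by (auto simp: indicator_def)
  finally show "set_integrable lborel A g" unfolding set_integrable_def .
qed

lemma fourier_pair_imp_has_fourier: "fourier_pair f k \<Longrightarrow> has_fourier_fun f k"
  unfolding has_fourier_def regular_distribution_def
  by (auto dest: fourier_pairD intro: L2_space_imp_L1_loc fourier_pairD(3)[OF _ test_functions_L2])

text \<open>The difference of the two candidates annihilates all test functions. The local fact
  \<open>int\<close> is needed first: the two integrals may be subtracted only because each product
  with a test function is integrable.\<close>

lemma has_fourier_unique: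
  fixes g h :: "'a::euclidean_space \<Rightarrow> complex"
  assumes g: "has_fourier T g" and h: "has_fourier T h"
  shows "AE x in lborel. g x = h x"
proof -
  have L: "g \<in> L1_loc" "h \<in> L1_loc" using g h by (auto simp: has_fourier_def)
  then have [measurable]: "g \<in> borel_measurable borel" "h \<in> borel_measurable borel"
    by (auto simp: L1_loc_def)
  have int: "integrable lborel (\<lambda>x. k x * \<phi> x)" if k: "k \<in> L1_loc" and \<phi>: "\<phi> \<in> test_functions"
    for k \<phi> :: "'a \<Rightarrow> complex"
  proof -
    have [measurable]: "k \<in> borel_measurable borel" "\<phi> \<in> borel_measurable borel"
      using k L2_spaceD(1)[OF test_functions_L2(1)[OF \<phi>]] by (auto simp: L1_loc_def)
    let ?S = "closure {x. \<phi> x \<noteq> 0}"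
    have S: "compact ?S" and "C_k_on 0 \<phi> UNIV"
      using \<phi> by (auto simp: test_functions_def smooth_def)
    then have c: "continuous_on UNIV \<phi>" by (auto simp: C_k_on_def)
    have "compact (\<phi> ` ?S)"
      by (rule compact_continuous_image[OF continuous_on_subset[OF c subset_UNIV] S])
    then obtain B where "\<forall>w\<in>\<phi> ` ?S. norm w \<le> B"
      using compact_imp_bounded[of "\<phi> ` ?S"] unfolding bounded_iff by auto
    then have B: "\<And>x. x \<in> ?S \<Longrightarrow> norm (\<phi> x) \<le> B" by blast
    have "set_integrable lborel ?S k" using k S by (auto simp: L1_loc_def)
    then have "integrable lborel (\<lambda>x. B *\<^sub>R (indicator ?S x *\<^sub>R k x))"
      unfolding set_integrable_def by (intro integrable_scaleR_right)
    then show ?thesis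
    proof (rule Bochner_Integration.integrable_bound)
      show "(\<lambda>x. k x * \<phi> x) \<in> borel_measurable lborel" by simp
      show "AE x in lborel. norm (k x * \<phi> x) \<le> norm (B *\<^sub>R (indicator ?S x *\<^sub>R k x))"
      proof (intro AE_I2)
      fix x
      show "norm (k x * \<phi> x) \<le> norm (B *\<^sub>R (indicator ?S x *\<^sub>R k x))"
      proof (cases "\<phi> x = 0")
        case False
        then have x: "x \<in> ?S" by (intro closure_subset[THEN subsetD]) simp
        have "norm (k x) * norm (\<phi> x) \<le> norm (k x) * \<bar>B\<bar>"
          using B[OF x] by (intro mult_left_mono) auto
        then show ?thesis using x by (simp add: norm_mult mult.commute)
      qed simp
      qed
    qed
  qed
  have "AE x in lborel. g x - h x = 0"
  proof (rule L1_loc_AE_zero)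
    show "(\<lambda>x. g x - h x) \<in> L1_loc"
      using L by (auto simp: L1_loc_def set_integrable_def scaleR_diff_right)
    fix \<phi> :: "'a \<Rightarrow> complex" assume \<phi>: "\<phi> \<in> test_functions"
    have "(LINT x|lborel. g x * \<phi> x) = (LINT x|lborel. h x * \<phi> x)"
      using g h \<phi> by (auto simp: has_fourier_def regular_distribution_def)
    then show "(LINT x|lborel. (g x - h x) * \<phi> x) = 0"
      using int[OF L(1) \<phi>] int[OF L(2) \<phi>] by (simp add: left_diff_distrib)
  qed
  then show ?thesis by simp
qed

text \<open>The L^2 transform of f exists and is also a distributional one, so by uniqueness it
  agrees almost everywhere with k. Hence k is square integrable and may be paired with the larger
  class of functions.\<close>

lemma has_fourier_imp_fourier_pair:
  assumes f: "f \<in> L2_space lborel" and k: "has_fourier_fun f k"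
  shows "fourier_pair f k"
proof -
  obtain K where K: "fourier_pair f K" using fourier_pair_exists[OF f] by blast
  show ?thesis
    by (rule fourier_pair_cong_AE[OF K])
      (use f k has_fourier_unique[OF k fourier_pair_imp_has_fourier[OF K]] in
        \<open>auto simp: has_fourier_def L1_loc_def L2_space_def\<close>)
qed

lemma fourier_pair_norm:
  fixes f :: "'a::euclidean_space \<Rightarrow> complex"
  assumes fk: "fourier_pair f k"
  shows "(L2_norm lborel k)\<^sup>2 = (2 * pi) ^ DIM('a) * (L2_norm lborel f)\<^sup>2"
proof -
  obtain K where K: "fourier_pair f K" "(L2_norm lborel K)\<^sup>2 = (2 * pi) ^ DIM('a) * (L2_norm lborel f)\<^sup>2"
    using fourier_pair_exists[OF fourier_pairD(1)[OF fk]] by blast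
  have "L2_norm lborel k = L2_norm lborel K"
    by (intro L2_norm_cong_AE L2_spaceD(1) fourier_pairD(2)[OF fk] fourier_pairD(2)[OF K(1)]
        has_fourier_unique[OF fourier_pair_imp_has_fourier[OF fk] fourier_pair_imp_has_fourier[OF K(1)]])
  then show ?thesis using K(2) by simp
qed

section \<open>Harmonic extension on the frequency side\<close>

subsection \<open>The Poisson integral\<close>

text \<open>The exponent i x.\<xi> - y|\<xi>| of a decaying plane wave. Being linear in the point,
  it makes differentiation in direction e multiplication by the phase of e.\<close>

definition poisson_phase :: "'a::euclidean_space \<Rightarrow> 'a \<times> real \<Rightarrow> complex" where
  "poisson_phase \<xi> z = \<i> * complex_of_real (fst z \<bullet> \<xi>) - complex_of_real (snd z * norm \<xi>)"

lemma poisson_phase_add: "poisson_phase \<xi> (z + t *\<^sub>R e) = poisson_phase \<xi> z + of_real t * poisson_phase \<xi> e"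
  by (simp add: poisson_phase_def inner_add_left algebra_simps)

lemma norm_exp_poisson_phase: "norm (exp (poisson_phase \<xi> z)) = exp (- (snd z * norm \<xi>))"
  by (simp add: poisson_phase_def)

lemma poisson_phase_bound: "norm (poisson_phase \<xi> e) \<le> 2 * norm e * norm \<xi>"
proof -
  have "norm (poisson_phase \<xi> e) \<le> \<bar>fst e \<bullet> \<xi>\<bar> + \<bar>snd e * norm \<xi>\<bar>"
    unfolding poisson_phase_def by (rule order_trans[OF norm_triangle_ineq4]) (simp add: norm_mult)
  also have "\<dots> \<le> norm (fst e) * norm \<xi> + norm (snd e) * norm \<xi>"
    using Cauchy_Schwarz_ineq2[of "fst e" \<xi>] by (simp add: abs_mult)
  also have "\<dots> \<le> norm e * norm \<xi> + norm e * norm \<xi>"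
    using norm_fst_le[of "fst e" "snd e"] norm_snd_le[of "snd e" "fst e"]
    by (intro add_mono mult_right_mono) auto
  finally show ?thesis by (simp add: mult_ac)
qed

lemma poisson_phase_measurable [measurable]: "(\<lambda>\<xi>. poisson_phase \<xi> z) \<in> borel_measurable borel"
  unfolding poisson_phase_def by measurable

text \<open>The horizontal components i \<xi>_b contribute -|\<xi>|^2 and the vertical one,
  -|\<xi>|, contributes +|\<xi>|^2. This cancellation is why every wave is harmonic.\<close>

lemma poisson_phase_square_sum: "(\<Sum>e\<in>Basis. (poisson_phase \<xi> e)\<^sup>2) = 0"
proof -
  have "(\<Sum>e\<in>Basis. (poisson_phase \<xi> e)\<^sup>2) =
     (\<Sum>e\<in>(\<lambda>u. (u, 0)) ` Basis. (poisson_phase \<xi> e)\<^sup>2) + (\<Sum>e\<in>(\<lambda>v. (0, v)) ` Basis. (poisson_phase \<xi> e)\<^sup>2)"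
    unfolding Basis_prod_def by (rule sum.union_disjoint) auto
  also have "(\<Sum>e\<in>(\<lambda>u. (u, 0)) ` Basis. (poisson_phase \<xi> e)\<^sup>2) = (\<Sum>b\<in>Basis. - complex_of_real ((\<xi> \<bullet> b)\<^sup>2))"
    by (subst sum.reindex) (auto simp: inj_on_def poisson_phase_def power_mult_distrib inner_commute)
  also have "\<dots> = - complex_of_real ((norm \<xi>)\<^sup>2)"
    by (simp add: norm_square_eq_sum_Basis sum_negf)
  also have "(\<Sum>e\<in>(\<lambda>v. (0, v)) ` Basis. (poisson_phase \<xi> e)\<^sup>2) = complex_of_real ((norm \<xi>)\<^sup>2)"
    by (simp add: poisson_phase_def)
  finally show ?thesis by simp
qed

text \<open>Integrability is demanded at every height because multiplication by a phase, that is,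
  taking a derivative, consumes part of the damping; in this form the class is closed under
  it.\<close>

definition damped_integrable :: "('a::euclidean_space \<Rightarrow> complex) \<Rightarrow> bool" where
  "damped_integrable a \<longleftrightarrow> a \<in> borel_measurable borel \<and>
     (\<forall>y>0. integrable lborel (\<lambda>\<xi>. exp (- (y * norm \<xi>)) * norm (a \<xi>)))"

lemma damped_integrableD:
  assumes "damped_integrable a"
  shows "a \<in> borel_measurable borel" "0 < y \<Longrightarrow> integrable lborel (\<lambda>\<xi>. exp (- (y * norm \<xi>)) * norm (a \<xi>))"
  using assms by (auto simp: damped_integrable_def)

lemma damped_integrable_phase:
  assumes a: "damped_integrable a"
  shows "damped_integrable (\<lambda>\<xi>. poisson_phase \<xi> e * a \<xi>)"
  unfolding damped_integrable_def
proof (intro conjI allI impI)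
  have [measurable]: "a \<in> borel_measurable borel" using a by (simp add: damped_integrable_def)
  show "(\<lambda>\<xi>. poisson_phase \<xi> e * a \<xi>) \<in> borel_measurable borel" by measurable
  fix y :: real assume y: "0 < y"
  \<comment> \<open>Half of the damping pays for the linear growth of the phase: |\<xi>| \<le> (2/y)
    exp(y|\<xi>|/2). The constant is this 2/y times the 2 \<open>norm e\<close> of
    \<open>poisson_phase_bound\<close>.\<close>
  have "integrable lborel (\<lambda>\<xi>. (4 * norm e / y) * (exp (- ((y / 2) * norm \<xi>)) * norm (a \<xi>)))"
    using y by (intro integrable_mult_right damped_integrableD(2)[OF a]) simp
  then show "integrable lborel (\<lambda>\<xi>. exp (- (y * norm \<xi>)) * norm (poisson_phase \<xi> e * a \<xi>))"
  proof (rule Bochner_Integration.integrable_bound)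
    show "AE \<xi> in lborel. norm (exp (- (y * norm \<xi>)) * norm (poisson_phase \<xi> e * a \<xi>)) \<le>
       norm ((4 * norm e / y) * (exp (- ((y / 2) * norm \<xi>)) * norm (a \<xi>)))"
    proof (intro AE_I2)
      fix \<xi> :: 'a
      have "(y / 2) * norm \<xi> \<le> exp ((y / 2) * norm \<xi>)"
        using exp_ge_add_one_self[of "(y / 2) * norm \<xi>"] by linarith
      then have "norm \<xi> \<le> 2 / y * exp ((y / 2) * norm \<xi>)"
        using y by (simp add: field_simps)
      then have "norm (poisson_phase \<xi> e) \<le> 2 * norm e * (2 / y * exp ((y / 2) * norm \<xi>))"
        using poisson_phase_bound[of \<xi> e] by (meson mult_left_mono norm_ge_zero mult_nonneg_nonneg order_trans zero_le_numeral)
      then have "exp (- (y * norm \<xi>)) * norm (poisson_phase \<xi> e) \<le> exp (- (y * norm \<xi>)) * (2 * norm e * (2 / y * exp ((y / 2) * norm \<xi>)))"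
        by (intro mult_left_mono) auto
      also have "\<dots> = (4 * norm e / y) * (exp (- (y * norm \<xi>)) * exp ((y / 2) * norm \<xi>))"
        by simp
      also have "exp (- (y * norm \<xi>)) * exp ((y / 2) * norm \<xi>) = exp (- ((y / 2) * norm \<xi>))"
        by (simp add: exp_add[symmetric] field_simps)
      finally have "exp (- (y * norm \<xi>)) * norm (poisson_phase \<xi> e) * norm (a \<xi>) \<le>
        (4 * norm e / y) * exp (- ((y / 2) * norm \<xi>)) * norm (a \<xi>)"
        by (intro mult_right_mono) auto
      then show "norm (exp (- (y * norm \<xi>)) * norm (poisson_phase \<xi> e * a \<xi>)) \<le>
         norm ((4 * norm e / y) * (exp (- ((y / 2) * norm \<xi>)) * norm (a \<xi>)))"
        using y by (simp add: norm_mult abs_mult mult.assoc)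
    qed
  qed measurable
qed

definition poisson_integral :: "('a::euclidean_space \<Rightarrow> complex) \<Rightarrow> 'a \<times> real \<Rightarrow> complex" where
  "poisson_integral a z = (LINT \<xi>|lborel. exp (poisson_phase \<xi> z) * a \<xi>)"

lemma poisson_integrand_integrable:
  assumes a: "damped_integrable a" and z: "0 < snd z"
  shows "integrable lborel (\<lambda>\<xi>. exp (poisson_phase \<xi> z) * a \<xi>)"
proof -
  have [measurable]: "a \<in> borel_measurable borel" using a by (simp add: damped_integrable_def)
  have "integrable lborel (\<lambda>\<xi>. exp (- (snd z * norm \<xi>)) * norm (a \<xi>))"
    using a z by (simp add: damped_integrable_def)
  then show ?thesis
    by (rule Bochner_Integration.integrable_bound)
      (measurable, intro AE_I2, simp only: norm_mult norm_exp_poisson_phase real_norm_def abs_mult abs_exp_cancel abs_norm_cancel order_refl)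
qed

lemma norm_exp_minus_one_le: "norm (exp w - 1) \<le> norm w * exp (norm w)" for w :: complex
proof -
  have "norm (exp w - exp 0) \<le> exp (norm w) * norm (w - 0)"
  proof (rule field_differentiable_bound[of "cball 0 (norm w)" exp exp])
    show "norm (exp v) \<le> exp (norm w)" if "v \<in> cball 0 (norm w)" for v
      using norm_exp[of v] that by (auto intro: order_trans)
  qed (auto intro!: derivative_eq_intros)
  then show ?thesis by (simp add: mult.commute)
qed

lemma half_space_approx:
  fixes Z :: "nat \<Rightarrow> 'a::euclidean_space \<times> real"
  assumes "Z \<longlonglongrightarrow> z" "0 < snd z"
  shows "\<forall>\<^sub>F n in sequentially. snd z / 2 < snd (Z n)"
  by (rule order_tendstoD(1)[OF tendsto_snd[OF assms(1)]]) (use assms(2) in simp)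

lemma poisson_integral_continuous:
  fixes a :: "'a::euclidean_space \<Rightarrow> complex"
  assumes a: "damped_integrable a"
  shows "continuous_on half_space (poisson_integral a)"
proof (rule continuous_on_sequentiallyI)
  have [measurable]: "a \<in> borel_measurable borel" using a by (simp add: damped_integrable_def)
  fix Z :: "nat \<Rightarrow> 'a \<times> real" and z assume "z \<in> half_space" and Z: "Z \<longlonglongrightarrow> z"
  then have z: "0 < snd z" by (auto simp: half_space_def)
  obtain N where N: "\<And>n. n \<ge> N \<Longrightarrow> snd z / 2 < snd (Z n)"
    using half_space_approx[OF Z z] by (auto simp: eventually_sequentially)
  have "(\<lambda>n. poisson_integral a (Z (n + N))) \<longlonglongrightarrow> poisson_integral a z"
    unfolding poisson_integral_def
  proof (rule integral_dominated_convergence)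
    show "integrable lborel (\<lambda>\<xi>. exp (- (snd z / 2 * norm \<xi>)) * norm (a \<xi>))"
      using z by (intro damped_integrableD(2)[OF a]) simp
    show "AE \<xi> in lborel. (\<lambda>n. exp (poisson_phase \<xi> (Z (n + N))) * a \<xi>) \<longlonglongrightarrow> exp (poisson_phase \<xi> z) * a \<xi>"
      unfolding poisson_phase_def by (intro AE_I2 tendsto_intros LIMSEQ_ignore_initial_segment Z)
    show "AE \<xi> in lborel. norm (exp (poisson_phase \<xi> (Z (n + N))) * a \<xi>) \<le> exp (- (snd z / 2 * norm \<xi>)) * norm (a \<xi>)" for n
    proof (intro AE_I2)
      fix \<xi> :: 'a
      have "snd z / 2 * norm \<xi> \<le> snd (Z (n + N)) * norm \<xi>"
        using N[of "n + N"] by (intro mult_right_mono) auto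
      then have "exp (- (snd (Z (n + N)) * norm \<xi>)) * norm (a \<xi>) \<le> exp (- (snd z / 2 * norm \<xi>)) * norm (a \<xi>)"
        by (intro mult_right_mono) auto
      then show "norm (exp (poisson_phase \<xi> (Z (n + N))) * a \<xi>) \<le> exp (- (snd z / 2 * norm \<xi>)) * norm (a \<xi>)"
        by (simp only: norm_mult norm_exp_poisson_phase)
    qed
  qed measurable
  then show "(\<lambda>n. poisson_integral a (Z n)) \<longlonglongrightarrow> poisson_integral a z"
    by (rule LIMSEQ_offset)
qed

lemma has_vector_derivative_at_0I:
  fixes f :: "real \<Rightarrow> 'b::real_normed_vector"
  assumes "((\<lambda>h. (f h - f 0) /\<^sub>R h) \<longlongrightarrow> D) (at 0)"
  shows "(f has_vector_derivative D) (at 0)"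
  unfolding has_vector_derivative_def has_derivative_at
proof (intro conjI bounded_linear_scaleR_left)
  have "((\<lambda>h. norm ((f h - f 0) /\<^sub>R h - D)) \<longlongrightarrow> 0) (at 0)"
    using assms by (simp add: LIM_zero tendsto_norm_zero)
  then show "((\<lambda>h. norm (f (0 + h) - f 0 - h *\<^sub>R D) / norm h) \<longlongrightarrow> 0) (at 0)"
  proof (rule Lim_transform_eventually)
    have "norm ((f h - f 0) /\<^sub>R h - D) = norm (f (0 + h) - f 0 - h *\<^sub>R D) / norm h" if "h \<noteq> 0" for h
    proof -
      have "(f h - f 0) /\<^sub>R h - D = (f (0 + h) - f 0 - h *\<^sub>R D) /\<^sub>R h"
        using that by (simp add: scaleR_diff_right)
      then show ?thesis by (simp add: divide_inverse mult.commute)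
    qed
    then show "\<forall>\<^sub>F h in at 0. norm ((f h - f 0) /\<^sub>R h - D) = norm (f (0 + h) - f 0 - h *\<^sub>R D) / norm h"
      by (auto simp: eventually_at_filter)
  qed
qed

lemma exp_quotient_tendsto:
  fixes L :: complex
  assumes X: "X \<longlonglongrightarrow> 0" "\<And>n. X n \<noteq> (0::real)"
  shows "(\<lambda>n. (exp (of_real (X n) * L) - 1) / of_real (X n)) \<longlonglongrightarrow> L"
proof -
  have "((\<lambda>w. exp (w * L)) has_field_derivative L) (at 0)"
    by (auto intro!: derivative_eq_intros)
  then have "((\<lambda>h. (exp (h * L) - 1) / h) \<longlongrightarrow> L) (at 0)"
    by (simp add: DERIV_def)
  moreover have "(\<lambda>n. complex_of_real (X n)) \<longlonglongrightarrow> 0" using tendsto_of_real[OF X(1)] by simp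
  ultimately show ?thesis
    using X(2) by (auto simp: tendsto_at_iff_sequentially comp_def)
qed

text \<open>Dominated convergence for the difference quotients. The limit is again a Poisson
  integral, so applying the lemma twice gives the second derivatives.\<close>

lemma poisson_integral_line_derivative:
  fixes a :: "'a::euclidean_space \<Rightarrow> complex"
  assumes a: "damped_integrable a" and z: "z \<in> half_space"
  shows "((\<lambda>t. poisson_integral a (z + t *\<^sub>R e)) has_vector_derivative
           poisson_integral (\<lambda>\<xi>. poisson_phase \<xi> e * a \<xi>) z) (at 0)"
proof (rule has_vector_derivative_at_0I, unfold tendsto_at_iff_sequentially, intro allI impI)
  have [measurable]: "a \<in> borel_measurable borel" by (rule damped_integrableD(1)[OF a])
  define y where "y = snd z"
  have y: "0 < y" using z by (auto simp: half_space_def y_def)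
  fix X :: "nat \<Rightarrow> real" assume "\<forall>i. X i \<in> UNIV - {0}" and X: "X \<longlonglongrightarrow> 0"
  then have X0: "X n \<noteq> 0" for n by auto
  have "(\<lambda>n. \<bar>X n\<bar> * (2 * norm e)) \<longlonglongrightarrow> 0"
    using tendsto_mult[OF tendsto_rabs[OF X] tendsto_const] by simp
  \<comment> \<open>For such small steps the growth of the difference quotient takes at most half of
    the damping at height y, and the displaced point stays in the half-space.\<close>
  from order_tendstoD(2)[OF this, of "y / 2"] y
  obtain N where N: "\<And>n. n \<ge> N \<Longrightarrow> \<bar>X n\<bar> * (2 * norm e) < y / 2"
    by (auto simp: eventually_sequentially)
  let ?Q = "\<lambda>n \<xi>. exp (poisson_phase \<xi> z) * ((exp (of_real (X n) * poisson_phase \<xi> e) - 1) / of_real (X n)) * a \<xi>"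
  have "(\<lambda>n. LINT \<xi>|lborel. ?Q (n + N) \<xi>) \<longlonglongrightarrow> (LINT \<xi>|lborel. exp (poisson_phase \<xi> z) * poisson_phase \<xi> e * a \<xi>)"
  proof (rule integral_dominated_convergence)
    show "integrable lborel (\<lambda>\<xi>. exp (- ((y / 2) * norm \<xi>)) * norm (poisson_phase \<xi> e * a \<xi>))"
      using y by (intro damped_integrableD(2) damped_integrable_phase a) simp
    show "AE \<xi> in lborel. (\<lambda>n. ?Q (n + N) \<xi>) \<longlonglongrightarrow> exp (poisson_phase \<xi> z) * poisson_phase \<xi> e * a \<xi>"
      by (intro AE_I2 tendsto_intros exp_quotient_tendsto LIMSEQ_ignore_initial_segment X X0)
    show "AE \<xi> in lborel. norm (?Q (n + N) \<xi>) \<le> exp (- ((y / 2) * norm \<xi>)) * norm (poisson_phase \<xi> e * a \<xi>)" for n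
    proof (intro AE_I2)
      fix \<xi> :: 'a
      let ?h = "X (n + N)" and ?L = "poisson_phase \<xi> e"
      have "\<bar>?h\<bar> * norm ?L \<le> \<bar>?h\<bar> * (2 * norm e * norm \<xi>)"
        by (intro mult_left_mono poisson_phase_bound) simp
      also have "\<dots> = (\<bar>?h\<bar> * (2 * norm e)) * norm \<xi>" by simp
      also have "\<dots> \<le> (y / 2) * norm \<xi>" using N[of "n + N"] by (intro mult_right_mono) auto
      finally have hL: "\<bar>?h\<bar> * norm ?L \<le> (y / 2) * norm \<xi>" .
      have "norm (exp (of_real ?h * ?L) - 1) \<le> \<bar>?h\<bar> * norm ?L * exp (\<bar>?h\<bar> * norm ?L)"
        using norm_exp_minus_one_le[of "of_real ?h * ?L"] by (simp add: norm_mult)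
      also have "\<dots> \<le> \<bar>?h\<bar> * norm ?L * exp ((y / 2) * norm \<xi>)"
        using hL by (intro mult_left_mono) auto
      finally have "norm ((exp (of_real ?h * ?L) - 1) / of_real ?h) \<le> norm ?L * exp ((y / 2) * norm \<xi>)"
        using X0[of "n + N"] by (simp add: norm_divide field_simps)
      then have "exp (- (y * norm \<xi>)) * norm ((exp (of_real ?h * ?L) - 1) / of_real ?h) \<le>
         exp (- (y * norm \<xi>)) * (norm ?L * exp ((y / 2) * norm \<xi>))"
        by (intro mult_left_mono) auto
      also have "\<dots> = (exp (- (y * norm \<xi>)) * exp ((y / 2) * norm \<xi>)) * norm ?L" by simp
      also have "exp (- (y * norm \<xi>)) * exp ((y / 2) * norm \<xi>) = exp (- ((y / 2) * norm \<xi>))"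
        by (simp add: exp_add[symmetric] field_simps)
      finally have "exp (- (y * norm \<xi>)) * norm ((exp (of_real ?h * ?L) - 1) / of_real ?h) * norm (a \<xi>) \<le>
         exp (- ((y / 2) * norm \<xi>)) * norm ?L * norm (a \<xi>)"
        by (intro mult_right_mono) auto
      then show "norm (?Q (n + N) \<xi>) \<le> exp (- ((y / 2) * norm \<xi>)) * norm (?L * a \<xi>)"
        by (simp only: norm_mult norm_exp_poisson_phase y_def mult.assoc)
    qed
  qed measurable
  then have lim: "(\<lambda>n. LINT \<xi>|lborel. ?Q (n + N) \<xi>) \<longlonglongrightarrow> poisson_integral (\<lambda>\<xi>. poisson_phase \<xi> e * a \<xi>) z"
    by (simp add: poisson_integral_def mult.assoc)
  have eq: "(poisson_integral a (z + X (n + N) *\<^sub>R e) - poisson_integral a (z + 0 *\<^sub>R e)) /\<^sub>R X (n + N) = (LINT \<xi>|lborel. ?Q (n + N) \<xi>)" for n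
  proof -
    let ?h = "X (n + N)"
    have "\<bar>?h * snd e\<bar> \<le> \<bar>?h\<bar> * norm e"
      using norm_snd_le[of "snd e" "fst e"] by (simp add: abs_mult mult_left_mono)
    then have "0 < snd (z + ?h *\<^sub>R e)"
      using N[of "n + N"] y by (simp add: y_def)
    then have "integrable lborel (\<lambda>\<xi>. exp (poisson_phase \<xi> (z + ?h *\<^sub>R e)) * a \<xi>)"
      "integrable lborel (\<lambda>\<xi>. exp (poisson_phase \<xi> z) * a \<xi>)"
      using y by (auto intro!: poisson_integrand_integrable[OF a] simp: y_def)
    then have "poisson_integral a (z + ?h *\<^sub>R e) - poisson_integral a z =
      (LINT \<xi>|lborel. exp (poisson_phase \<xi> (z + ?h *\<^sub>R e)) * a \<xi> - exp (poisson_phase \<xi> z) * a \<xi>)"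
      by (simp add: poisson_integral_def)
    then have "(poisson_integral a (z + ?h *\<^sub>R e) - poisson_integral a (z + 0 *\<^sub>R e)) /\<^sub>R ?h =
      (LINT \<xi>|lborel. (exp (poisson_phase \<xi> (z + ?h *\<^sub>R e)) * a \<xi> - exp (poisson_phase \<xi> z) * a \<xi>) /\<^sub>R ?h)"
      by simp
    also have "\<dots> = (LINT \<xi>|lborel. ?Q (n + N) \<xi>)"
      by (intro Bochner_Integration.integral_cong refl)
        (simp add: poisson_phase_add exp_add scaleR_conv_of_real field_simps)
    finally show ?thesis .
  qed
  show "((\<lambda>h. (poisson_integral a (z + h *\<^sub>R e) - poisson_integral a (z + 0 *\<^sub>R e)) /\<^sub>R h) \<circ> X) \<longlonglongrightarrow>
     poisson_integral (\<lambda>\<xi>. poisson_phase \<xi> e * a \<xi>) z"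
    unfolding comp_def
  proof (rule LIMSEQ_offset[where k=N])
    show "(\<lambda>n. (poisson_integral a (z + X (n + N) *\<^sub>R e) - poisson_integral a (z + 0 *\<^sub>R e)) /\<^sub>R X (n + N)) \<longlonglongrightarrow>
     poisson_integral (\<lambda>\<xi>. poisson_phase \<xi> e * a \<xi>) z"
      unfolding eq by (rule lim)
  qed
qed

lemma poisson_integral_harmonic:
  fixes a :: "'a::euclidean_space \<Rightarrow> complex"
  assumes a: "damped_integrable a" and z: "z \<in> half_space"
  shows "(\<Sum>e\<in>Basis. poisson_integral (\<lambda>\<xi>. poisson_phase \<xi> e * (poisson_phase \<xi> e * a \<xi>)) z) = 0"
proof -
  have "0 < snd z" using z by (auto simp: half_space_def)
  then have int: "integrable lborel (\<lambda>\<xi>. exp (poisson_phase \<xi> z) * (poisson_phase \<xi> e * (poisson_phase \<xi> e * a \<xi>)))" for e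
    by (intro poisson_integrand_integrable damped_integrable_phase a)
  have "(\<Sum>e\<in>Basis. poisson_integral (\<lambda>\<xi>. poisson_phase \<xi> e * (poisson_phase \<xi> e * a \<xi>)) z)
     = (LINT \<xi>|lborel. (\<Sum>e\<in>Basis. exp (poisson_phase \<xi> z) * (poisson_phase \<xi> e * (poisson_phase \<xi> e * a \<xi>))))"
    unfolding poisson_integral_def using int by (subst Bochner_Integration.integral_sum) auto
  also have "\<dots> = (LINT \<xi>|lborel. exp (poisson_phase \<xi> z) * (\<Sum>e\<in>Basis. (poisson_phase \<xi> e)\<^sup>2) * a \<xi>)"
    by (intro Bochner_Integration.integral_cong refl)
      (simp add: sum_distrib_left sum_distrib_right power2_eq_square mult.assoc)
  finally show ?thesis by (simp add: poisson_phase_square_sum)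
qed

section \<open>Uniqueness through convexity of the slice energy\<close>

subsection \<open>Derivatives along lines\<close>

text \<open>Derivatives along one direction are all that the uniqueness argument needs. A solution
  has them through its Frechet derivatives, the Poisson integral through dominated convergence, with
  no joint differentiability to prove.\<close>

definition line_derivative ::
  "('v::real_normed_vector \<Rightarrow> 'b::real_normed_vector) \<Rightarrow> ('v \<Rightarrow> 'b) \<Rightarrow> 'v \<Rightarrow> 'v set \<Rightarrow> bool" where
  "line_derivative f f' e S \<longleftrightarrow> (\<forall>z\<in>S. ((\<lambda>t. f (z + t *\<^sub>R e)) has_vector_derivative f' z) (at 0))"

lemma line_derivative_at:
  assumes "line_derivative f f' e S" "z + s *\<^sub>R e \<in> S"
  shows "((\<lambda>t. f (z + t *\<^sub>R e)) has_vector_derivative f' (z + s *\<^sub>R e)) (at s)"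
proof -
  have "((\<lambda>t. f (z + s *\<^sub>R e + t *\<^sub>R e)) has_vector_derivative f' (z + s *\<^sub>R e)) (at (s - s))"
    using assms by (simp add: line_derivative_def)
  then have "((\<lambda>t. f (z + s *\<^sub>R e + t *\<^sub>R e)) \<circ> (\<lambda>t. t - s) has_vector_derivative 1 *\<^sub>R f' (z + s *\<^sub>R e)) (at s)"
    by (intro vector_diff_chain_at) (auto intro!: derivative_eq_intros)
  then show ?thesis
    by (simp add: comp_def scaleR_diff_left algebra_simps)
qed

lemma line_derivative_inner:
  fixes f g :: "'v::real_normed_vector \<Rightarrow> 'b::real_inner"
  assumes "line_derivative f f' e S" "line_derivative g g' e S"
  shows "line_derivative (\<lambda>z. f z \<bullet> g z) (\<lambda>z. f z \<bullet> g' z + f' z \<bullet> g z) e S"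
  unfolding line_derivative_def
proof
  fix z assume "z \<in> S"
  then have "((\<lambda>t. f (z + t *\<^sub>R e)) has_vector_derivative f' z) (at 0)"
    "((\<lambda>t. g (z + t *\<^sub>R e)) has_vector_derivative g' z) (at 0)"
    using assms by (auto simp: line_derivative_def)
  from bounded_bilinear.has_vector_derivative[OF bounded_bilinear_inner this]
  show "((\<lambda>t. f (z + t *\<^sub>R e) \<bullet> g (z + t *\<^sub>R e)) has_vector_derivative f z \<bullet> g' z + f' z \<bullet> g z) (at 0)"
    by simp
qed

lemma line_derivative_add:
  assumes "line_derivative f f' e S" "line_derivative g g' e S"
  shows "line_derivative (\<lambda>z. f z + g z) (\<lambda>z. f' z + g' z) e S"
  using assms unfolding line_derivative_def by (auto intro: has_vector_derivative_add)

lemma line_derivative_diff: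
  assumes "line_derivative f f' e S" "line_derivative g g' e S"
  shows "line_derivative (\<lambda>z. f z - g z) (\<lambda>z. f' z - g' z) e S"
  using assms unfolding line_derivative_def by (auto intro: has_vector_derivative_diff)

lemma line_derivative_slice:
  assumes "line_derivative f f' (b, 0) half_space" "0 < y"
  shows "line_derivative (\<lambda>x. f (x, y)) (\<lambda>x. f' (x, y)) b UNIV"
  using assms by (auto simp: line_derivative_def half_space_def)

lemma slice_continuous:
  assumes "continuous_on half_space f" "0 < y"
  shows "continuous_on UNIV (\<lambda>x. f (x, y))"
  by (rule continuous_on_compose2[OF assms(1)]) (use assms(2) in \<open>auto simp: half_space_def intro!: continuous_intros\<close>)

lemma cube_supset: "cball (0::'a::euclidean_space) r \<subseteq> cbox (- (r *\<^sub>R One)) (r *\<^sub>R One)"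
proof
  fix x :: 'a assume "x \<in> cball 0 r"
  then show "x \<in> cbox (- (r *\<^sub>R One)) (r *\<^sub>R One)"
    using Basis_le_norm[of _ x] by (force simp: mem_box)
qed

lemma integral_cbox_eq_lborel:
  fixes f :: "'a::euclidean_space \<Rightarrow> real"
  assumes c: "continuous_on UNIV f" and out: "\<And>x. x \<notin> cbox l u \<Longrightarrow> f x = 0"
  shows "integral (cbox l u) f = (LINT x|lborel. f x)" "integrable lborel f"
proof -
  have "integrable lborel (\<lambda>x. indicator (cbox l u) x *\<^sub>R f x)"
    by (rule borel_integrable_compact[OF compact_cbox]) (rule continuous_on_subset[OF c], simp)
  also have "(\<lambda>x. indicator (cbox l u) x *\<^sub>R f x) = f"
  proof
    show "indicator (cbox l u) x *\<^sub>R f x = f x" for x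
      by (cases "x \<in> cbox l u") (simp_all add: out)
  qed
  finally show i: "integrable lborel f" .
  have "(f has_integral (LINT x|lborel. f x)) UNIV" by (rule has_integral_integral_lborel[OF i])
  moreover have "f = (\<lambda>x. if x \<in> cbox l u then f x else 0)" using out by auto
  ultimately have "((\<lambda>x. if x \<in> cbox l u then f x else 0) has_integral (LINT x|lborel. f x)) UNIV" by simp
  then have "(f has_integral (LINT x|lborel. f x)) (cbox l u)"
    by (simp only: has_integral_restrict_UNIV)
  then show "integral (cbox l u) f = (LINT x|lborel. f x)" by (rule integral_unique)
qed

text \<open>Translation invariance of the integral, differentiated.\<close>

lemma integral_line_derivative_eq_0:
  fixes G :: "'a::euclidean_space \<Rightarrow> real"
  assumes G: "line_derivative G G' b UNIV" and c: "continuous_on UNIV G" and c': "continuous_on UNIV G'"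
    and out: "\<And>x. norm x > r \<Longrightarrow> G x = 0" and b: "norm b = 1"
  defines "Q \<equiv> cbox (- ((r + 1) *\<^sub>R One)) ((r + 1) *\<^sub>R (One::'a))"
  shows "integral Q G' = 0"
proof -
  have cI: "continuous_on UNIV (\<lambda>x. G (x + t *\<^sub>R b))" for t
    by (rule continuous_on_compose2[OF c]) (auto intro!: continuous_intros)
  \<comment> \<open>A shift of length below 1 keeps the support inside the cube, whose half side
    exceeds r by 1, so the cube integral is the full integral and does not depend on t.\<close>
  have const: "integral Q (\<lambda>x. G (x + t *\<^sub>R b)) = (LINT x|lborel. G x)" if t: "\<bar>t\<bar> < 1" for t
  proof -
    have "G (x + t *\<^sub>R b) = 0" if "x \<notin> Q" for x
    proof -
      have "norm x > r + 1" using that cube_supset[of "r + 1"] unfolding Q_def by (force simp: subset_iff)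
      moreover have "norm x \<le> norm (x + t *\<^sub>R b) + norm (t *\<^sub>R b)"
        by (metis add_diff_cancel_right' norm_triangle_ineq4)
      ultimately show ?thesis using t b by (intro out) auto
    qed
    then have "integral Q (\<lambda>x. G (x + t *\<^sub>R b)) = (LINT x|lborel. G (x + t *\<^sub>R b))"
      unfolding Q_def by (intro integral_cbox_eq_lborel cI) auto
    then show ?thesis
      using c by (simp add: lborel_integral_translate borel_measurable_continuous_onI)
  qed
  have at: "at (0::real) within {-1<..<1} = at 0" by (rule at_within_open) auto
  define l u where "l = - ((r + 1) *\<^sub>R (One::'a))" and "u = (r + 1) *\<^sub>R (One::'a)"
  have Q: "Q = cbox l u" unfolding Q_def l_def u_def ..
  have "((\<lambda>t::real. integral (cbox l u) (\<lambda>x. G (x + t *\<^sub>R b))) has_vector_derivative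
      integral (cbox l u) (\<lambda>x. G' (x + 0 *\<^sub>R b))) (at 0 within {-1<..<1})"
  proof (rule leibniz_rule_vector_derivative[where f="\<lambda>t x. G (x + t *\<^sub>R b)" and fx="\<lambda>t x. G' (x + t *\<^sub>R b)" and ?x0.0=0])
    show "((\<lambda>t. G (x + t *\<^sub>R b)) has_vector_derivative G' (x + t *\<^sub>R b)) (at t within {-1<..<1})" for t x
      by (rule has_vector_derivative_at_within[OF line_derivative_at[OF G]]) simp
    show "(\<lambda>x. G (x + t *\<^sub>R b)) integrable_on cbox l u" for t
      by (intro integrable_continuous continuous_on_subset[OF cI]) simp
    show "continuous_on ({-1<..<1} \<times> cbox l u) (\<lambda>(t, x). G' (x + t *\<^sub>R b))"
      unfolding split_beta by (rule continuous_on_compose2[OF c']) (auto intro!: continuous_intros)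
    show "(0::real) \<in> {-1<..<1}" "convex {-1<..<1::real}" by auto
  qed
  then have 1: "((\<lambda>t. integral Q (\<lambda>x. G (x + t *\<^sub>R b))) has_vector_derivative integral Q G') (at 0)"
    unfolding at Q by simp
  have "((\<lambda>t. LINT x|lborel. G x) has_vector_derivative 0) (at 0)" by simp
  then have 2: "((\<lambda>t. integral Q (\<lambda>x. G (x + t *\<^sub>R b))) has_vector_derivative 0) (at 0)"
    by (rule has_vector_derivative_transform_within_open[of _ _ _ "{-1<..<1}"]) (auto simp: const)
  show ?thesis by (rule vector_derivative_unique_at[OF 1 2])
qed

subsection \<open>A cutoff function\<close>

lemma pos_part_power_deriv:
  "((\<lambda>s. max 0 s ^ Suc (Suc m)) has_real_derivative real (Suc (Suc m)) * max 0 s ^ Suc m) (at s)"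
proof (cases s "0::real" rule: linorder_cases)
  case less
  have "((\<lambda>s. 0) has_real_derivative real (Suc (Suc m)) * max 0 s ^ Suc m) (at s)" using less by simp
  then show ?thesis
    by (rule has_field_derivative_transform_within_open[of _ _ _ "{..<0}"]) (use less in auto)
next
  case greater
  have "((\<lambda>s. s ^ Suc (Suc m)) has_real_derivative real (Suc (Suc m)) * max 0 s ^ Suc m) (at s)"
    using DERIV_pow[of "Suc (Suc m)" s UNIV] greater by simp
  then show ?thesis
    by (rule has_field_derivative_transform_within_open[of _ _ _ "{0<..}"]) (use greater in auto)
next
  case equal
  have "((\<lambda>h::real. max 0 h ^ Suc (Suc m) / h) \<longlongrightarrow> 0) (at 0)"
  proof (rule Lim_null_comparison)
    have "norm (max 0 h ^ Suc (Suc m) / h) \<le> \<bar>h\<bar> ^ Suc m" for h :: real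
    proof (cases "h > 0")
      case False
      then have "max 0 h = 0" by simp
      then have "norm (max 0 h ^ Suc (Suc m) / h) = 0" by simp
      also have "\<dots> \<le> \<bar>h\<bar> ^ Suc m" by (intro zero_le_power abs_ge_zero)
      finally show ?thesis .
    qed simp
    then show "\<forall>\<^sub>F h in at 0. norm (max 0 h ^ Suc (Suc m) / h) \<le> \<bar>h :: real\<bar> ^ Suc m" by simp
    have "((\<lambda>h::real. \<bar>h\<bar> ^ Suc m) \<longlongrightarrow> \<bar>0\<bar> ^ Suc m) (at 0)"
      by (intro tendsto_intros)
    then show "((\<lambda>h::real. \<bar>h\<bar> ^ Suc m) \<longlongrightarrow> 0) (at 0)" by simp
  qed
  then show ?thesis using equal by (simp add: DERIV_def)
qed

context
  fixes R :: real
begin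

definition cutoff_base :: "'a::euclidean_space \<Rightarrow> real" where
  "cutoff_base x = max 0 (1 - (x \<bullet> x) / R\<^sup>2)"

text \<open>The third power is the least integer power of a positive part with two continuous
  derivatives. \<open>cutoff1 b\<close> and \<open>cutoff2 b\<close> are the first and second
  derivative along b in closed form.\<close>

definition cutoff :: "'a::euclidean_space \<Rightarrow> real" where
  "cutoff x = cutoff_base x ^ 3"

definition cutoff1 :: "'a \<Rightarrow> 'a::euclidean_space \<Rightarrow> real" where
  "cutoff1 b x = - (6 * cutoff_base x ^ 2 * (x \<bullet> b) / R\<^sup>2)"

definition cutoff2 :: "'a \<Rightarrow> 'a::euclidean_space \<Rightarrow> real" where
  "cutoff2 b x = 24 * cutoff_base x * (x \<bullet> b)\<^sup>2 / R^4 - 6 * cutoff_base x ^ 2 / R\<^sup>2"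

lemma cutoff_continuous:
  "continuous_on A cutoff" "continuous_on A (cutoff1 b)" "continuous_on A (cutoff2 b)"
  unfolding cutoff_def cutoff1_def cutoff2_def cutoff_base_def divide_inverse
  by (intro continuous_intros)+

lemma cutoff_base_bounds: "0 \<le> cutoff_base x" "cutoff_base x \<le> 1"
  by (auto simp: cutoff_base_def)

lemma cutoff_bounds: "0 \<le> cutoff x" "cutoff x \<le> 1"
  using cutoff_base_bounds[of x] by (auto simp: cutoff_def power_le_one)

lemma cutoff_base_power_deriv:
  assumes b: "b \<in> Basis"
  shows "((\<lambda>t. cutoff_base (x + t *\<^sub>R b) ^ Suc (Suc m)) has_real_derivative
     - (real (Suc (Suc m)) * cutoff_base x ^ Suc m * (2 * (x \<bullet> b) / R\<^sup>2))) (at 0)"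
proof -
  have q: "(x + t *\<^sub>R b) \<bullet> (x + t *\<^sub>R b) = x \<bullet> x + 2 * t * (x \<bullet> b) + t\<^sup>2" for t
    using b by (simp add: inner_add_left inner_add_right inner_commute[of b x] power2_eq_square distrib_left)
  have "((\<lambda>t. 1 - (x \<bullet> x + 2 * t * (x \<bullet> b) + t\<^sup>2) * inverse (R\<^sup>2)) has_real_derivative - (2 * (x \<bullet> b) / R\<^sup>2)) (at 0)"
    by (auto intro!: derivative_eq_intros simp: divide_inverse)
  from DERIV_chain2[OF pos_part_power_deriv this, of m]
  show ?thesis unfolding cutoff_base_def q by (simp add: divide_inverse)
qed

lemma cutoff_line_derivative:
  assumes b: "b \<in> Basis"
  shows "line_derivative cutoff (cutoff1 b) b UNIV" "line_derivative (cutoff1 b) (cutoff2 b) b UNIV"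
proof -
  have "((\<lambda>t. cutoff (x + t *\<^sub>R b)) has_real_derivative cutoff1 b x) (at 0)" for x
  proof -
    have "((\<lambda>t. cutoff_base (x + t *\<^sub>R b) ^ 3) has_real_derivative - (3 * cutoff_base x ^ 2 * (2 * (x \<bullet> b) / R\<^sup>2))) (at 0)"
      using cutoff_base_power_deriv[OF b, of x 1] by (simp add: numeral_3_eq_3 numeral_2_eq_2)
    then show ?thesis by (simp add: cutoff_def[abs_def] cutoff1_def mult.assoc)
  qed
  then show "line_derivative cutoff (cutoff1 b) b UNIV"
    by (simp add: line_derivative_def has_real_derivative_iff_has_vector_derivative)
  have "((\<lambda>t. cutoff1 b (x + t *\<^sub>R b)) has_real_derivative cutoff2 b x) (at 0)" for x
  proof -
    have p: "((\<lambda>t. cutoff_base (x + t *\<^sub>R b) ^ 2) has_real_derivative - (2 * cutoff_base x * (2 * (x \<bullet> b) / R\<^sup>2))) (at 0)"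
      using cutoff_base_power_deriv[OF b, of x 0] by (simp add: numeral_2_eq_2)
    have "((\<lambda>t. (x + t *\<^sub>R b) \<bullet> b) has_real_derivative 1) (at 0)"
      using b by (auto intro!: derivative_eq_intros simp: inner_add_left)
    note D = DERIV_cmult[OF DERIV_mult[OF p this], of "- 6 / R\<^sup>2"]
    have i: "inverse (R ^ 4) = inverse (R\<^sup>2) * inverse (R\<^sup>2)"
      by (simp add: power4_eq_xxxx power2_eq_square)
    have eq: "(\<lambda>t. cutoff1 b (x + t *\<^sub>R b)) = (\<lambda>t. - 6 / R\<^sup>2 * (cutoff_base (x + t *\<^sub>R b) ^ 2 * ((x + t *\<^sub>R b) \<bullet> b)))"
      by (simp add: fun_eq_iff cutoff1_def)
    show ?thesis
      unfolding eq by (rule DERIV_cong[OF D])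
        (simp add: cutoff2_def divide_inverse i algebra_simps power2_eq_square[of "x \<bullet> b"])
  qed
  then show "line_derivative (cutoff1 b) (cutoff2 b) b UNIV"
    by (simp add: line_derivative_def has_real_derivative_iff_has_vector_derivative)
qed

lemma cutoff_base_outside: "0 < R \<Longrightarrow> norm x > R \<Longrightarrow> cutoff_base x = 0"
  using power_strict_mono[of R "norm x" 2]
  by (simp add: cutoff_base_def power2_norm_eq_inner max_def)

lemma cutoff_outside:
  assumes "0 < R" "norm x > R"
  shows "cutoff x = 0" "cutoff1 b x = 0" "cutoff2 b x = 0"
  using cutoff_base_outside[OF assms] by (auto simp: cutoff_def cutoff1_def cutoff2_def)

text \<open>Only the ball of radius R matters, and there |x.b| \<le> R; the two terms contribute 24
  and 6. The factor R^(-2) is what makes the cutoff error vanish in the limit.\<close>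

lemma cutoff2_bound:
  assumes R: "0 < R" and b: "b \<in> Basis"
  shows "\<bar>cutoff2 b x\<bar> \<le> 30 / R\<^sup>2"
proof (cases "norm x > R")
  case True
  then show ?thesis using cutoff_outside(3)[OF R True] R by simp
next
  case False
  have "\<bar>x \<bullet> b\<bar> \<le> R" using Basis_le_norm[OF b, of x] False by linarith
  then have "(x \<bullet> b)\<^sup>2 \<le> R\<^sup>2" using abs_le_square_iff[of "x \<bullet> b" R] R by simp
  then have "cutoff_base x * (x \<bullet> b)\<^sup>2 \<le> 1 * R\<^sup>2"
    using cutoff_base_bounds[of x] by (intro mult_mono) auto
  then have 1: "24 * cutoff_base x * (x \<bullet> b)\<^sup>2 / R^4 \<le> 24 / R\<^sup>2"
    using R by (simp add: field_simps power2_eq_square power4_eq_xxxx)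
  have 2: "6 * cutoff_base x ^ 2 / R\<^sup>2 \<le> 6 / R\<^sup>2"
    using cutoff_base_bounds[of x] R by (intro divide_right_mono) (auto simp: power_le_one)
  have 3: "0 \<le> 24 * cutoff_base x * (x \<bullet> b)\<^sup>2 / R^4" "0 \<le> 6 * cutoff_base x ^ 2 / R\<^sup>2"
    using cutoff_base_bounds[of x] by auto
  have "30 / R\<^sup>2 = 24 / R\<^sup>2 + 6 / R\<^sup>2" by (simp add: add_divide_distrib[symmetric])
  then show ?thesis using 1 2 3 unfolding cutoff2_def by (simp only: abs_le_iff) linarith
qed

end

lemma cutoff_tendsto: "(\<lambda>n. cutoff (real (Suc n)) x) \<longlonglongrightarrow> 1"
proof -
  have i: "(\<lambda>n. inverse (real (Suc n))) \<longlonglongrightarrow> 0" by (rule LIMSEQ_inverse_real_of_nat)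
  have "(\<lambda>n. max 0 (1 - (x \<bullet> x) * (inverse (real (Suc n)))\<^sup>2) ^ 3) \<longlonglongrightarrow> max 0 (1 - (x \<bullet> x) * 0\<^sup>2) ^ 3"
    by (intro tendsto_intros i)
  then show ?thesis by (simp add: cutoff_def cutoff_base_def divide_inverse power_inverse)
qed

subsection \<open>Bounded subharmonic slices\<close>

lemma sum_Basis_prod_real:
  fixes f :: "'a::euclidean_space \<times> real \<Rightarrow> 'b::comm_monoid_add"
  shows "(\<Sum>e\<in>Basis. f e) = (\<Sum>b\<in>Basis. f (b, 0)) + f (0, 1)"
proof -
  have "(\<Sum>e\<in>Basis. f e) = (\<Sum>e\<in>(\<lambda>u. (u, 0)) ` Basis. f e) + (\<Sum>e\<in>(\<lambda>v. (0, v)) ` Basis. f e)"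
    unfolding Basis_prod_def by (rule sum.union_disjoint) auto
  then show ?thesis by (simp add: sum.reindex inj_on_def)
qed

lemma weighted_slice_integral_derivative:
  fixes F :: "'a::euclidean_space \<times> real \<Rightarrow> real"
  assumes F: "line_derivative F F' (0, 1) half_space"
    and c: "continuous_on half_space F" "continuous_on half_space F'" and k: "continuous_on UNIV k" and y: "0 < y"
  shows "((\<lambda>y. integral (cbox l u) (\<lambda>x. F (x, y) * k x)) has_real_derivative
     integral (cbox l u) (\<lambda>x. F' (x, y) * k x)) (at y)"
proof -
  have at: "at y within {0<..} = at y" using y by (intro at_within_open) auto
  have "((\<lambda>y. integral (cbox l u) (\<lambda>x. F (x, y) * k x)) has_vector_derivative
     integral (cbox l u) (\<lambda>x. F' (x, y) * k x)) (at y within {0<..})"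
  proof (rule leibniz_rule_vector_derivative[where f="\<lambda>y x. F (x, y) * k x" and fx="\<lambda>y x. F' (x, y) * k x" and ?x0.0=y])
    show "((\<lambda>y. F (x, y) * k x) has_vector_derivative F' (x, s) * k x) (at s within {0<..})" if "s \<in> {0<..}" for s x
    proof -
      have "((\<lambda>t. F ((x, 0) + t *\<^sub>R (0, 1))) has_vector_derivative F' ((x, 0) + s *\<^sub>R (0, 1))) (at s)"
        by (rule line_derivative_at[OF F]) (use that in \<open>simp add: half_space_def\<close>)
      then have "((\<lambda>t. F (x, t) * k x) has_vector_derivative F' (x, s) * k x) (at s)"
        by (simp add: has_vector_derivative_mult_left)
      then show ?thesis by (rule has_vector_derivative_at_within)
    qed
    show "(\<lambda>x. F (x, s) * k x) integrable_on cbox l u" if "s \<in> {0<..}" for s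
      using that by (intro integrable_continuous continuous_on_mult
         continuous_on_subset[OF slice_continuous[OF c(1)]] continuous_on_subset[OF k]) auto
    show "continuous_on ({0<..} \<times> cbox l u) (\<lambda>(y, x). F' (x, y) * k x)"
      unfolding split_beta
      by (rule continuous_on_mult, rule continuous_on_compose2[OF c(2)], goal_cases)
        (auto simp: half_space_def intro!: continuous_intros continuous_on_compose2[OF k])
    show "y \<in> {0<..}" "convex {0::real<..}" using y by auto
  qed
  then show ?thesis unfolding at by (simp add: has_real_derivative_iff_has_vector_derivative)
qed

text \<open>The model is S = |w|^2 with w the difference of two solutions. One bound M for all
  slices enters twice: in the cutoff error and in the passage from convexity to
  monotonicity.\<close>

locale subharmonic_slices =
  fixes S :: "'a::euclidean_space \<times> real \<Rightarrow> real" and S1 S2 :: "'a \<times> real \<Rightarrow> 'a \<times> real \<Rightarrow> real" and M :: real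
  assumes cont: "continuous_on half_space S" "\<And>e. e \<in> Basis \<Longrightarrow> continuous_on half_space (S1 e)"
      "\<And>e. e \<in> Basis \<Longrightarrow> continuous_on half_space (S2 e)"
    and deriv: "\<And>e. e \<in> Basis \<Longrightarrow> line_derivative S (S1 e) e half_space"
      "\<And>e. e \<in> Basis \<Longrightarrow> line_derivative (S1 e) (S2 e) e half_space"
    and nonneg: "\<And>z. z \<in> half_space \<Longrightarrow> 0 \<le> S z"
    and subharmonic: "\<And>z. z \<in> half_space \<Longrightarrow> 0 \<le> (\<Sum>e\<in>Basis. S2 e z)"
    and slice_integrable: "\<And>y. 0 < y \<Longrightarrow> integrable lborel (\<lambda>x. S (x, y))"
    and slice_bound: "\<And>y. 0 < y \<Longrightarrow> (LINT x|lborel. S (x, y)) \<le> M"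
begin

abbreviation energy :: "real \<Rightarrow> real" where
  "energy y \<equiv> LINT x|lborel. S (x, y)"

text \<open>Nothing is assumed about integrability of the derivatives of S on slices, so the energy
  itself cannot be differentiated under the integral; with the weight, only a compact cube
  counts.\<close>

definition cutoff_energy :: "real \<Rightarrow> real \<Rightarrow> real" where
  "cutoff_energy R y = (LINT x|lborel. S (x, y) * cutoff R x)"

lemma energy_nonneg: "0 < y \<Longrightarrow> 0 \<le> energy y"
  by (intro integral_nonneg_AE AE_I2 nonneg) (simp add: half_space_def)

text \<open>The b-derivative of S_b \<chi> - S \<chi>_b is S_bb \<chi> - S \<chi>_bb, because the
  mixed terms cancel. So one vanishing integral replaces two integrations by parts.\<close>

lemma integral_by_parts_twice:
  assumes R: "0 < R" and y: "0 < y" and b: "b \<in> Basis"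
  shows "integral (cbox (- ((R + 1) *\<^sub>R One)) ((R + 1) *\<^sub>R One)) (\<lambda>x. S2 (b, 0) (x, y) * cutoff R x) =
         (LINT x|lborel. S (x, y) * cutoff2 R b x)"
proof -
  have e: "(b, 0) \<in> Basis" using b by (simp add: Basis_prod_def)
  define l u where "l = - ((R + 1) *\<^sub>R (One::'a))" and "u = (R + 1) *\<^sub>R (One::'a)"
  have cS: "continuous_on A (\<lambda>x. S (x, y))" "continuous_on A (\<lambda>x. S1 (b, 0) (x, y))" "continuous_on A (\<lambda>x. S2 (b, 0) (x, y))" for A
    using slice_continuous[OF cont(1) y] slice_continuous[OF cont(2)[OF e] y] slice_continuous[OF cont(3)[OF e] y]
    by (auto intro: continuous_on_subset)
  have d: "line_derivative (\<lambda>x. S (x, y)) (\<lambda>x. S1 (b, 0) (x, y)) b UNIV"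
    "line_derivative (\<lambda>x. S1 (b, 0) (x, y)) (\<lambda>x. S2 (b, 0) (x, y)) b UNIV"
    by (rule line_derivative_slice[OF deriv(1)[OF e] y]) (rule line_derivative_slice[OF deriv(2)[OF e] y])
  have "line_derivative (\<lambda>x. S1 (b, 0) (x, y) * cutoff R x - S (x, y) * cutoff1 R b x)
     (\<lambda>x. S2 (b, 0) (x, y) * cutoff R x - S (x, y) * cutoff2 R b x) b UNIV"
    using line_derivative_diff[OF line_derivative_inner[OF d(2) cutoff_line_derivative(1)[OF b, where R=R]]
        line_derivative_inner[OF d(1) cutoff_line_derivative(2)[OF b, where R=R]]] by simp
  then have "integral (cbox l u) (\<lambda>x. S2 (b, 0) (x, y) * cutoff R x - S (x, y) * cutoff2 R b x) = 0"
    unfolding l_def u_def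
    by (rule integral_line_derivative_eq_0)
      (use b in \<open>auto simp: cutoff_outside[OF R] intro!: continuous_intros cS cutoff_continuous\<close>)
  moreover have "(\<lambda>x. S2 (b, 0) (x, y) * cutoff R x) integrable_on cbox l u"
    "(\<lambda>x. S (x, y) * cutoff2 R b x) integrable_on cbox l u"
    by (intro integrable_continuous continuous_intros cS cutoff_continuous)+
  ultimately have "integral (cbox l u) (\<lambda>x. S2 (b, 0) (x, y) * cutoff R x) = integral (cbox l u) (\<lambda>x. S (x, y) * cutoff2 R b x)"
    by (simp add: Henstock_Kurzweil_Integration.integral_diff)
  also have "\<dots> = (LINT x|lborel. S (x, y) * cutoff2 R b x)"
  proof (rule integral_cbox_eq_lborel(1))
    show "continuous_on UNIV (\<lambda>x. S (x, y) * cutoff2 R b x)"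
      by (intro continuous_intros cS cutoff_continuous)
    fix x assume "x \<notin> cbox l u"
    then have "x \<notin> cball 0 (R + 1)" using cube_supset[of "R + 1"] unfolding l_def u_def by blast
    then show "S (x, y) * cutoff2 R b x = 0" using cutoff_outside(3)[OF R, of x b] by simp
  qed
  finally show ?thesis unfolding l_def u_def .
qed

text \<open>By subharmonicity the second y-derivative is at least minus the horizontal part, and
  after integration by parts each of the \<open>DIM('a)\<close> directions costs at most (30 / R^2)
  M. The quadratic term compensates exactly for this total K.\<close>

lemma cutoff_energy_convex:
  assumes R: "0 < R"
  shows "convex_on {0<..} (\<lambda>y. cutoff_energy R y + real DIM('a) * (30 / R\<^sup>2 * M) / 2 * y\<^sup>2)"
proof -
  define l u where "l = - ((R + 1) *\<^sub>R (One::'a))" and "u = (R + 1) *\<^sub>R (One::'a)"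
  define K where "K = real DIM('a) * (30 / R\<^sup>2 * M)"
  have e0: "(0, 1) \<in> (Basis :: ('a \<times> real) set)" by (simp add: Basis_prod_def)
  define J0 J1 J2 where "J0 y = integral (cbox l u) (\<lambda>x. S (x, y) * cutoff R x)"
    and "J1 y = integral (cbox l u) (\<lambda>x. S1 (0, 1) (x, y) * cutoff R x)"
    and "J2 y = integral (cbox l u) (\<lambda>x. S2 (0, 1) (x, y) * cutoff R x)" for y
  have J0: "(J0 has_real_derivative J1 y) (at y)" and J1: "(J1 has_real_derivative J2 y) (at y)" if "0 < y" for y
    unfolding J0_def[abs_def] J1_def[abs_def] J2_def
    by (intro weighted_slice_integral_derivative deriv cont e0 cutoff_continuous that)+
  have J0_eq: "J0 y = cutoff_energy R y" if y: "0 < y" for y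
    unfolding J0_def cutoff_energy_def
  proof (rule integral_cbox_eq_lborel(1))
    show "continuous_on UNIV (\<lambda>x. S (x, y) * cutoff R x)"
      by (intro continuous_intros slice_continuous[OF cont(1) y] cutoff_continuous)
    fix x assume "x \<notin> cbox l u"
    then have "x \<notin> cball 0 (R + 1)" using cube_supset[of "R + 1"] unfolding l_def u_def by blast
    then show "S (x, y) * cutoff R x = 0" using cutoff_outside(1)[OF R, of x] by simp
  qed
  have J2: "- K \<le> J2 y" if y: "0 < y" for y
  proof -
    have cS: "continuous_on A (\<lambda>x. S2 e (x, y))" if "e \<in> Basis" for e A
      using slice_continuous[OF cont(3)[OF that] y] by (auto intro: continuous_on_subset)
    have int: "(\<lambda>x. S2 e (x, y) * cutoff R x) integrable_on cbox l u" if "e \<in> Basis" for e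
      by (intro integrable_continuous continuous_intros cS cutoff_continuous that)
    have b0: "(b, 0) \<in> (Basis :: ('a \<times> real) set)" if "b \<in> Basis" for b
      using that by (simp add: Basis_prod_def)
    have "0 \<le> integral (cbox l u) (\<lambda>x. \<Sum>e\<in>Basis. S2 e (x, y) * cutoff R x)"
    proof (rule Henstock_Kurzweil_Integration.integral_nonneg)
      show "(\<lambda>x. \<Sum>e\<in>Basis. S2 e (x, y) * cutoff R x) integrable_on cbox l u"
        by (intro integrable_sum int) auto
      show "0 \<le> (\<Sum>e\<in>Basis. S2 e (x, y) * cutoff R x)" for x
        using subharmonic[of "(x, y)"] y cutoff_bounds(1)[of R x]
        by (simp add: sum_distrib_right[symmetric] half_space_def)
    qed
    also have "\<dots> = (\<Sum>e\<in>Basis. integral (cbox l u) (\<lambda>x. S2 e (x, y) * cutoff R x))"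
      by (intro integral_sum int) auto
    also have "\<dots> = (\<Sum>b\<in>Basis. integral (cbox l u) (\<lambda>x. S2 (b, 0) (x, y) * cutoff R x)) + J2 y"
      by (simp add: sum_Basis_prod_real J2_def)
    also have "(\<Sum>b\<in>Basis. integral (cbox l u) (\<lambda>x. S2 (b, 0) (x, y) * cutoff R x)) =
       (\<Sum>b\<in>Basis. LINT x|lborel. S (x, y) * cutoff2 R b x)"
      unfolding l_def u_def by (intro sum.cong refl integral_by_parts_twice R y)
    also have "\<dots> \<le> (\<Sum>b\<in>(Basis::'a set). 30 / R\<^sup>2 * M)"
    proof (rule sum_mono)
      fix b :: 'a assume b: "b \<in> Basis"
      have "(LINT x|lborel. S (x, y) * cutoff2 R b x) \<le> (LINT x|lborel. S (x, y) * (30 / R\<^sup>2))"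
      proof (rule integral_mono)
        show i: "integrable lborel (\<lambda>x. S (x, y) * (30 / R\<^sup>2))"
          using slice_integrable[OF y] by simp
        have m: "(\<lambda>x. S (x, y) * cutoff2 R b x) \<in> borel_measurable lborel"
          using borel_measurable_continuous_onI[OF continuous_on_mult[OF slice_continuous[OF cont(1) y] cutoff_continuous(3)]]
          by simp
        have le: "\<bar>S (x, y) * cutoff2 R b x\<bar> \<le> S (x, y) * (30 / R\<^sup>2)" for x
          using nonneg[of "(x, y)"] y cutoff2_bound[OF R b, of x]
          by (simp only: abs_mult) (intro mult_mono, auto simp: half_space_def)
        show "integrable lborel (\<lambda>x. S (x, y) * cutoff2 R b x)"
          by (rule Bochner_Integration.integrable_bound[OF i m], intro AE_I2, simp only: real_norm_def)
            (rule order_trans[OF le abs_ge_self])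
        show "S (x, y) * cutoff2 R b x \<le> S (x, y) * (30 / R\<^sup>2)" for x
          using le[of x] by linarith
      qed
      also have "\<dots> = 30 / R\<^sup>2 * energy y" by simp
      also have "\<dots> \<le> 30 / R\<^sup>2 * M" using slice_bound[OF y] by (intro mult_left_mono) auto
      finally show "(LINT x|lborel. S (x, y) * cutoff2 R b x) \<le> 30 / R\<^sup>2 * M" .
    qed
    also have "\<dots> = K" by (simp add: K_def)
    finally show ?thesis by simp
  qed
  have CE: "(cutoff_energy R has_real_derivative J1 y) (at y)" if "0 < y" for y
    by (rule has_field_derivative_transform_within_open[OF J0[OF that] open_greaterThan[of 0]])
      (use that J0_eq in auto)
  have "convex_on {0<..} (\<lambda>y. cutoff_energy R y + K / 2 * y\<^sup>2)"
  proof (rule f''_ge0_imp_convex)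
    show "((\<lambda>y. cutoff_energy R y + K / 2 * y\<^sup>2) has_real_derivative J1 y + K * y) (at y)" if "y \<in> {0<..}" for y
      using CE[of y] that by (auto intro!: derivative_eq_intros)
    show "((\<lambda>y. J1 y + K * y) has_real_derivative J2 y + K) (at y)" if "y \<in> {0<..}" for y
      using J1[of y] that by (auto intro!: derivative_eq_intros)
    show "0 \<le> J2 y + K" if "y \<in> {0<..}" for y using J2[of y] that by simp
  qed simp
  then show ?thesis
    unfolding K_def .
qed

lemma cutoff_energy_tendsto:
  assumes y: "0 < y"
  shows "(\<lambda>n. cutoff_energy (real (Suc n)) y) \<longlonglongrightarrow> energy y"
proof -
  have [measurable]: "(\<lambda>x. S (x, y)) \<in> borel_measurable borel"
    by (rule borel_measurable_continuous_onI[OF slice_continuous[OF cont(1) y]])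
  have [measurable]: "cutoff R \<in> borel_measurable borel" for R
    by (rule borel_measurable_continuous_onI[OF cutoff_continuous(1)])
  have S: "0 \<le> S (x, y)" for x by (rule nonneg) (use y in \<open>simp add: half_space_def\<close>)
  have "(\<lambda>n. LINT x|lborel. S (x, y) * cutoff (real (Suc n)) x) \<longlonglongrightarrow> (LINT x|lborel. S (x, y) * 1)"
  proof (rule integral_dominated_convergence)
    show "integrable lborel (\<lambda>x. S (x, y))" by (rule slice_integrable[OF y])
    show "AE x in lborel. (\<lambda>n. S (x, y) * cutoff (real (Suc n)) x) \<longlonglongrightarrow> S (x, y) * 1"
      by (intro AE_I2 tendsto_intros cutoff_tendsto)
    show "AE x in lborel. norm (S (x, y) * cutoff (real (Suc n)) x) \<le> S (x, y)" for n
    proof (intro AE_I2)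
      fix x
      have "S (x, y) * cutoff (real (Suc n)) x \<le> S (x, y) * 1"
        by (intro mult_left_mono cutoff_bounds S)
      then show "norm (S (x, y) * cutoff (real (Suc n)) x) \<le> S (x, y)"
        using S[of x] cutoff_bounds(1)[of "real (Suc n)" x] by (simp add: abs_mult)
    qed
  qed measurable
  then show ?thesis by (simp add: cutoff_energy_def)
qed

text \<open>Convexity is a family of weak inequalities between values at three points, so it
  survives the pointwise limit R to infinity, in which the quadratic correction tends to 0.\<close>

lemma energy_convex: "convex_on {0<..} energy"
  unfolding convex_on_def
proof (intro conjI ballI allI impI)
  fix x y t u :: real assume xy: "x \<in> {0<..}" "y \<in> {0<..}" and t: "0 \<le> t" "0 \<le> u" "t + u = 1"
  define K where "K n = real DIM('a) * (30 / (real (Suc n))\<^sup>2 * M) / 2" for n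
  have K: "K \<longlonglongrightarrow> 0"
  proof -
    have "K = (\<lambda>n. 15 * real DIM('a) * M * (1 / real (Suc n))\<^sup>2)"
      by (simp add: K_def[abs_def] power_divide mult_ac del: of_nat_Suc)
    moreover have "(\<lambda>n. 15 * real DIM('a) * M * (1 / real (Suc n))\<^sup>2) \<longlonglongrightarrow> 15 * real DIM('a) * M * 0\<^sup>2"
      by (intro tendsto_intros LIMSEQ_Suc[OF lim_1_over_n])
    ultimately show ?thesis by simp
  qed
  have z: "0 < t *\<^sub>R x + u *\<^sub>R y"
    using convexD[OF convex_real_interval(3)[of 0] xy t] by simp
  let ?L = "\<lambda>n z. cutoff_energy (real (Suc n)) z + K n * z\<^sup>2"
  have lim: "(\<lambda>n. ?L n z) \<longlonglongrightarrow> energy z" if "0 < z" for z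
    using tendsto_add[OF cutoff_energy_tendsto[OF that] tendsto_mult[OF K tendsto_const[of "z\<^sup>2"]]] by simp
  show "energy (t *\<^sub>R x + u *\<^sub>R y) \<le> t * energy x + u * energy y"
  proof (rule LIMSEQ_le)
    show "(\<lambda>n. ?L n (t *\<^sub>R x + u *\<^sub>R y)) \<longlonglongrightarrow> energy (t *\<^sub>R x + u *\<^sub>R y)" by (rule lim[OF z])
    show "(\<lambda>n. t * ?L n x + u * ?L n y) \<longlonglongrightarrow> t * energy x + u * energy y"
      using xy by (intro tendsto_intros lim) auto
    show "\<exists>N. \<forall>n\<ge>N. ?L n (t *\<^sub>R x + u *\<^sub>R y) \<le> t * ?L n x + u * ?L n y"
    proof (intro exI[of _ 0] allI impI)
      fix n
      show "?L n (t *\<^sub>R x + u *\<^sub>R y) \<le> t * ?L n x + u * ?L n y"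
      proof -
        have "convex_on {0<..} (?L n)"
          unfolding K_def by (rule cutoff_energy_convex) simp
        with xy t show ?thesis unfolding convex_on_def by blast
      qed
    qed
  qed
qed simp

text \<open>A bounded convex function on the half-line is nonincreasing.\<close>

lemma energy_eq_0:
  assumes lim: "(energy \<longlongrightarrow> 0) (at_right 0)" and y: "0 < y"
  shows "energy y = 0"
proof -
  have dec: "energy y \<le> energy s" if s: "0 < s" "s < y" for s
  proof (rule LIMSEQ_le_const)
    have i: "(\<lambda>n. inverse (real (Suc n))) \<longlonglongrightarrow> 0" by (rule LIMSEQ_inverse_real_of_nat)
    show "(\<lambda>n. energy s + inverse (real (Suc n)) * M) \<longlonglongrightarrow> energy s"
      using tendsto_add[OF tendsto_const tendsto_mult[OF i tendsto_const]] by simp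
    have "energy y \<le> energy s + inverse (real (Suc n)) * M" for n
    proof -
      define t where "t = inverse (real (Suc n))"
      have t: "0 < t" "t \<le> 1" by (auto simp: t_def divide_simps)
      \<comment> \<open>T is the point for which y = (1 - t) s + t T. It moves off to infinity as t
        tends to 0, but the energy at T stays below M, so its contribution t M disappears.\<close>
      define T where "T = s + (y - s) / t"
      have T: "0 < T" using s t by (simp add: T_def add_pos_pos)
      have eq: "(1 - t) *\<^sub>R s + t *\<^sub>R T = y" using t by (simp add: T_def field_simps)
      have "energy y \<le> (1 - t) * energy s + t * energy T"
        using convex_onD[OF energy_convex, of t s T] s T t unfolding eq by simp
      also have "\<dots> \<le> 1 * energy s + t * M"
        using t energy_nonneg[OF s(1)] slice_bound[OF T] by (intro add_mono mult_right_mono mult_left_mono) auto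
      finally show ?thesis by (simp add: t_def)
    qed
    then show "\<exists>N. \<forall>n\<ge>N. energy y \<le> energy s + inverse (real (Suc n)) * M" by blast
  qed
  have "energy y \<le> 0"
  proof (rule tendsto_lowerbound[OF lim])
    show "\<forall>\<^sub>F s in at_right 0. energy y \<le> energy s"
      unfolding eventually_at_right_field using y by (intro exI[of _ y]) (auto intro: dec)
  qed simp
  with energy_nonneg[OF y] show ?thesis by simp
qed

end

text \<open>For harmonic w the Laplacian of |w|^2 is twice the squared gradient, hence nonnegative.
  The real inner product on the complex numbers gives |w|^2 as \<open>w z \<bullet> w z\<close> and
  its derivatives by the product rule.\<close>

lemma harmonic_slices_vanish:
  fixes w :: "'a::euclidean_space \<times> real \<Rightarrow> complex" and w1 w2 :: "'a \<times> real \<Rightarrow> 'a \<times> real \<Rightarrow> complex"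
  assumes cont: "continuous_on half_space w" "\<And>e. e \<in> Basis \<Longrightarrow> continuous_on half_space (w1 e)"
      "\<And>e. e \<in> Basis \<Longrightarrow> continuous_on half_space (w2 e)"
    and deriv: "\<And>e. e \<in> Basis \<Longrightarrow> line_derivative w (w1 e) e half_space"
      "\<And>e. e \<in> Basis \<Longrightarrow> line_derivative (w1 e) (w2 e) e half_space"
    and harmonic: "\<And>z. z \<in> half_space \<Longrightarrow> (\<Sum>e\<in>Basis. w2 e z) = 0"
    and L2: "\<And>y. 0 < y \<Longrightarrow> (\<lambda>x. w (x, y)) \<in> L2_space lborel"
    and bound: "\<And>y. 0 < y \<Longrightarrow> L2_norm lborel (\<lambda>x. w (x, y)) \<le> M"
    and lim: "((\<lambda>y. L2_norm lborel (\<lambda>x. w (x, y))) \<longlongrightarrow> 0) (at_right 0)"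
    and y: "0 < y"
  shows "L2_norm lborel (\<lambda>x. w (x, y)) = 0"
proof -
  interpret subharmonic_slices "\<lambda>z. w z \<bullet> w z" "\<lambda>e z. w z \<bullet> w1 e z + w1 e z \<bullet> w z"
    "\<lambda>e z. (w z \<bullet> w2 e z + w1 e z \<bullet> w1 e z) + (w1 e z \<bullet> w1 e z + w2 e z \<bullet> w z)" "M\<^sup>2"
  proof
    fix z :: "'a \<times> real" assume z: "z \<in> half_space"
    have "(\<Sum>e\<in>Basis. (w z \<bullet> w2 e z + w1 e z \<bullet> w1 e z) + (w1 e z \<bullet> w1 e z + w2 e z \<bullet> w z))
      = w z \<bullet> (\<Sum>e\<in>Basis. w2 e z) + (\<Sum>e\<in>Basis. w2 e z) \<bullet> w z + 2 * (\<Sum>e\<in>Basis. w1 e z \<bullet> w1 e z)"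
      by (simp add: inner_sum_left inner_sum_right sum.distrib sum_distrib_left)
    then show "0 \<le> (\<Sum>e\<in>Basis. (w z \<bullet> w2 e z + w1 e z \<bullet> w1 e z) + (w1 e z \<bullet> w1 e z + w2 e z \<bullet> w z))"
      using harmonic[OF z] by (simp add: sum_nonneg)
  next
    fix y :: real assume y: "0 < y"
    show "integrable lborel (\<lambda>x. w (x, y) \<bullet> w (x, y))"
      using L2_spaceD(2)[OF L2[OF y]] by (simp add: power2_norm_eq_inner)
    have "(L2_norm lborel (\<lambda>x. w (x, y)))\<^sup>2 \<le> M\<^sup>2" by (intro power_mono bound y) simp
    then show "(LINT x|lborel. w (x, y) \<bullet> w (x, y)) \<le> M\<^sup>2"
      by (simp add: L2_norm_sq power2_norm_eq_inner)
  next
    fix e :: "'a \<times> real" assume e: "e \<in> Basis"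
    show "line_derivative (\<lambda>z. w z \<bullet> w z) (\<lambda>z. w z \<bullet> w1 e z + w1 e z \<bullet> w z) e half_space"
      by (rule line_derivative_inner[OF deriv(1)[OF e] deriv(1)[OF e]])
    show "line_derivative (\<lambda>z. w z \<bullet> w1 e z + w1 e z \<bullet> w z)
       (\<lambda>z. (w z \<bullet> w2 e z + w1 e z \<bullet> w1 e z) + (w1 e z \<bullet> w1 e z + w2 e z \<bullet> w z)) e half_space"
      by (rule line_derivative_add[OF line_derivative_inner[OF deriv(1)[OF e] deriv(2)[OF e]]
            line_derivative_inner[OF deriv(2)[OF e] deriv(1)[OF e]]])
  qed (auto intro!: continuous_intros cont)
  have "((\<lambda>y. (L2_norm lborel (\<lambda>x. w (x, y)))\<^sup>2) \<longlongrightarrow> 0\<^sup>2) (at_right 0)"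
    by (intro tendsto_intros lim)
  then have "((\<lambda>y. LINT x|lborel. w (x, y) \<bullet> w (x, y)) \<longlongrightarrow> 0) (at_right 0)"
    by (simp add: L2_norm_sq power2_norm_eq_inner)
  from energy_eq_0[OF this y] show ?thesis
    by (simp add: L2_norm_def power2_norm_eq_inner)
qed

section \<open>Every solution is the Poisson extension of its datum\<close>

subsection \<open>The solution of the Dirichlet problem on the Fourier side\<close>

lemma fourier_pair_norm':
  fixes f :: "'a::euclidean_space \<Rightarrow> complex"
  assumes "fourier_pair f k"
  shows "L2_norm lborel f = L2_norm lborel k / sqrt ((2 * pi) ^ DIM('a))"
proof -
  have "(L2_norm lborel f)\<^sup>2 = (L2_norm lborel k)\<^sup>2 / (2 * pi) ^ DIM('a)"
    by (simp add: fourier_pair_norm[OF assms])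
  then have "sqrt ((L2_norm lborel f)\<^sup>2) = sqrt ((L2_norm lborel k)\<^sup>2 / (2 * pi) ^ DIM('a))" by simp
  then show ?thesis by (simp only: real_sqrt_divide real_sqrt_abs abs_of_nonneg[OF L2_norm_nonneg])
qed

lemma fourier_pair_add:
  assumes "fourier_pair f k" "fourier_pair g l"
  shows "fourier_pair (\<lambda>x. f x + g x) (\<lambda>x. k x + l x)"
  using fourier_pair_diff[OF assms(1) fourier_pair_cmult[OF assms(2), of "-1"]] by simp

lemma L2_norm_mono_AE:
  assumes "f \<in> L2_space M" "g \<in> L2_space M" "AE x in M. norm (f x) \<le> norm (g x)"
  shows "L2_norm M f \<le> L2_norm M g"
  unfolding L2_norm_def
proof (rule real_sqrt_le_mono, rule integral_mono_AE)
  show "AE x in M. (norm (f x))\<^sup>2 \<le> (norm (g x))\<^sup>2"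
    using assms(3) by (rule AE_mp) (auto intro!: AE_I2 power_mono)
qed (use assms in \<open>auto intro: L2_spaceD\<close>)

lemma L2_norm_eq_0_imp_AE:
  assumes f: "f \<in> L2_space M" and 0: "L2_norm M f = 0"
  shows "AE x in M. f x = 0"
proof -
  have "(LINT x|M. (norm (f x))\<^sup>2) = 0" using L2_norm_sq[of M f] 0 by simp
  then have "AE x in M. (norm (f x))\<^sup>2 = 0"
    by (subst (asm) integral_nonneg_eq_0_iff_AE[OF L2_spaceD(2)[OF f]]) auto
  then show ?thesis by simp
qed

lemma L2_tendsto_0_dominated_at_right:
  fixes F :: "real \<Rightarrow> 'b \<Rightarrow> complex"
  assumes m: "\<And>h. 0 < h \<Longrightarrow> F h \<in> borel_measurable M" and G: "G \<in> L2_space M"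
    and lim: "\<And>x. ((\<lambda>h. F h x) \<longlongrightarrow> 0) (at_right 0)"
    and bound: "\<And>h x. 0 < h \<Longrightarrow> norm (F h x) \<le> norm (G x)"
  shows "((\<lambda>h. L2_norm M (F h)) \<longlongrightarrow> 0) (at_right 0)"
  unfolding tendsto_at_iff_sequentially
proof (intro allI impI)
  fix X :: "nat \<Rightarrow> real" assume X: "\<forall>i. X i \<in> {0<..} - {0}" and X0: "X \<longlonglongrightarrow> 0"
  have "(\<lambda>i. L2_norm M (F (X i))) \<longlonglongrightarrow> 0"
  proof (rule L2_tendsto_0_dominated[OF _ G])
    show "F (X i) \<in> borel_measurable M" for i using X m by auto
    show "AE x in M. norm (F (X i) x) \<le> norm (G x)" for i using X bound by auto
    show "AE x in M. (\<lambda>i. F (X i) x) \<longlonglongrightarrow> 0"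
      using lim X X0 unfolding tendsto_at_iff_sequentially comp_def by (intro AE_I2) blast
  qed
  then show "((\<lambda>h. L2_norm M (F h)) \<circ> X) \<longlonglongrightarrow> 0" by (simp add: comp_def)
qed

lemma integrable_exp_abs:
  fixes l :: real
  assumes l: "0 < l" shows "integrable lborel (\<lambda>t. exp (- (l * \<bar>t\<bar>)))"
proof -
  interpret prob_space "density lborel (exponential_density l)"
    by (rule prob_space_exponential_density[OF l])
  have "(\<integral>\<^sup>+t. ennreal (exponential_density l t) \<partial>lborel) = 1"
    using emeasure_space_1 by (simp add: emeasure_density)
  then have i: "integrable lborel (exponential_density l)"
    using exponential_density_nonneg[OF l] by (intro integrableI_nonneg) auto
  then have "integrable lborel (\<lambda>t. exponential_density l (- t))"
    using lborel_integrable_reflect[of "exponential_density l"] by simp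
  with i have "integrable lborel (\<lambda>t. (exponential_density l t + exponential_density l (- t)) / l)" by simp
  then show ?thesis
    by (rule Bochner_Integration.integrable_bound)
      (use l in \<open>auto intro!: AE_I2 simp: exponential_density_def abs_if field_simps\<close>)
qed

text \<open>As |\<xi>.b| \<le> |\<xi>| for each coordinate, the rate l can be shared equally among
  the coordinates, which bounds the weight by a product of one-dimensional exponentials.\<close>

lemma integrable_exp_norm:
  assumes l: "0 < l" shows "integrable lborel (\<lambda>\<xi>::'a::euclidean_space. exp (- (l * norm \<xi>)))"
proof -
  let ?d = "real DIM('a)"
  have d: "0 < ?d" by simp
  have "integrable lborel (\<lambda>t. complex_of_real (exp (- (l / ?d * \<bar>t\<bar>))))"
    using integrable_exp_abs[of "l / ?d"] l d by (intro integrable_of_real) simp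
  then have "integrable lborel (\<lambda>\<xi>::'a. \<Prod>b\<in>Basis. complex_of_real (exp (- (l / ?d * \<bar>\<xi> \<bullet> b\<bar>))))"
    by (rule lborel_integral_prod_Basis(1))
  then show ?thesis
  proof (rule Bochner_Integration.integrable_bound)
    show "AE \<xi> in lborel. norm (exp (- (l * norm \<xi>))) \<le> norm (\<Prod>b\<in>Basis. complex_of_real (exp (- (l / ?d * \<bar>(\<xi>::'a) \<bullet> b\<bar>))))"
    proof (intro AE_I2)
      fix \<xi> :: 'a
      have "(\<Sum>b\<in>Basis. l / ?d * \<bar>\<xi> \<bullet> b\<bar>) \<le> (\<Sum>b\<in>(Basis::'a set). l / ?d * norm \<xi>)"
        using l by (intro sum_mono mult_left_mono Basis_le_norm) auto
      also have "\<dots> = l * norm \<xi>" by simp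
      finally have "exp (- (l * norm \<xi>)) \<le> exp (\<Sum>b\<in>Basis. - (l / ?d * \<bar>\<xi> \<bullet> b\<bar>))"
        by (simp add: sum_negf)
      also have "\<dots> = (\<Prod>b\<in>Basis. exp (- (l / ?d * \<bar>\<xi> \<bullet> b\<bar>)))" by (rule exp_sum) simp
      finally show "norm (exp (- (l * norm \<xi>))) \<le> norm (\<Prod>b\<in>Basis. complex_of_real (exp (- (l / ?d * \<bar>\<xi> \<bullet> b\<bar>))))"
        by (simp add: prod_norm[symmetric] del: of_real_prod)
    qed
  qed measurable
qed

lemma exp_norm_L2:
  assumes l: "0 < l" shows "(\<lambda>\<xi>::'a::euclidean_space. complex_of_real (exp (- (l * norm \<xi>)))) \<in> L2_space lborel"
proof -
  have "integrable lborel (\<lambda>\<xi>::'a. exp (- (2 * l * norm \<xi>)))" using l by (intro integrable_exp_norm) simp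
  then show ?thesis
    by (simp add: L2_space_def power2_eq_square exp_add[symmetric] mult.assoc)
qed

lemma L2_imp_damped_integrable:
  fixes k :: "'a::euclidean_space \<Rightarrow> complex"
  assumes k: "k \<in> L2_space lborel"
  shows "damped_integrable k"
  unfolding damped_integrable_def
proof (intro conjI allI impI)
  show "k \<in> borel_measurable borel" using L2_spaceD(1)[OF k] by simp
  fix y :: real assume "0 < y"
  from integrable_norm[OF L2_mult_integrable[OF exp_norm_L2[OF this] k]]
  show "integrable lborel (\<lambda>\<xi>. exp (- (y * norm \<xi>)) * norm (k \<xi>))"
    by (simp only: norm_mult norm_of_real abs_exp_cancel)
qed

text \<open>The multiplier of the Poisson semigroup at time y.\<close>

definition damp :: "real \<Rightarrow> ('a::euclidean_space \<Rightarrow> complex) \<Rightarrow> 'a \<Rightarrow> complex" where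
  "damp y k \<xi> = complex_of_real (exp (- (y * norm \<xi>))) * k \<xi>"

lemma norm_damp: "norm (damp y k \<xi>) = exp (- (y * norm \<xi>)) * norm (k \<xi>)"
  by (simp only: damp_def norm_mult norm_of_real abs_exp_cancel)

lemma norm_damp_le: "0 \<le> y \<Longrightarrow> norm (damp y k \<xi>) \<le> norm (k \<xi>)"
  unfolding norm_damp by (rule mult_left_le_one_le) auto

lemma damp_L2:
  fixes k :: "'a::euclidean_space \<Rightarrow> complex"
  assumes k: "k \<in> L2_space lborel" and y: "0 \<le> y"
  shows "damp y k \<in> L2_space lborel" "L2_norm lborel (damp y k) \<le> L2_norm lborel k"
proof -
  have [measurable]: "k \<in> borel_measurable borel" using L2_spaceD(1)[OF k] by simp
  show *: "damp y k \<in> L2_space lborel"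
  proof (rule L2_space_bound[OF k, of _ 1])
    show "damp y k \<in> borel_measurable lborel" unfolding damp_def[abs_def] by measurable
  qed (simp add: norm_damp_le[OF y])
  show "L2_norm lborel (damp y k) \<le> L2_norm lborel k"
    by (rule L2_norm_mono_AE[OF * k]) (simp add: norm_damp_le[OF y])
qed

text \<open>Damping makes an L^2 symbol integrable, so at fixed height the Poisson integral is an
  ordinary inverse Fourier integral. The factor (2 pi)^(-n) absent from
  \<open>poisson_integral\<close> is restored here.\<close>

lemma poisson_slice_pair:
  fixes k :: "'a::euclidean_space \<Rightarrow> complex"
  assumes k: "k \<in> L2_space lborel" and y: "0 < y"
  shows "fourier_pair (\<lambda>x. complex_of_real (1 / (2 * pi) ^ DIM('a)) * poisson_integral k (x, y)) (damp y k)"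
proof -
  have i: "integrable lborel (damp y k)"
    unfolding damp_def by (rule L2_mult_integrable[OF exp_norm_L2[OF y] k])
  have "poisson_integral k (x, y) = fourier_integral (damp y k) (- x)" for x
    unfolding poisson_integral_def fourier_integral_def
  proof (intro Bochner_Integration.integral_cong refl)
    fix \<xi>
    have "poisson_phase \<xi> (x, y) = - (\<i> * complex_of_real (\<xi> \<bullet> - x)) + complex_of_real (- (y * norm \<xi>))"
      by (simp add: poisson_phase_def inner_commute)
    then show "exp (poisson_phase \<xi> (x, y)) * k \<xi> = exp (- (\<i> * complex_of_real (\<xi> \<bullet> - x))) * damp y k \<xi>"
      by (simp only: damp_def exp_add exp_of_real mult.assoc)
  qed
  then show ?thesis
    using fourier_pair_inversion[OF damp_L2(1)[OF k less_imp_le[OF y]] i] by simp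
qed

lemma damp_tendsto:
  fixes k :: "'a::euclidean_space \<Rightarrow> complex"
  assumes k: "k \<in> L2_space lborel"
  shows "((\<lambda>y. L2_norm lborel (\<lambda>\<xi>. damp y k \<xi> - k \<xi>)) \<longlongrightarrow> 0) (at_right 0)"
proof (rule L2_tendsto_0_dominated_at_right[OF _ L2_space_cmult[OF k, of 2]])
  have [measurable]: "k \<in> borel_measurable borel" using L2_spaceD(1)[OF k] by simp
  show "(\<lambda>\<xi>. damp h k \<xi> - k \<xi>) \<in> borel_measurable lborel" for h
    unfolding damp_def by measurable
  fix \<xi> :: 'a
  have "((\<lambda>y. complex_of_real (exp (- (y * norm \<xi>))) * k \<xi> - k \<xi>) \<longlongrightarrow> complex_of_real (exp (- (0 * norm \<xi>))) * k \<xi> - k \<xi>) (at_right 0)"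
    by (intro tendsto_intros)
  then show "((\<lambda>y. damp y k \<xi> - k \<xi>) \<longlongrightarrow> 0) (at_right 0)" by (simp add: damp_def)
  fix h :: real assume h: "0 < h"
  show "norm (damp h k \<xi> - k \<xi>) \<le> norm (2 * k \<xi>)"
    using norm_triangle_ineq4[of "damp h k \<xi>" "k \<xi>"] norm_damp_le[of h k \<xi>] h by (simp add: norm_mult)
qed

lemma open_half_space: "open (half_space :: ('a::euclidean_space \<times> real) set)"
proof -
  have "(half_space :: ('a \<times> real) set) = {z. 0 < snd z}" by (auto simp: half_space_def)
  moreover have "open {z :: 'a \<times> real. 0 < snd z}" by (intro open_Collect_less continuous_intros)
  ultimately show ?thesis by simp
qed

lemma frechet_line_derivative:
  assumes "f differentiable_on S" "open S"
  shows "line_derivative f (\<lambda>z. frechet_derivative f (at z) e) e S"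
  unfolding line_derivative_def
proof
  fix z assume "z \<in> S"
  then have "f differentiable (at z)"
    using assms by (metis differentiable_on_eq_differentiable_at)
  then have f: "(f has_derivative frechet_derivative f (at z)) (at (z + 0 *\<^sub>R e))"
    by (simp add: frechet_derivative_works)
  have l: "((\<lambda>t. z + t *\<^sub>R e) has_derivative (\<lambda>t. t *\<^sub>R e)) (at 0)"
    by (auto intro!: derivative_eq_intros)
  have "((\<lambda>t. f (z + t *\<^sub>R e)) has_derivative (\<lambda>t. frechet_derivative f (at z) (t *\<^sub>R e))) (at 0)"
    by (rule has_derivative_compose[OF l f])
  then show "((\<lambda>t. f (z + t *\<^sub>R e)) has_vector_derivative frechet_derivative f (at z) e) (at 0)"
    using has_derivative_bounded_linear[OF f]
    by (simp add: has_vector_derivative_def linear_simps(5))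
qed

lemma line_derivative_cmult:
  fixes f :: "'v::real_normed_vector \<Rightarrow> complex"
  assumes "line_derivative f f' e S"
  shows "line_derivative (\<lambda>z. c * f z) (\<lambda>z. c * f' z) e S"
  using assms unfolding line_derivative_def
  by (auto intro: bounded_linear.has_vector_derivative[OF bounded_linear_mult_right])

lemma dirichlet_solution_continuous:
  assumes "dirichlet_solution f u" shows "continuous_on half_space u"
proof -
  have "C_k_on 2 u half_space" using assms by (simp add: dirichlet_solution_def harmonic_on_def)
  then have "\<forall>bs. set bs \<subseteq> Basis \<and> length bs \<le> 2 \<longrightarrow> continuous_on half_space (pderivs bs u)"
    unfolding C_k_on_def by blast
  from this[rule_format, of "[]"] show ?thesis by simp
qed

text \<open>u is compared with the Poisson extension P of k. The height 0 is included, as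
  \<open>damp 0 k\<close> is k and u takes the values f there; increments from the boundary can then
  be treated like any other slice.\<close>

theorem dirichlet_solution_fourier:
  fixes f :: "'a::euclidean_space \<Rightarrow> complex"
  assumes u: "dirichlet_solution f u" and fk: "fourier_pair f k" and y: "0 \<le> y"
  shows "fourier_pair (\<lambda>x. u (x, y)) (damp y k)"
proof (cases "y = 0")
  case True
  moreover have "(\<lambda>x. u (x, 0)) = f" using u by (simp add: dirichlet_solution_def)
  ultimately show ?thesis using fk by (simp add: damp_def[abs_def])
next
  case False
  with y have y: "0 < y" by simp
  have harm: "C_k_on 2 u half_space" "\<And>z. z \<in> half_space \<Longrightarrow> laplacian u z = 0"
    and slice: "\<And>y. 0 < y \<Longrightarrow> (\<lambda>x. u (x, y)) \<in> L2_space lborel"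
    and bdd: "bdd_above ((\<lambda>y. L2_norm lborel (\<lambda>x. u (x, y))) ` {0<..})"
    and lim: "((\<lambda>y. L2_norm lborel (\<lambda>x. u (x, y) - f x)) \<longlongrightarrow> 0) (at_right 0)"
    using u by (auto simp: dirichlet_solution_def harmonic_on_def L2_tendsto_def)
  have f: "f \<in> L2_space lborel" and k: "k \<in> L2_space lborel" using fourier_pairD[OF fk] by auto
  note dk = L2_imp_damped_integrable[OF k]
  have diff: "pderivs bs u differentiable_on half_space" if "set bs \<subseteq> Basis" "length bs < 2" for bs
    using harm(1) that by (auto simp: C_k_on_def)
  have cont: "continuous_on half_space (pderivs bs u)" if "set bs \<subseteq> Basis" "length bs \<le> 2" for bs
    using harm(1) that by (auto simp: C_k_on_def)
  define c where "c = complex_of_real (1 / (2 * pi) ^ DIM('a))"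
  define P where "P z = c * poisson_integral k z" for z
  define P1 where "P1 e z = c * poisson_integral (\<lambda>\<xi>. poisson_phase \<xi> e * k \<xi>) z" for e z
  define P2 where "P2 e z = c * poisson_integral (\<lambda>\<xi>. poisson_phase \<xi> e * (poisson_phase \<xi> e * k \<xi>)) z" for e z
  have Pp: "fourier_pair (\<lambda>x. P (x, y)) (damp y k)" if "0 < y" for y
    unfolding P_def c_def by (rule poisson_slice_pair[OF k that])
  obtain M where M: "\<And>y. 0 < y \<Longrightarrow> L2_norm lborel (\<lambda>x. u (x, y)) \<le> M"
    using bdd by (auto simp: bdd_above_def)
  have Pd: "fourier_pair (\<lambda>x. P (x, y) - f x) (\<lambda>\<xi>. damp y k \<xi> - k \<xi>)" if "0 < y" for y
    by (rule fourier_pair_diff[OF Pp[OF that] fk])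
  \<comment> \<open>The uniform bound adds the one assumed for u to the norm of f, since damping
    contracts. Both u and P tend to f in L^2, hence the difference to 0.\<close>
  have "L2_norm lborel (\<lambda>x. u (x, y) - P (x, y)) = 0"
  proof (rule harmonic_slices_vanish[where w="\<lambda>z. u z - P z" and ?w1.0="\<lambda>e z. pderivs [e] u z - P1 e z"
        and ?w2.0="\<lambda>e z. pderivs [e, e] u z - P2 e z" and M="M + L2_norm lborel f"])
    show "continuous_on half_space (\<lambda>z. u z - P z)"
      unfolding P_def using cont[of "[]"] by (intro continuous_intros poisson_integral_continuous dk) auto
    fix e :: "'a \<times> real" assume e: "e \<in> Basis"
    show "continuous_on half_space (\<lambda>z. pderivs [e] u z - P1 e z)"
      unfolding P1_def using cont[of "[e]"] e
      by (intro continuous_intros poisson_integral_continuous damped_integrable_phase dk) auto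
    show "continuous_on half_space (\<lambda>z. pderivs [e, e] u z - P2 e z)"
      unfolding P2_def using cont[of "[e, e]"] e
      by (intro continuous_intros poisson_integral_continuous damped_integrable_phase dk) auto
    have "line_derivative u (pderivs [e] u) e half_space"
      using frechet_line_derivative[OF diff[of "[]"] open_half_space, of e] by simp
    then show "line_derivative (\<lambda>z. u z - P z) (\<lambda>z. pderivs [e] u z - P1 e z) e half_space"
      unfolding P_def P1_def
      by (intro line_derivative_diff line_derivative_cmult)
        (auto simp: line_derivative_def intro!: poisson_integral_line_derivative dk)
    have "line_derivative (pderivs [e] u) (pderivs [e, e] u) e half_space"
      using frechet_line_derivative[OF diff[of "[e]"] open_half_space, of e] e by simp
    then show "line_derivative (\<lambda>z. pderivs [e] u z - P1 e z) (\<lambda>z. pderivs [e, e] u z - P2 e z) e half_space"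
      unfolding P1_def P2_def
      by (intro line_derivative_diff line_derivative_cmult)
        (auto simp: line_derivative_def intro!: poisson_integral_line_derivative damped_integrable_phase dk)
  next
    fix z :: "'a \<times> real" assume z: "z \<in> half_space"
    have "(\<Sum>e\<in>Basis. P2 e z) = 0"
      using poisson_integral_harmonic[OF dk z] by (simp add: P2_def sum_distrib_left[symmetric])
    then show "(\<Sum>e\<in>Basis. pderivs [e, e] u z - P2 e z) = 0"
      using harm(2)[OF z] by (simp add: laplacian_def sum_subtractf)
  next
    fix y :: real assume y: "0 < y"
    show "(\<lambda>x. u (x, y) - P (x, y)) \<in> L2_space lborel"
      by (intro L2_space_diff slice fourier_pairD(1)[OF Pp] y)
    have "L2_norm lborel (\<lambda>x. P (x, y)) \<le> L2_norm lborel f"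
      unfolding fourier_pair_norm'[OF Pp[OF y]] fourier_pair_norm'[OF fk]
      using damp_L2(2)[OF k] y by (intro divide_right_mono) auto
    moreover have "L2_norm lborel (\<lambda>x. u (x, y) - P (x, y)) \<le> L2_norm lborel (\<lambda>x. u (x, y)) + L2_norm lborel (\<lambda>x. P (x, y))"
      using L2_norm_triangle[OF slice[OF y] L2_space_cmult[OF fourier_pairD(1)[OF Pp[OF y]], of "-1"]]
        L2_norm_cmult[of lborel "-1" "\<lambda>x. P (x, y)"] by simp
    ultimately show "L2_norm lborel (\<lambda>x. u (x, y) - P (x, y)) \<le> M + L2_norm lborel f"
      using M[OF y] by linarith
  next
    have "((\<lambda>y. L2_norm lborel (\<lambda>\<xi>. damp y k \<xi> - k \<xi>) / sqrt ((2 * pi) ^ DIM('a))) \<longlongrightarrow> 0 / sqrt ((2 * pi) ^ DIM('a))) (at_right 0)"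
      by (intro tendsto_divide damp_tendsto k tendsto_const) simp
    with lim have "((\<lambda>y. L2_norm lborel (\<lambda>x. u (x, y) - f x) + L2_norm lborel (\<lambda>\<xi>. damp y k \<xi> - k \<xi>) / sqrt ((2 * pi) ^ DIM('a)))
        \<longlongrightarrow> 0 + 0 / sqrt ((2 * pi) ^ DIM('a))) (at_right 0)"
      by (rule tendsto_add)
    then have "((\<lambda>y. L2_norm lborel (\<lambda>x. u (x, y) - f x) + L2_norm lborel (\<lambda>\<xi>. damp y k \<xi> - k \<xi>) / sqrt ((2 * pi) ^ DIM('a)))
        \<longlongrightarrow> 0) (at_right 0)" by simp
    then show "((\<lambda>y. L2_norm lborel (\<lambda>x. u (x, y) - P (x, y))) \<longlongrightarrow> 0) (at_right 0)"
    proof (rule Lim_null_comparison[rotated], intro eventually_at_rightI[of 0 1])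
      fix y :: real assume "y \<in> {0<..<1}"
      then have y: "0 < y" by simp
      have "L2_norm lborel (\<lambda>x. u (x, y) - P (x, y)) \<le> L2_norm lborel (\<lambda>x. u (x, y) - f x) + L2_norm lborel (\<lambda>x. f x - P (x, y))"
        by (intro L2_norm_triangle_diff slice y f fourier_pairD(1)[OF Pp])
      also have "L2_norm lborel (\<lambda>x. f x - P (x, y)) = L2_norm lborel (\<lambda>\<xi>. damp y k \<xi> - k \<xi>) / sqrt ((2 * pi) ^ DIM('a))"
        by (subst L2_norm_minus_commute) (rule fourier_pair_norm'[OF Pd[OF y]])
      finally show "norm (L2_norm lborel (\<lambda>x. u (x, y) - P (x, y))) \<le>
          L2_norm lborel (\<lambda>x. u (x, y) - f x) + L2_norm lborel (\<lambda>\<xi>. damp y k \<xi> - k \<xi>) / sqrt ((2 * pi) ^ DIM('a))"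
        by simp
    qed simp
  qed (rule y)
  then have "AE x in lborel. u (x, y) - P (x, y) = 0"
    by (intro L2_norm_eq_0_imp_AE L2_space_diff slice y fourier_pairD(1)[OF Pp])
  then show ?thesis
    by (intro fourier_pair_cong_AE[OF Pp[OF y]] L2_spaceD(1)[OF slice[OF y]] L2_spaceD(1)[OF damp_L2(1)[OF k]])
      (use y in auto)
qed

section \<open>Symbols of the two parts of the boundary operator\<close>

subsection \<open>The normal derivative\<close>

text \<open>The quotient lies between -s and 0. With s = |\<xi>| this makes |\<xi>| k a dominating
  function for all h at once.\<close>

lemma exp_difference_quotient_bound:
  fixes s h :: real assumes "0 \<le> s" "0 < h"
  shows "\<bar>(exp (- (h * s)) - 1) / h + s\<bar> \<le> s"
proof -
  have "1 - h * s \<le> exp (- (h * s))" using exp_ge_add_one_self[of "- (h * s)"] by simp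
  then have "0 \<le> (exp (- (h * s)) - 1) / h + s" using assms by (simp add: field_simps)
  moreover have "(exp (- (h * s)) - 1) / h \<le> 0" using assms by (simp add: divide_nonpos_pos)
  ultimately show ?thesis by simp
qed

lemma exp_difference_quotient_tendsto:
  "((\<lambda>h. (exp (- (h * s)) - 1) / h + s) \<longlongrightarrow> (0::real)) (at_right 0)"
proof -
  have "((\<lambda>h. exp (- (h * s))) has_real_derivative - s) (at 0)"
    by (auto intro!: derivative_eq_intros)
  then have "((\<lambda>h. (exp (- (h * s)) - 1) / h) \<longlongrightarrow> - s) (at 0)" by (simp add: DERIV_def)
  then have "((\<lambda>h. (exp (- (h * s)) - 1) / h + s) \<longlongrightarrow> - s + s) (at_right 0)"
    by (intro tendsto_add tendsto_const) (rule tendsto_within_subset, auto)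
  then show ?thesis by simp
qed

text \<open>\<open>normal_derivative\<close> is a choice, so nothing is known of it before a limit
  exists. A limit g is built from its symbol, its convergence is checked by Plancherel, and
  uniqueness of L^2 limits transfers the symbol to the chosen function.\<close>

lemma normal_derivative_fourier:
  fixes f :: "'a::euclidean_space \<Rightarrow> complex"
  assumes u: "dirichlet_solution f u" and fk: "fourier_pair f k"
    and nk: "(\<lambda>\<xi>. complex_of_real (norm \<xi>) * k \<xi>) \<in> L2_space lborel"
  shows "has_normal_derivative u (normal_derivative u)"
    "fourier_pair (normal_derivative u) (\<lambda>\<xi>. - complex_of_real (norm \<xi>) * k \<xi>)"
proof -
  have k: "k \<in> L2_space lborel" by (rule fourier_pairD(2)[OF fk])
  have [measurable]: "k \<in> borel_measurable borel" using L2_spaceD(1)[OF k] by simp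
  have "(\<lambda>\<xi>. - complex_of_real (norm \<xi>) * k \<xi>) \<in> L2_space lborel"
    using L2_space_cmult[OF nk, of "-1"] by simp
  then obtain g where g: "fourier_pair g (\<lambda>\<xi>. - complex_of_real (norm \<xi>) * k \<xi>)"
    by (rule fourier_pair_inverse_exists)
  let ?F = "\<lambda>h x. (u (x, h) - u (x, 0)) / complex_of_real h"
  have F: "fourier_pair (?F h) (\<lambda>\<xi>. complex_of_real ((exp (- (h * norm \<xi>)) - 1) / h) * k \<xi>)" if h: "0 < h" for h
  proof -
    have "fourier_pair (\<lambda>x. u (x, h) - u (x, 0)) (\<lambda>\<xi>. damp h k \<xi> - damp 0 k \<xi>)"
      using h by (intro fourier_pair_diff dirichlet_solution_fourier[OF u fk]) auto
    from fourier_pair_cmult[OF this, of "complex_of_real (1 / h)"] show ?thesis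
      by (simp add: damp_def left_diff_distrib diff_divide_distrib exp_of_real)
  qed
  have "has_normal_derivative u g"
    unfolding has_normal_derivative_def L2_tendsto_def
  proof (intro conjI)
    show "g \<in> L2_space lborel" by (rule fourier_pairD(1)[OF g])
    show "\<forall>\<^sub>F h in at_right 0. ?F h \<in> L2_space lborel"
      by (rule eventually_at_rightI[of 0 1]) (auto intro: fourier_pairD(1)[OF F])
    define D where "D h \<xi> = complex_of_real ((exp (- (h * norm \<xi>)) - 1) / h) * k \<xi> - - complex_of_real (norm \<xi>) * k \<xi>" for h and \<xi> :: 'a
    have D: "D h \<xi> = complex_of_real ((exp (- (h * norm \<xi>)) - 1) / h + norm \<xi>) * k \<xi>" for h \<xi>
      by (simp add: D_def algebra_simps)
    have "((\<lambda>h. L2_norm lborel (D h)) \<longlongrightarrow> 0) (at_right 0)"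
    proof (rule L2_tendsto_0_dominated_at_right[OF _ nk])
      show "D h \<in> borel_measurable lborel" for h unfolding D[abs_def] by measurable
      show "((\<lambda>h. D h \<xi>) \<longlongrightarrow> 0) (at_right 0)" for \<xi>
        unfolding D using tendsto_mult[OF tendsto_of_real[OF exp_difference_quotient_tendsto[of "norm \<xi>"]] tendsto_const[of "k \<xi>"]]
        by simp
      show "norm (D h \<xi>) \<le> norm (complex_of_real (norm \<xi>) * k \<xi>)" if "0 < h" for h \<xi>
        unfolding D norm_mult norm_of_real
        using exp_difference_quotient_bound[of "norm \<xi>" h] that by (intro mult_right_mono) auto
    qed
    then have "((\<lambda>h. L2_norm lborel (D h) / sqrt ((2 * pi) ^ DIM('a))) \<longlongrightarrow> 0 / sqrt ((2 * pi) ^ DIM('a))) (at_right 0)"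
      by (intro tendsto_divide tendsto_const) auto
    then have "((\<lambda>h. L2_norm lborel (D h) / sqrt ((2 * pi) ^ DIM('a))) \<longlongrightarrow> 0) (at_right 0)" by simp
    then show "((\<lambda>h. L2_norm lborel (\<lambda>x. ?F h x - g x)) \<longlongrightarrow> 0) (at_right 0)"
    proof (rule Lim_transform_eventually, intro eventually_at_rightI[of 0 1])
      fix h :: real assume "h \<in> {0<..<1}"
      then have "0 < h" by simp
      from fourier_pair_norm'[OF fourier_pair_diff[OF F[OF this] g]]
      show "L2_norm lborel (D h) / sqrt ((2 * pi) ^ DIM('a)) = L2_norm lborel (\<lambda>x. ?F h x - g x)"
        by (simp add: D_def[abs_def])
    qed simp
  qed
  then show nd: "has_normal_derivative u (normal_derivative u)"
    unfolding normal_derivative_def by (rule someI[of "has_normal_derivative u"])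
  let ?g' = "normal_derivative u"
  have g': "?g' \<in> L2_space lborel" and gL: "g \<in> L2_space lborel"
    using nd fourier_pairD(1)[OF g] by (auto simp: has_normal_derivative_def L2_tendsto_def)
  have "((\<lambda>h. L2_norm lborel (\<lambda>x. ?F h x - ?g' x) + L2_norm lborel (\<lambda>x. ?F h x - g x)) \<longlongrightarrow> 0 + 0) (at_right 0)"
    using nd \<open>has_normal_derivative u g\<close> unfolding has_normal_derivative_def L2_tendsto_def
    by (intro tendsto_add) auto
  \<comment> \<open>Both functions are limits of the same difference quotients, so they coincide up
    to a null set.\<close>
  then have "L2_norm lborel (\<lambda>x. ?g' x - g x) \<le> 0 + 0"
  proof (rule tendsto_lowerbound, intro eventually_at_rightI[of 0 1])
    fix h :: real assume "h \<in> {0<..<1}"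
    then have Fh: "?F h \<in> L2_space lborel" by (intro fourier_pairD(1)[OF F]) simp
    show "L2_norm lborel (\<lambda>x. ?g' x - g x) \<le> L2_norm lborel (\<lambda>x. ?F h x - ?g' x) + L2_norm lborel (\<lambda>x. ?F h x - g x)"
      using L2_norm_triangle_diff[OF g' Fh gL] by (subst (2) L2_norm_minus_commute) simp
  qed simp_all
  then have "L2_norm lborel (\<lambda>x. ?g' x - g x) = 0" using L2_norm_nonneg[of lborel "\<lambda>x. ?g' x - g x"] by linarith
  from L2_norm_eq_0_imp_AE[OF L2_space_diff[OF g' gL] this]
  show "fourier_pair ?g' (\<lambda>\<xi>. - complex_of_real (norm \<xi>) * k \<xi>)"
    by (intro fourier_pair_cong_AE[OF g] L2_spaceD(1)[OF g']) (auto simp: fourier_pairD(2)[OF g, THEN L2_spaceD(1)])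
qed

subsection \<open>The jump part of the boundary operator\<close>

locale finite_levy_measure = finite_measure \<mu> for \<mu> :: "real measure" +
  assumes sets_mu: "sets \<mu> = sets (restrict_space borel {0..})"
begin

lemma space_mu: "space \<mu> = {0..}"
  using sets_eq_imp_space_eq[OF sets_mu] by (simp add: space_restrict_space)

lemma borel_imp_measurable_mu [measurable (raw)]:
  "f \<in> M \<rightarrow>\<^sub>M \<mu> \<Longrightarrow> g \<in> borel_measurable borel \<Longrightarrow> (\<lambda>x. g (f x)) \<in> borel_measurable M"
proof (rule measurable_compose[of f M \<mu>])
  assume "g \<in> borel_measurable borel"
  then have "g \<in> borel_measurable (restrict_space borel {0..})" by (rule measurable_restrict_space1)
  then show "g \<in> borel_measurable \<mu>" using measurable_cong_sets[OF sets_mu refl] by blast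
qed

lemma ident_measurable_mu [measurable]: "(\<lambda>z. z) \<in> \<mu> \<rightarrow>\<^sub>M borel"
  using borel_imp_measurable_mu[of "\<lambda>z. z" \<mu> "\<lambda>z. z"] by simp

lemma levy_integrand_integrable:
  assumes "0 \<le> l" shows "integrable \<mu> (\<lambda>z. 1 - exp (- (l * z)))"
  by (rule integrable_const_bound[of _ 1]) (use assms in \<open>auto simp: space_mu\<close>)

definition levy_integral :: "real \<Rightarrow> real" where
  "levy_integral l = (LINT z|\<mu>. 1 - exp (- (l * z)))"

lemma levy_symbol_eq: "levy_symbol \<mu> l = l + levy_integral l"
  by (simp add: levy_symbol_def levy_integral_def)

text \<open>The lower bound gives |\<xi>| \<le> Phi(|\<xi>|); the upper one, the total mass, makes
  the jump symbol a bounded multiplier on L^2.\<close>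

lemma levy_integral_bounds:
  assumes l: "0 \<le> l" shows "0 \<le> levy_integral l" "levy_integral l \<le> measure \<mu> (space \<mu>)"
proof -
  show "0 \<le> levy_integral l" unfolding levy_integral_def
    by (intro integral_nonneg_AE AE_I2) (use l in \<open>simp add: space_mu\<close>)
  have "levy_integral l \<le> (LINT z|\<mu>. 1)"
    unfolding levy_integral_def by (intro integral_mono levy_integrand_integrable l) auto
  then show "levy_integral l \<le> measure \<mu> (space \<mu>)" by simp
qed

lemma levy_integral_measurable [measurable]: "levy_integral \<in> borel_measurable borel"
  unfolding levy_integral_def[abs_def] by measurable

text \<open>The increments are replaced by 0 at the origin so that they form a jointly measurable function.\<close>

definition increment :: "('a::euclidean_space \<times> real \<Rightarrow> complex) \<Rightarrow> 'a \<Rightarrow> real \<Rightarrow> complex" where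
  "increment u x z = (if 0 < z then u (x, z) - u (x, 0) else 0)"

lemma increment_eq: "z \<in> space \<mu> \<Longrightarrow> u (x, z) - u (x, 0) = increment u x z"
  by (auto simp: increment_def space_mu)

text \<open>u is continuous only on the open half-space, and its boundary values are merely
  measurable. Split at z = 0, the two pieces are each jointly measurable.\<close>

lemma increment_measurable:
  fixes u :: "'a::euclidean_space \<times> real \<Rightarrow> complex"
  assumes c: "continuous_on half_space u" and f: "(\<lambda>x. u (x, 0)) \<in> borel_measurable borel"
  shows "(\<lambda>p. increment u (fst p) (snd p)) \<in> borel_measurable (borel \<Otimes>\<^sub>M borel)"
proof -
  have "(\<lambda>p. indicator half_space p *\<^sub>R u p) \<in> borel_measurable borel"
    by (rule borel_measurable_continuous_on_indicator[OF borel_open[OF open_half_space] c])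
  then have [measurable]: "(\<lambda>p. indicator half_space p *\<^sub>R u p) \<in> borel_measurable (borel \<Otimes>\<^sub>M borel)"
    by (simp add: borel_prod)
  note [measurable] = f
  have "(\<lambda>p. increment u (fst p) (snd p)) =
     (\<lambda>p. indicator half_space p *\<^sub>R u p - (if 0 < snd p then u (fst p, 0) else 0))"
    by (auto simp: increment_def half_space_def fun_eq_iff)
  also have "\<dots> \<in> borel_measurable (borel \<Otimes>\<^sub>M borel)" by measurable
  finally show ?thesis .
qed

definition jump_part :: "('a::euclidean_space \<times> real \<Rightarrow> complex) \<Rightarrow> 'a \<Rightarrow> complex" where
  "jump_part u x = (LINT z|\<mu>. u (x, z) - u (x, 0))"

text \<open>The increments have slices bounded in L^2 uniformly in z and \<mu> is finite, so they
  are square integrable on the product space. This gives existence of the jump integral for almost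
  every x as well as its square integrability, and the symbol follows by pairing with a transform
  and exchanging integrals.\<close>

lemma jump_part_fourier:
  fixes f :: "'a::euclidean_space \<Rightarrow> complex"
  assumes u: "dirichlet_solution f u" and fk: "fourier_pair f k"
  shows "AE x in lborel. integrable \<mu> (\<lambda>z. u (x, z) - u (x, 0))"
    and "fourier_pair (jump_part u) (\<lambda>\<xi>. - complex_of_real (levy_integral (norm \<xi>)) * k \<xi>)"
proof -
  interpret P: pair_sigma_finite \<mu> "lborel :: 'a measure" ..
  have f: "f \<in> L2_space lborel" and k: "k \<in> L2_space lborel" using fourier_pairD[OF fk] by auto
  have [measurable]: "f \<in> borel_measurable borel" "k \<in> borel_measurable borel"
    using L2_spaceD(1)[OF f] L2_spaceD(1)[OF k] by auto
  have c: "continuous_on half_space u" by (rule dirichlet_solution_continuous[OF u])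
  have u0: "u (x, 0) = f x" for x using u by (simp add: dirichlet_solution_def)
  have inc: "(\<lambda>p. increment u (fst p) (snd p)) \<in> borel_measurable (borel \<Otimes>\<^sub>M borel)"
    by (rule increment_measurable[OF c]) (simp add: u0)
  have mu: "(\<lambda>z. z) \<in> \<mu> \<rightarrow>\<^sub>M borel" by (rule ident_measurable_mu)
  have swap: "(\<lambda>p. (snd p, fst p)) \<in> \<mu> \<Otimes>\<^sub>M (lborel :: 'a measure) \<rightarrow>\<^sub>M borel \<Otimes>\<^sub>M borel"
    by (intro measurable_Pair measurable_compose[OF measurable_fst mu])
      (simp add: measurable_snd''[OF measurable_ident_sets[OF sets_lborel]])
  have Dm [measurable]: "(\<lambda>(z, x). increment u x z) \<in> borel_measurable (\<mu> \<Otimes>\<^sub>M lborel)"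
    using measurable_compose[OF swap inc] by (simp add: split_beta')
  have D: "fourier_pair (\<lambda>x. increment u x z) (\<lambda>\<xi>. damp z k \<xi> - k \<xi>)" if "z \<in> space \<mu>" for z
  proof -
    have z: "0 \<le> z" using that by (simp add: space_mu)
    have "fourier_pair (\<lambda>x. u (x, z) - u (x, 0)) (\<lambda>\<xi>. damp z k \<xi> - damp 0 k \<xi>)"
      using z by (intro fourier_pair_diff dirichlet_solution_fourier[OF u fk]) auto
    then show ?thesis by (simp add: increment_eq[OF that] damp_def[of 0])
  qed
  have dk: "norm (damp z k \<xi> - k \<xi>) \<le> norm (k \<xi>)" if "z \<in> space \<mu>" for z \<xi>
  proof -
    have z: "0 \<le> z" using that by (simp add: space_mu)
    have "damp z k \<xi> - k \<xi> = complex_of_real (exp (- (z * norm \<xi>)) - 1) * k \<xi>"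
      by (simp add: damp_def algebra_simps)
    also have "norm \<dots> \<le> 1 * norm (k \<xi>)"
      unfolding norm_mult norm_of_real using z by (intro mult_right_mono) auto
    finally show ?thesis by simp
  qed
  define B where "B = L2_norm lborel k / sqrt ((2 * pi) ^ DIM('a))"
  have DB: "L2_norm lborel (\<lambda>x. increment u x z) \<le> B" if "z \<in> space \<mu>" for z
    unfolding fourier_pair_norm'[OF D[OF that]] B_def
    by (intro divide_right_mono L2_norm_mono_AE fourier_pairD(2)[OF D[OF that]] k) (auto simp: dk[OF that])
  \<comment> \<open>Each inner integral is at most B^2, and constants are integrable for a finite
    measure.\<close>
  have sq: "integrable (\<mu> \<Otimes>\<^sub>M lborel) (\<lambda>(z, x). (norm (increment u x z))\<^sup>2)"
  proof (rule P.Fubini_integrable)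
    show "(\<lambda>(z, x). (norm (increment u x z))\<^sup>2) \<in> borel_measurable (\<mu> \<Otimes>\<^sub>M lborel)" by measurable
    show "AE z in \<mu>. integrable lborel (\<lambda>x. case (z, x) of (z, x) \<Rightarrow> (norm (increment u x z))\<^sup>2)"
      using L2_spaceD(2)[OF fourier_pairD(1)[OF D]] by (intro AE_I2) simp
    show "integrable \<mu> (\<lambda>z. LINT x|lborel. norm (case (z, x) of (z, x) \<Rightarrow> (norm (increment u x z))\<^sup>2))"
    proof (rule integrable_const_bound[of _ "B\<^sup>2"])
      show "AE z in \<mu>. norm (LINT x|lborel. norm (case (z, x) of (z, x) \<Rightarrow> (norm (increment u x z))\<^sup>2)) \<le> B\<^sup>2"
        using power_mono[OF DB L2_norm_nonneg, of _ 2] by (intro AE_I2) (simp add: L2_norm_sq)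
    qed measurable
  qed
  have sqx: "AE x in lborel. integrable \<mu> (\<lambda>z. (norm (increment u x z))\<^sup>2)"
    by (rule P.AE_integrable_snd[OF sq])
  have mx: "(\<lambda>z. increment u x z) \<in> borel_measurable \<mu>" for x by measurable
  have one: "(\<lambda>_. 1) \<in> L2_space \<mu>" by (simp add: L2_space_def)
  have L: "AE x in lborel. (\<lambda>z. increment u x z) \<in> L2_space \<mu>"
    using sqx by (rule AE_mp) (auto intro!: AE_I2 simp: L2_space_def mx)
  have jump: "jump_part u x = (LINT z|\<mu>. increment u x z)" for x
    unfolding jump_part_def by (intro Bochner_Integration.integral_cong refl increment_eq)
  show "AE x in lborel. integrable \<mu> (\<lambda>z. u (x, z) - u (x, 0))"
    using L
  proof (rule AE_mp, intro AE_I2 impI)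
    fix x assume "(\<lambda>z. increment u x z) \<in> L2_space \<mu>"
    from L2_mult_integrable[OF this one] show "integrable \<mu> (\<lambda>z. u (x, z) - u (x, 0))"
      by (subst Bochner_Integration.integrable_cong[OF refl increment_eq]) auto
  qed
  have jm: "jump_part u \<in> borel_measurable lborel"
    unfolding jump[abs_def] by measurable
  show "fourier_pair (jump_part u) (\<lambda>\<xi>. - complex_of_real (levy_integral (norm \<xi>)) * k \<xi>)"
    unfolding fourier_pair_def
  proof (intro conjI ballI impI)
    \<comment> \<open>Cauchy-Schwarz in z against the constant 1: the squared jump is at most the
      mass of \<mu> times the \<mu>-integral of the squared increments.\<close>
    have "integrable lborel (\<lambda>x. (L2_norm \<mu> (\<lambda>_. 1))\<^sup>2 * (LINT z|\<mu>. (norm (increment u x z))\<^sup>2))"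
      by (intro integrable_mult_right P.integrable_snd[OF sq])
    then have "integrable lborel (\<lambda>x. (norm (jump_part u x))\<^sup>2)"
    proof (rule Bochner_Integration.integrable_bound)
      show "(\<lambda>x. (norm (jump_part u x))\<^sup>2) \<in> borel_measurable lborel" using jm by measurable
      show "AE x in lborel. norm ((norm (jump_part u x))\<^sup>2) \<le> norm ((L2_norm \<mu> (\<lambda>_. 1))\<^sup>2 * (LINT z|\<mu>. (norm (increment u x z))\<^sup>2))"
        using L
      proof (rule AE_mp, intro AE_I2 impI)
        fix x assume "(\<lambda>z. increment u x z) \<in> L2_space \<mu>"
        from L2_Cauchy_Schwarz(2)[OF one this]
        have "norm (jump_part u x) \<le> L2_norm \<mu> (\<lambda>_. 1) * L2_norm \<mu> (\<lambda>z. increment u x z)" by (simp add: jump)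
        from power_mono[OF this norm_ge_zero, of 2]
        show "norm ((norm (jump_part u x))\<^sup>2) \<le> norm ((L2_norm \<mu> (\<lambda>_. 1))\<^sup>2 * (LINT z|\<mu>. (norm (increment u x z))\<^sup>2))"
          by (simp add: power_mult_distrib L2_norm_sq[of \<mu> "\<lambda>z. increment u x z"] abs_mult)
      qed
    qed
    then show "jump_part u \<in> L2_space lborel" using jm by (simp add: L2_space_def)
    show "(\<lambda>\<xi>. - complex_of_real (levy_integral (norm \<xi>)) * k \<xi>) \<in> L2_space lborel"
      by (rule L2_space_bound[OF k, of _ "measure \<mu> (space \<mu>)"])
        (measurable, auto intro!: AE_I2 mult_right_mono simp: norm_mult levy_integral_bounds)
    fix g :: "'a \<Rightarrow> complex" assume g: "g \<in> L2_space lborel" "integrable lborel g"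
    note [measurable] = fourier_integral_measurable[OF g(2)]
    have [measurable]: "g \<in> borel_measurable borel" using L2_spaceD(1)[OF g(1)] by simp
    have gh: "fourier_integral g \<in> L2_space lborel" by (rule fourier_integral_L2[OF g])
    have int1: "integrable (\<mu> \<Otimes>\<^sub>M lborel) (\<lambda>(z, x). increment u x z * fourier_integral g x)"
    proof (rule P.Fubini_integrable)
      show "(\<lambda>(z, x). increment u x z * fourier_integral g x) \<in> borel_measurable (\<mu> \<Otimes>\<^sub>M lborel)" by measurable
      show "AE z in \<mu>. integrable lborel (\<lambda>x. case (z, x) of (z, x) \<Rightarrow> increment u x z * fourier_integral g x)"
        by (intro AE_I2) (simp add: L2_mult_integrable[OF fourier_pairD(1)[OF D] gh])
      show "integrable \<mu> (\<lambda>z. LINT x|lborel. norm (case (z, x) of (z, x) \<Rightarrow> increment u x z * fourier_integral g x))"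
      proof (rule integrable_const_bound[of _ "B * L2_norm lborel (fourier_integral g)"])
        show "AE z in \<mu>. norm (LINT x|lborel. norm (case (z, x) of (z, x) \<Rightarrow> increment u x z * fourier_integral g x))
            \<le> B * L2_norm lborel (fourier_integral g)"
        proof (intro AE_I2)
          fix z assume z: "z \<in> space \<mu>"
          have "(LINT x|lborel. norm (increment u x z * fourier_integral g x)) \<le> B * L2_norm lborel (fourier_integral g)"
            using L2_Cauchy_Schwarz(1)[OF fourier_pairD(1)[OF D[OF z]] gh] mult_right_mono[OF DB[OF z] L2_norm_nonneg]
            by (rule order_trans)
          then show "norm (LINT x|lborel. norm (case (z, x) of (z, x) \<Rightarrow> increment u x z * fourier_integral g x))
            \<le> B * L2_norm lborel (fourier_integral g)" by simp
        qed
      qed measurable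
    qed
    have kg: "integrable lborel (\<lambda>\<xi>. k \<xi> * g \<xi>)" by (rule L2_mult_integrable[OF k g(1)])
    have int2: "integrable (\<mu> \<Otimes>\<^sub>M lborel) (\<lambda>(z, \<xi>). (damp z k \<xi> - k \<xi>) * g \<xi>)"
    proof (rule P.Fubini_integrable)
      show "(\<lambda>(z, \<xi>). (damp z k \<xi> - k \<xi>) * g \<xi>) \<in> borel_measurable (\<mu> \<Otimes>\<^sub>M lborel)"
        unfolding damp_def by measurable
      show "AE z in \<mu>. integrable lborel (\<lambda>\<xi>. case (z, \<xi>) of (z, \<xi>) \<Rightarrow> (damp z k \<xi> - k \<xi>) * g \<xi>)"
        by (intro AE_I2) (simp add: L2_mult_integrable[OF fourier_pairD(2)[OF D] g(1)])
      show "integrable \<mu> (\<lambda>z. LINT \<xi>|lborel. norm (case (z, \<xi>) of (z, \<xi>) \<Rightarrow> (damp z k \<xi> - k \<xi>) * g \<xi>))"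
      proof (rule integrable_const_bound[of _ "LINT \<xi>|lborel. norm (k \<xi> * g \<xi>)"])
        show "AE z in \<mu>. norm (LINT \<xi>|lborel. norm (case (z, \<xi>) of (z, \<xi>) \<Rightarrow> (damp z k \<xi> - k \<xi>) * g \<xi>))
            \<le> (LINT \<xi>|lborel. norm (k \<xi> * g \<xi>))"
        proof (intro AE_I2)
          fix z assume z: "z \<in> space \<mu>"
          have "(LINT \<xi>|lborel. norm ((damp z k \<xi> - k \<xi>) * g \<xi>)) \<le> (LINT \<xi>|lborel. norm (k \<xi> * g \<xi>))"
            by (intro integral_mono integrable_norm kg L2_mult_integrable[OF fourier_pairD(2)[OF D[OF z]] g(1)])
              (simp add: norm_mult mult_right_mono dk[OF z])
          then show "norm (LINT \<xi>|lborel. norm (case (z, \<xi>) of (z, \<xi>) \<Rightarrow> (damp z k \<xi> - k \<xi>) * g \<xi>))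
            \<le> (LINT \<xi>|lborel. norm (k \<xi> * g \<xi>))" by simp
        qed
        show "(\<lambda>z. LINT \<xi>|lborel. norm (case (z, \<xi>) of (z, \<xi>) \<Rightarrow> (damp z k \<xi> - k \<xi>) * g \<xi>)) \<in> borel_measurable \<mu>"
          unfolding damp_def by measurable
      qed
    qed
    \<comment> \<open>Fubini to fix z, the slice relation to pass from x to \<xi>, and Fubini back
      to let the z-integral act on the multiplier alone.\<close>
    have "(LINT x|lborel. jump_part u x * fourier_integral g x) = (LINT x|lborel. (LINT z|\<mu>. increment u x z * fourier_integral g x))"
      by (simp add: jump)
    also have "\<dots> = (LINT z|\<mu>. (LINT x|lborel. increment u x z * fourier_integral g x))"
      using P.Fubini_integral[OF int1] by simp
    also have "\<dots> = (LINT z|\<mu>. (LINT \<xi>|lborel. (damp z k \<xi> - k \<xi>) * g \<xi>))"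
      by (intro Bochner_Integration.integral_cong refl fourier_pairD(3)[OF D g])
    also have "\<dots> = (LINT \<xi>|lborel. (LINT z|\<mu>. (damp z k \<xi> - k \<xi>) * g \<xi>))"
      using P.Fubini_integral[OF int2] by simp
    also have "\<dots> = (LINT \<xi>|lborel. - complex_of_real (levy_integral (norm \<xi>)) * k \<xi> * g \<xi>)"
    proof (intro Bochner_Integration.integral_cong refl)
      fix \<xi> :: 'a
      have "(LINT z|\<mu>. (damp z k \<xi> - k \<xi>) * g \<xi>) = (LINT z|\<mu>. complex_of_real (1 - exp (- (norm \<xi> * z))) * (- k \<xi> * g \<xi>))"
        by (intro Bochner_Integration.integral_cong refl) (simp add: damp_def algebra_simps)
      also have "\<dots> = complex_of_real (levy_integral (norm \<xi>)) * (- k \<xi> * g \<xi>)"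
        unfolding levy_integral_def integral_complex_of_real[symmetric] by (rule integral_mult_left_zero)
      finally show "(LINT z|\<mu>. (damp z k \<xi> - k \<xi>) * g \<xi>) = - complex_of_real (levy_integral (norm \<xi>)) * k \<xi> * g \<xi>"
        by simp
    qed
    finally show "(LINT x|lborel. jump_part u x * fourier_integral g x) =
       (LINT \<xi>|lborel. - complex_of_real (levy_integral (norm \<xi>)) * k \<xi> * g \<xi>)" .
  qed
qed

end

section \<open>Square integrability in the half-space and the conclusion\<close>

subsection \<open>Square integrability on the half-space\<close>

lemma nn_integral_exp_half_line:
  assumes l: "0 < l" shows "(\<integral>\<^sup>+y. indicator {0<..} y * ennreal (exp (- (l * y))) \<partial>lborel) \<le> ennreal (1 / l)"
proof -
  interpret prob_space "density lborel (exponential_density l)"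
    by (rule prob_space_exponential_density[OF l])
  have 1: "(\<integral>\<^sup>+t. ennreal (exponential_density l t) \<partial>lborel) = 1"
    using emeasure_space_1 by (simp add: emeasure_density)
  have "(\<integral>\<^sup>+y. indicator {0<..} y * ennreal (exp (- (l * y))) \<partial>lborel) \<le> (\<integral>\<^sup>+y. ennreal (1 / l) * ennreal (exponential_density l y) \<partial>lborel)"
  proof (rule nn_integral_mono)
    fix y :: real
    show "indicator {0<..} y * ennreal (exp (- (l * y))) \<le> ennreal (1 / l) * ennreal (exponential_density l y)"
      using l by (cases "0 < y") (auto simp: exponential_density_def ennreal_mult[symmetric] mult.commute)
  qed
  also have "\<dots> = ennreal (1 / l)" by (subst nn_integral_cmult) (auto simp: 1)
  finally show ?thesis .
qed

text \<open>Everything runs with nonnegative extended integrals, so Tonelli applies before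
  finiteness is known; the finiteness comes only at the end, from the Sobolev weight.\<close>

lemma dirichlet_solution_L2_half_space:
  fixes f :: "'a::euclidean_space \<Rightarrow> complex"
  assumes u: "dirichlet_solution f u" and fk: "fourier_pair f k"
    and hs: "integrable lborel (\<lambda>\<xi>. norm \<xi> powr (2 * (- 1/2)) * (norm (k \<xi>))\<^sup>2)"
  shows "u \<in> L2_space (restrict_space lborel half_space)"
proof -
  have k: "k \<in> L2_space lborel" by (rule fourier_pairD(2)[OF fk])
  have [measurable]: "k \<in> borel_measurable borel" using L2_spaceD(1)[OF k] by simp
  have c: "continuous_on half_space u" by (rule dirichlet_solution_continuous[OF u])
  have H [measurable]: "half_space \<in> sets (borel :: ('a \<times> real) measure)" by (rule borel_open[OF open_half_space])
  \<comment> \<open>u is unconstrained for y < 0, so it is replaced by 0 outside the half-space to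
    obtain a Borel function on the whole space.\<close>
  define v where "v p = indicator half_space p *\<^sub>R u p" for p
  have v: "v \<in> borel_measurable borel"
    unfolding v_def[abs_def] by (rule borel_measurable_continuous_on_indicator[OF H c])
  then have v' [measurable]: "v \<in> borel_measurable (borel \<Otimes>\<^sub>M borel)" by (simp add: borel_prod)
  let ?C = "(2 * pi) ^ DIM('a)"
  have slice: "(\<integral>\<^sup>+x. ennreal ((norm (v (x, y)))\<^sup>2) \<partial>lborel) \<le>
      (\<integral>\<^sup>+\<xi>. ennreal ((norm (k \<xi>))\<^sup>2) * (indicator {0<..} y * ennreal (exp (- (2 * norm \<xi> * y)))) \<partial>lborel)" for y
  proof (cases "0 < y")
    case True
    have fy: "fourier_pair (\<lambda>x. u (x, y)) (damp y k)"
      using True by (intro dirichlet_solution_fourier[OF u fk]) simp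
    have "(\<integral>\<^sup>+x. ennreal ((norm (v (x, y)))\<^sup>2) \<partial>lborel) = (\<integral>\<^sup>+x. ennreal ((norm (u (x, y)))\<^sup>2) \<partial>lborel)"
      using True by (simp add: v_def half_space_def)
    also have "\<dots> = ennreal ((L2_norm lborel (\<lambda>x. u (x, y)))\<^sup>2)"
      unfolding L2_norm_sq by (rule nn_integral_eq_integral[OF L2_spaceD(2)[OF fourier_pairD(1)[OF fy]]]) simp
    also have "\<dots> \<le> ennreal ((L2_norm lborel (damp y k))\<^sup>2)"
    proof (rule ennreal_leI)
      \<comment> \<open>Only finiteness is at stake, so the Plancherel constant, which is at least
        1, is dropped.\<close>
      have "1 * (L2_norm lborel (\<lambda>x. u (x, y)))\<^sup>2 \<le> ?C * (L2_norm lborel (\<lambda>x. u (x, y)))\<^sup>2"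
        using pi_ge_two by (intro mult_right_mono one_le_power) auto
      then show "(L2_norm lborel (\<lambda>x. u (x, y)))\<^sup>2 \<le> (L2_norm lborel (damp y k))\<^sup>2"
        by (simp add: fourier_pair_norm[OF fy])
    qed
    also have "\<dots> = (\<integral>\<^sup>+\<xi>. ennreal ((norm (damp y k \<xi>))\<^sup>2) \<partial>lborel)"
      unfolding L2_norm_sq by (rule nn_integral_eq_integral[OF L2_spaceD(2)[OF fourier_pairD(2)[OF fy]], symmetric]) simp
    also have "\<dots> = (\<integral>\<^sup>+\<xi>. ennreal ((norm (k \<xi>))\<^sup>2) * (indicator {0<..} y * ennreal (exp (- (2 * norm \<xi> * y)))) \<partial>lborel)"
    proof (rule nn_integral_cong)
      fix \<xi> :: 'a
      have "(exp (- (y * norm \<xi>)))\<^sup>2 = exp (- (2 * norm \<xi> * y))"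
        by (simp add: power2_eq_square exp_add[symmetric] mult_ac)
      then have "(norm (damp y k \<xi>))\<^sup>2 = (norm (k \<xi>))\<^sup>2 * exp (- (2 * norm \<xi> * y))"
        by (simp add: norm_damp power_mult_distrib mult.commute)
      then show "ennreal ((norm (damp y k \<xi>))\<^sup>2) = ennreal ((norm (k \<xi>))\<^sup>2) * (indicator {0<..} y * ennreal (exp (- (2 * norm \<xi> * y))))"
        using True by (simp add: ennreal_mult)
    qed
    finally show ?thesis .
  qed (simp add: v_def half_space_def)
  have "(\<integral>\<^sup>+p. ennreal ((norm (v p))\<^sup>2) \<partial>lborel) = (\<integral>\<^sup>+y. (\<integral>\<^sup>+x. ennreal ((norm (v (x, y)))\<^sup>2) \<partial>lborel) \<partial>lborel)"
    unfolding lborel_prod[symmetric] by (rule lborel_pair.nn_integral_snd[symmetric]) measurable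
  also have "\<dots> \<le> (\<integral>\<^sup>+y. (\<integral>\<^sup>+\<xi>. ennreal ((norm (k \<xi>))\<^sup>2) * (indicator {0<..} y * ennreal (exp (- (2 * norm \<xi> * y)))) \<partial>lborel) \<partial>lborel)"
    by (intro nn_integral_mono slice)
  also have "\<dots> = (\<integral>\<^sup>+\<xi>. (\<integral>\<^sup>+y. ennreal ((norm (k \<xi>))\<^sup>2) * (indicator {0<..} y * ennreal (exp (- (2 * norm \<xi> * y)))) \<partial>lborel) \<partial>lborel)"
    by (rule lborel_pair.Fubini') measurable
  also have "\<dots> = (\<integral>\<^sup>+\<xi>. ennreal ((norm (k \<xi>))\<^sup>2) * (\<integral>\<^sup>+y. indicator {0<..} y * ennreal (exp (- (2 * norm \<xi> * y))) \<partial>lborel) \<partial>lborel)"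
    by (intro nn_integral_cong nn_integral_cmult) measurable
  also have "\<dots> \<le> (\<integral>\<^sup>+\<xi>. ennreal (norm \<xi> powr (2 * (- 1/2)) * (norm (k \<xi>))\<^sup>2) \<partial>lborel)"
  \<comment> \<open>The origin has to be removed: the y-integral is infinite there, while
    \<open>powr\<close> has the value 0 at base 0.\<close>
  proof (rule nn_integral_mono_AE, rule AE_mp[OF AE_lborel_singleton[of 0]], intro AE_I2 impI)
    fix \<xi> :: 'a assume "\<xi> \<noteq> 0"
    then have n: "0 < norm \<xi>" by simp
    have "(\<integral>\<^sup>+y. indicator {0<..} y * ennreal (exp (- (2 * norm \<xi> * y))) \<partial>lborel) \<le> ennreal (1 / (2 * norm \<xi>))"
      using n by (intro nn_integral_exp_half_line) simp
    also have "\<dots> \<le> ennreal (norm \<xi> powr (2 * (- 1/2)))"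
      using n by (intro ennreal_leI) (simp add: powr_minus divide_simps)
    finally have "ennreal ((norm (k \<xi>))\<^sup>2) * (\<integral>\<^sup>+y. indicator {0<..} y * ennreal (exp (- (2 * norm \<xi> * y))) \<partial>lborel)
      \<le> ennreal ((norm (k \<xi>))\<^sup>2) * ennreal (norm \<xi> powr (2 * (- 1/2)))"
      by (rule mult_left_mono) simp
    also have "\<dots> = ennreal (norm \<xi> powr (2 * (- 1/2)) * (norm (k \<xi>))\<^sup>2)"
      by (simp add: ennreal_mult[symmetric] mult.commute)
    finally show "ennreal ((norm (k \<xi>))\<^sup>2) * (\<integral>\<^sup>+y. indicator {0<..} y * ennreal (exp (- (2 * norm \<xi> * y))) \<partial>lborel)
      \<le> ennreal (norm \<xi> powr (2 * (- 1/2)) * (norm (k \<xi>))\<^sup>2)" .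
  qed
  also have "\<dots> < \<infinity>"
    using nn_integral_eq_integral[OF hs] by simp
  finally have fin: "(\<integral>\<^sup>+p. ennreal ((norm (v p))\<^sup>2) \<partial>lborel) < \<infinity>" .
  have "integrable lborel (\<lambda>p. (norm (v p))\<^sup>2)"
    using fin v by (intro integrableI_bounded) auto
  also have "(\<lambda>p. (norm (v p))\<^sup>2) = (\<lambda>p. indicator half_space p *\<^sub>R (norm (u p))\<^sup>2)"
    by (auto simp: v_def indicator_def)
  finally have "integrable (restrict_space lborel half_space) (\<lambda>p. (norm (u p))\<^sup>2)"
    by (subst integrable_restrict_space) auto
  moreover have "u \<in> borel_measurable (restrict_space lborel half_space)"
    using borel_measurable_continuous_on_restrict[OF c]
    by (simp add: measurable_cong_sets[OF sets_restrict_space_cong[OF sets_lborel] refl])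
  ultimately show ?thesis by (simp add: L2_space_def)
qed

text \<open>A transform is determined up to null sets, so the symbol formula is claimed for every
  version, with existence stated separately. Existence of the normal derivative and of the jump
  integrals is also claimed, since a choice or a Bochner integral denotes some value even without
  it.\<close>

theorem theorem6:
  fixes \<mu> :: "real measure"
    and f :: "'a::euclidean_space \<Rightarrow> complex"
    and u :: "'a \<times> real \<Rightarrow> complex"
  assumes "sets \<mu> = sets (restrict_space borel {0..})"
    and "finite_measure \<mu>"
    and "0 < measure \<mu> {0..}"
    and "f \<in> H_symbol (levy_symbol \<mu>)"
    and "regular_distribution f \<in> homogeneous_sobolev (- 1/2)"
    and "dirichlet_solution f u"
  shows "has_normal_derivative u (normal_derivative u) \<and>
         (AE x in lborel. integrable \<mu> (\<lambda>z. u (x, z) - u (x, 0))) \<and>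
         (\<exists>fh. has_fourier_fun f fh) \<and>
         (\<forall>fh. has_fourier_fun f fh \<longrightarrow>
            has_fourier_fun (nonlocal_boundary_op \<mu> u)
              (\<lambda>\<xi>. - complex_of_real (levy_symbol \<mu> (norm \<xi>)) * fh \<xi>)) \<and>
         nonlocal_boundary_op \<mu> u \<in> L2_space lborel \<and>
         u \<in> L2_space (restrict_space lborel half_space)"
proof -
  interpret finite_levy_measure \<mu>
    using assms(1,2) by (simp add: finite_levy_measure_def finite_levy_measure_axioms_def)
  note u = assms(6)
  obtain g where f: "f \<in> L2_space lborel" and g: "has_fourier_fun f g"
    and \<Phi>g: "(\<lambda>\<xi>. complex_of_real (levy_symbol \<mu> (norm \<xi>)) * g \<xi>) \<in> L2_space lborel"
    using assms(4) by (auto simp: H_symbol_def)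
  obtain h where h: "has_fourier_fun f h"
    and hs: "integrable lborel (\<lambda>\<xi>. norm \<xi> powr (2 * (- 1/2)) * (norm (h \<xi>))\<^sup>2)"
    using assms(5) by (auto simp: homogeneous_sobolev_def)
  have K: "fourier_pair (nonlocal_boundary_op \<mu> u) (\<lambda>\<xi>. - complex_of_real (levy_symbol \<mu> (norm \<xi>)) * k \<xi>)"
    and nd: "has_normal_derivative u (normal_derivative u)" if k: "has_fourier_fun f k" for k
  proof -
    have fk: "fourier_pair f k" by (rule has_fourier_imp_fourier_pair[OF f k])
    have [measurable]: "k \<in> borel_measurable borel" using L2_spaceD(1)[OF fourier_pairD(2)[OF fk]] by simp
    \<comment> \<open>The version k may differ from the g supplied by the weighted space, but only
      on a null set; |\<xi>| \<le> Phi(|\<xi>|) then puts |\<xi>| k into L^2, as the normal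
      derivative requires.\<close>
    have "AE \<xi> in lborel. norm (complex_of_real (norm \<xi>) * k \<xi>) \<le> 1 * norm (complex_of_real (levy_symbol \<mu> (norm \<xi>)) * g \<xi>)"
      using has_fourier_unique[OF k g]
    proof (rule AE_mp, intro AE_I2 impI)
      fix \<xi> assume "k \<xi> = g \<xi>"
      then show "norm (complex_of_real (norm \<xi>) * k \<xi>) \<le> 1 * norm (complex_of_real (levy_symbol \<mu> (norm \<xi>)) * g \<xi>)"
        using levy_integral_bounds(1)[of "norm \<xi>"] unfolding norm_mult norm_of_real levy_symbol_eq
        by (simp add: mult_right_mono)
    qed
    then have nk: "(\<lambda>\<xi>. complex_of_real (norm \<xi>) * k \<xi>) \<in> L2_space lborel"
      by (rule L2_space_bound[OF \<Phi>g, rotated]) measurable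
    show "has_normal_derivative u (normal_derivative u)"
      by (rule normal_derivative_fourier(1)[OF u fk nk])
    have "fourier_pair (\<lambda>x. normal_derivative u x + jump_part u x)
        (\<lambda>\<xi>. - complex_of_real (norm \<xi>) * k \<xi> + - complex_of_real (levy_integral (norm \<xi>)) * k \<xi>)"
      by (intro fourier_pair_add normal_derivative_fourier(2)[OF u fk nk] jump_part_fourier(2)[OF u fk])
    also have "(\<lambda>x. normal_derivative u x + jump_part u x) = nonlocal_boundary_op \<mu> u"
      by (simp add: fun_eq_iff nonlocal_boundary_op_def jump_part_def)
    finally show "fourier_pair (nonlocal_boundary_op \<mu> u) (\<lambda>\<xi>. - complex_of_real (levy_symbol \<mu> (norm \<xi>)) * k \<xi>)"
      by (simp add: levy_symbol_eq algebra_simps)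
  qed
  show ?thesis
  proof (intro conjI allI impI)
    show "has_normal_derivative u (normal_derivative u)" by (rule nd[OF g])
    show "AE x in lborel. integrable \<mu> (\<lambda>z. u (x, z) - u (x, 0))"
      by (rule jump_part_fourier(1)[OF u has_fourier_imp_fourier_pair[OF f g]])
    show "\<exists>fh. has_fourier_fun f fh" using g by blast
    show "nonlocal_boundary_op \<mu> u \<in> L2_space lborel" by (rule fourier_pairD(1)[OF K[OF g]])
    show "u \<in> L2_space (restrict_space lborel half_space)"
      by (rule dirichlet_solution_L2_half_space[OF u has_fourier_imp_fourier_pair[OF f h] hs])
    fix fh assume fh: "has_fourier_fun f fh"
    show "has_fourier_fun (nonlocal_boundary_op \<mu> u) (\<lambda>\<xi>. - complex_of_real (levy_symbol \<mu> (norm \<xi>)) * fh \<xi>)"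
      by (rule fourier_pair_imp_has_fourier[OF K[OF fh]])
  qed
qed

end
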